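(* Let $d\ge1$, $b\ge 2$, and let $f(X)=g(X)1_{\Omega}(X)$, where $g\in C^1([0,1]^d)$, $\Omega\subset[0,1]^d$, and $\partial\Omega$ admits a $(d-1)$-dimensional Minkowski content. Let $\mu=\int_{[0,1]^d}f(X)\,\mathrm{d}X$ and suppose $\sigma_\Omega^2=\int_{\Omega}\Vert\nabla g(X)\Vert^{2}\,\mathrm{d} X>0$. Let $\hat{\mu}_n$ be the HSFC-based estimate with $n=b^m$ points defined below. Then for all sufficiently large $n=b^m$, $$\mathrm{Var}(\hat{\mu}_{n})\geq \frac{\sigma_\Omega^2}{96}\,2^{-2/d-d}\,n^{-1-2/d}.$$ Moreover, if $d>2$, then $$\frac{\hat{\mu}_{n}-\mu}{\sqrt{\mathrm{Var}(\hat{\mu}_{n})}}\to N(0,1)$$ in distribution as $n=b^m\to\infty$.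
   Context: For $A\subset\mathbb{R}^d$ and $\epsilon>0$ let $(A)_\epsilon=\{x+y: x\in A,\ \Vert y\Vert\le\epsilon\}$, and let $\lambda_d$ be Lebesgue measure on $\mathbb{R}^d$. The boundary $\partial\Omega$ admits a $(d-1)$-dimensional Minkowski content if $\mathcal{M}(\partial\Omega)=\lim_{\epsilon\downarrow0}\lambda_d((\partial\Omega)_\epsilon)/(2\epsilon)$ exists and is finite. $H:[0,1]\to[0,1]^d$ denotes the $d$-dimensional Hilbert space-filling curve (the continuous surjection obtained as the limit of the standard recursive Hilbert curve construction, e.g. Butz's algorithm; for $d=1$, $H(x)=x$). Van der Corput sequence in base $b$: writing $i-1=\sum_{j\ge1}a_{ij}b^{j-1}$ with digits $a_{ij}\in\{0,\dots,b-1\}$, set $a_i=\sum_{j\ge1}a_{ij}b^{-j}$. Its nested uniform (Owen) scrambling is $x_i=\sum_{j\ge1}x_{ij}b^{-j}$ with $x_{i1}=\pi(a_{i1})$ and $x_{ij}=\pi_{a_{i1}\dots a_{i,j-1}}(a_{ij})$ for $j\ge 2$, where all these permutations are mutually independent and each uniformly distributed over the $b!$ permutations of $\{0,\dots,b-1\}$. The HSFC-based estimate is $\hat{\mu}_n=\frac1n\sum_{i=1}^n f(H(x_i))$ with $x_1,\dots,x_n$ the first $n=b^m$ scrambled points. $\Vert\cdot\Vert$ is the Euclidean norm. *)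

theory Defs
  imports "HOL-Analysis.Analysis" "HOL-Probability.Probability"
begin

definition eps_nbhd :: "'a::euclidean_space set \<Rightarrow> real \<Rightarrow> 'a set" where
  "eps_nbhd A \<epsilon> = {x + y | x y. x \<in> A \<and> norm y \<le> \<epsilon>}"

definition has_minkowski_content :: "'a::euclidean_space set \<Rightarrow> bool" where
  "has_minkowski_content A \<longleftrightarrow>
     (\<exists>L::real. ((\<lambda>\<epsilon>. measure lborel (eps_nbhd A \<epsilon>) / (2 * \<epsilon>)) \<longlongrightarrow> L) (at_right 0))"

section \<open>The d-dimensional Hilbert curve (Butz's algorithm, in Hamilton's formulation)\<close>

text \<open>d-bit words are naturals below 2^d; bit j of a word is coordinate j.\<close>

definition rotl :: "nat \<Rightarrow> nat \<Rightarrow> nat \<Rightarrow> nat" where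
  "rotl d r x = (let r' = r mod d in (x * 2 ^ r') mod 2 ^ d + x div 2 ^ (d - r'))"

definition gray :: "nat \<Rightarrow> nat" where
  "gray w = xor w (w div 2)"

definition trailing_ones :: "nat \<Rightarrow> nat" where
  "trailing_ones i = (LEAST k. even (i div 2 ^ k))"

text \<open>entry point e(w) and intra-direction d(w) of sub-hypercube w\<close>
definition hentry :: "nat \<Rightarrow> nat" where
  "hentry w = (if w = 0 then 0 else gray (2 * ((w - 1) div 2)))"

definition hdir :: "nat \<Rightarrow> nat \<Rightarrow> nat" where
  "hdir d w = (if w = 0 then 0 else if even w then trailing_ones (w - 1) mod d
               else trailing_ones w mod d)"

text \<open>One refinement step: state (e, dir, p) and the next d-bit digit w of the index.\<close>
definition hstep :: "nat \<Rightarrow> nat \<times> nat \<times> (nat \<Rightarrow> nat) \<Rightarrow> nat \<Rightarrow> nat \<times> nat \<times> (nat \<Rightarrow> nat)" where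
  "hstep d s w = (case s of (e, r, p) \<Rightarrow>
     (let l = xor (rotl d (r + 1) (gray w)) e
      in (xor e (rotl d (r + 1) (hentry w)), (r + hdir d w + 1) mod d,
          (\<lambda>j. 2 * p j + l div 2 ^ j mod 2))))"

text \<open>Level-k Hilbert curve: index h < 2^(d k) is mapped to the integer corner
  (coordinate j in 0..2^k-1) of the h-th subcube of side 2^-k.\<close>
definition hilbert_cell :: "nat \<Rightarrow> nat \<Rightarrow> nat \<Rightarrow> (nat \<Rightarrow> nat)" where
  "hilbert_cell d k h =
     snd (snd (foldl (hstep d) (0, 0, \<lambda>_. 0) (map (\<lambda>i. h div 2 ^ (d * i) mod 2 ^ d) (rev [0..<k]))))"

definition coord_idx :: "'n::finite \<Rightarrow> nat" where
  "coord_idx = (SOME f. bij_betw f (UNIV :: 'n set) {..<CARD('n)})"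

definition hilbert_curve :: "real \<Rightarrow> real ^ 'n::finite" where
  "hilbert_curve x = lim (\<lambda>k. \<chi> i. real (hilbert_cell CARD('n) k
        (min (nat \<lfloor>x * 2 ^ (CARD('n) * k)\<rfloor>) (2 ^ (CARD('n) * k) - 1)) (coord_idx i)) / 2 ^ k)"

definition vdc_digit :: "nat \<Rightarrow> nat \<Rightarrow> nat \<Rightarrow> nat" where
  "vdc_digit b i j = ((i - 1) div b ^ (j - 1)) mod b"

text \<open>Probability space of the random permutations: one independent uniform permutation
  of {0..b-1} for every digit prefix (the empty prefix gives pi), completed.\<close>
definition scr_space :: "nat \<Rightarrow> (nat list \<Rightarrow> nat \<Rightarrow> nat) measure" where
  "scr_space b = completion
     (PiM UNIV (\<lambda>_::nat list. measure_pmf (pmf_of_set {p. p permutes {..<b}})))"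

definition scr_vdc :: "nat \<Rightarrow> (nat list \<Rightarrow> nat \<Rightarrow> nat) \<Rightarrow> nat \<Rightarrow> real" where
  "scr_vdc b \<omega> i = (\<Sum>j. real (\<omega> (map (vdc_digit b i) [1..<Suc j]) (vdc_digit b i (Suc j)))
                        / real b ^ Suc j)"

definition hsfc_est :: "nat \<Rightarrow> nat \<Rightarrow> (real ^ 'n::finite \<Rightarrow> real) \<Rightarrow> (nat list \<Rightarrow> nat \<Rightarrow> nat) \<Rightarrow> real" where
  "hsfc_est b m f \<omega> = (\<Sum>i = 1..b ^ m. f (hilbert_curve (scr_vdc b \<omega> i))) / real (b ^ m)"

definition var :: "'a measure \<Rightarrow> ('a \<Rightarrow> real) \<Rightarrow> real" where
  "var M X = integral\<^sup>L M (\<lambda>\<omega>. (X \<omega> - integral\<^sup>L M X)\<^sup>2)"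

end

theory Submission
  imports Defs
begin

text \<open>Given the first \<open>m\<close> levels of permutations, the scrambled points are one independent uniform point
  in each of the \<open>n = b^m\<close> intervals of length \<open>1/n\<close>, so the estimate is distributed like a stratified
  sample of \<open>f \<circ> H\<close>. The Hilbert curve carries each dyadic interval of length \<open>2^(-dK)\<close> to a cube of side
  \<open>2^(-K)\<close>, preserving measure, and on such a cube inside \<open>\<Omega>\<close> the variance of the almost linear \<open>g\<close> is about
  \<open>|\<nabla>g|^2 4^(-K) / 12\<close>. Taking the largest cubes guaranteed to fit in the strata and summing gives the lower
  bound. Continuity of \<open>H\<close> is not needed: for a fixed coarse level, all but boundedly many strata lie
  inside a single coarse interval, on which the gradient hardly varies. For \<open>d > 2\<close> the
  standard deviation of the sum of the \<open>n\<close> bounded terms tends to infinity, so Lindeberg's condition is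
  trivially satisfied.\<close>

section \<open>Uniform distributions\<close>

text \<open>Origin of the constants: on a cube of side s the centred second moment of an affine
  function with gradient v is s^(d+2) |v|^2 / 12. If a stratum has the length of L cells, then
  s^(d+2) = (n L)^(-1-2/d), and L < 2^(d+1) brings in (2^(d+1))^(-1-2/d) = 2^(-2/d-d) / 8; so 96 =
  12 * 8. This constant is to be attained at finite n with the full integral over \<Omega>, while
  linearisation, strata crossing coarse endpoints and cells near the boundary all lose something.
  Hence a strict gain, the factor 4/3, has to be secured before any error is estimated. A second
  obstacle is measurability: \<Omega> is an arbitrary set with a null boundary, so f composed with H
  need not be Borel. The work is done for g on the interior of \<Omega>, and f is reached on the
  completed probability space. The Minkowski condition serves twice: it makes the boundary null, and
  it makes the cells inside the interior exhaust it.\<close>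

lemma measure_ge_uniform_of_compact_le:
  fixes N :: "'b::euclidean_space measure"
  assumes "prob_space N" and sets: "sets N = sets borel"
    and C: "compact C" "emeasure lborel C = 1"
    and le: "\<And>K. compact K \<Longrightarrow> measure lborel (K \<inter> C) \<le> measure N K"
  shows "N = uniform_measure lborel C"
proof -
  interpret N: prob_space N by fact
  have C_meas [measurable]: "C \<in> sets borel"
    using C by (simp add: compact_imp_closed)
  let ?U = "uniform_measure lborel C"
  interpret U: prob_space ?U
    using C by (intro prob_space_uniform_measure) auto
  have U_eq: "measure ?U A = measure lborel (C \<inter> A)" if "A \<in> sets borel" for A
    using C that by (subst measure_uniform_measure) (auto simp: measure_def)
  have le': "measure ?U A \<le> measure N A" if A: "A \<in> sets borel" for A
  proof -
    have "emeasure ?U A = (SUP K \<in> {K. K \<subseteq> A \<and> compact K}. emeasure ?U K)"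
      using A by (intro inner_regular) (auto simp: U.emeasure_space_1[simplified])
    also have "\<dots> \<le> emeasure N A"
    proof (rule SUP_least, clarify)
      fix K assume K: "K \<subseteq> A" "compact K"
      then have Kb: "K \<in> sets borel" by (simp add: compact_imp_closed)
      have "measure ?U K \<le> measure N K"
        using le[OF K(2)] Kb by (simp add: U_eq Int_commute)
      also have "\<dots> \<le> measure N A"
        using K A sets by (intro N.finite_measure_mono) auto
      finally show "emeasure ?U K \<le> emeasure N A"
        by (simp add: U.emeasure_eq_measure N.emeasure_eq_measure)
    qed
    finally show ?thesis
      by (simp add: U.emeasure_eq_measure N.emeasure_eq_measure)
  qed
  show ?thesis
  proof (rule measure_eqI)
    show "sets N = sets ?U" by (simp add: sets)
  next
    fix A assume "A \<in> sets N"
    then have A: "A \<in> sets borel" by (simp add: sets)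
    have spN: "space N = UNIV" using sets_eq_imp_space_eq[OF sets] by simp
    \<comment> \<open>Both measures have mass 1, so domination on the complement is the reverse
      inequality on A.\<close>
    have "measure ?U (UNIV - A) \<le> measure N (UNIV - A)"
      using A by (intro le') auto
    moreover have "measure ?U (UNIV - A) = 1 - measure ?U A"
      using U.prob_compl[of A] A by simp
    moreover have "measure N (UNIV - A) = 1 - measure N A"
      using N.prob_compl[of A] A sets spN by simp
    ultimately have "measure N A = measure ?U A" using le'[OF A] by simp
    then show "emeasure N A = emeasure ?U A"
      by (simp add: U.emeasure_eq_measure N.emeasure_eq_measure)
  qed
qed

text \<open>A one-sided comparison per cell is enough: the events \<open>E r h\<close> are disjoint,
  while the compact cells \<open>Q r h\<close> may share boundary points. Given an open U around a
  compact K, all cells meeting K lie in U once the mesh \<open>\<delta> r\<close> is small, so their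
  total measure is at most the probability of U; outer regularity brings U down to K. The criterion
  serves both the Hilbert curve and the random digit expansions.\<close>

lemma distr_eq_uniform_of_cells:
  fixes X :: "'a \<Rightarrow> 'b::euclidean_space" and Q :: "nat \<Rightarrow> 'i \<Rightarrow> 'b set"
  assumes "prob_space M" and X: "X \<in> borel_measurable M"
    and C: "compact C" "emeasure lborel C = 1"
    and fin: "\<And>r. finite (I r)"
    and E: "\<And>r h. h \<in> I r \<Longrightarrow> E r h \<in> sets M"
    and disj: "\<And>r. disjoint_family_on (E r) (I r)"
    and XE: "\<And>r h x. h \<in> I r \<Longrightarrow> x \<in> E r h \<Longrightarrow> X x \<in> Q r h"
    and Q: "\<And>r h. h \<in> I r \<Longrightarrow> compact (Q r h)"
    and meas: "\<And>r h. h \<in> I r \<Longrightarrow> measure lborel (Q r h) \<le> measure M (E r h)"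
    and diam: "\<And>r h x y. h \<in> I r \<Longrightarrow> x \<in> Q r h \<Longrightarrow> y \<in> Q r h \<Longrightarrow> dist x y \<le> \<delta> r"
    and \<delta>: "\<delta> \<longlonglongrightarrow> 0"
    and cover: "\<And>r. C \<subseteq> (\<Union>h\<in>I r. Q r h)"
  shows "distr M borel X = uniform_measure lborel C"
proof -
  interpret prob_space M by fact
  let ?N = "distr M borel X"
  interpret N: prob_space ?N using X by (rule prob_space_distr)
  show ?thesis
  proof (rule measure_ge_uniform_of_compact_le[OF N.prob_space_axioms _ C])
    fix K :: "'b set" assume K: "compact K"
    have main: "emeasure lborel (K \<inter> C) \<le> emeasure ?N U" if U: "K \<subseteq> U" "open U" for U
    proof -
      obtain e where e: "e > 0" "(\<Union>x\<in>K. ball x e) \<subseteq> U"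
        using compact_subset_open_imp_ball_epsilon_subset U K by metis
      obtain r where r: "\<delta> r < e"
        using order_tendstoD(2)[OF \<delta> e(1)] by (auto simp: eventually_sequentially)
      define J where "J = {h \<in> I r. Q r h \<inter> K \<noteq> {}}"
      have J: "finite J" "J \<subseteq> I r" using fin by (auto simp: J_def)
      have QU: "Q r h \<subseteq> U" if h: "h \<in> J" for h
      proof
        fix x assume x: "x \<in> Q r h"
        from h obtain y where y: "y \<in> Q r h" "y \<in> K" "h \<in> I r" by (auto simp: J_def)
        then have "dist y x < e" using diam[of h r y x] x r by simp
        with y have "x \<in> (\<Union>x\<in>K. ball x e)" by auto
        then show "x \<in> U" using e(2) by blast
      qed
      have KQ: "K \<inter> C \<subseteq> (\<Union>h\<in>J. Q r h)"
        using cover[of r] unfolding J_def by blast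
      have em: "emeasure lborel (Q r h) \<le> emeasure M (E r h)" if "h \<in> J" for h
      proof -
        have h: "h \<in> I r" using that J by auto
        have "emeasure lborel (Q r h) \<noteq> \<infinity>"
          using emeasure_bounded_finite[OF compact_imp_bounded[OF Q[OF h]]] by simp
        then show ?thesis
          using meas[OF h] by (simp add: emeasure_eq_measure emeasure_eq_ennreal_measure)
      qed
      have "emeasure lborel (K \<inter> C) \<le> emeasure lborel (\<Union>h\<in>J. Q r h)"
        using KQ J Q by (intro emeasure_mono) (auto intro!: sets.finite_UN simp: compact_imp_closed)
      also have "\<dots> \<le> (\<Sum>h\<in>J. emeasure lborel (Q r h))"
        using J Q by (intro emeasure_subadditive_finite) (auto simp: compact_imp_closed)
      also have "\<dots> \<le> (\<Sum>h\<in>J. emeasure M (E r h))"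
        by (intro sum_mono em)
      also have "\<dots> = emeasure M (\<Union>h\<in>J. E r h)"
        using J E by (intro sum_emeasure disjoint_family_on_mono[OF J(2) disj]) auto
      also have "\<dots> \<le> emeasure M (X -` U \<inter> space M)"
      proof (rule emeasure_mono)
        show "(\<Union>h\<in>J. E r h) \<subseteq> X -` U \<inter> space M"
          using XE J QU E[THEN sets.sets_into_space] by blast
        show "X -` U \<inter> space M \<in> sets M"
          using X U(2) by (intro measurable_sets[of X M borel]) auto
      qed
      also have "\<dots> = emeasure ?N U"
        using X U(2) by (subst emeasure_distr) auto
      finally show ?thesis .
    qed
    have "emeasure lborel (K \<inter> C) \<le> (INF U \<in> {U. K \<subseteq> U \<and> open U}. emeasure ?N U)"
      by (rule INF_greatest) (auto intro: main)
    also have "\<dots> = emeasure ?N K"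
      using K by (intro outer_regular[symmetric])
        (auto simp: N.emeasure_space_1[simplified] compact_imp_closed)
    finally show "measure lborel (K \<inter> C) \<le> measure ?N K"
      unfolding N.emeasure_eq_measure
      by (auto simp: measure_def intro: enn2real_leI)
  qed simp
qed

section \<open>A central limit theorem for bounded triangular arrays\<close>

lemma abs_one_minus_exp_le:
  fixes x :: real
  assumes "0 \<le> x" "x \<le> 1"
  shows "\<bar>(1 - x) - exp (-x)\<bar> \<le> x\<^sup>2"
proof -
  have 1: "1 - x \<le> exp (-x)" using exp_ge_add_one_self[of "-x"] by simp
  have "exp (-x) = 1 / exp x" by (simp add: exp_minus inverse_eq_divide)
  also have "\<dots> \<le> 1 / (1 + x)" using exp_ge_add_one_self[of x] assms by (intro divide_left_mono) auto
  also have "\<dots> \<le> 1 - x + x\<^sup>2"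
    using assms by (simp add: field_simps power2_eq_square)
  finally show ?thesis using 1 by simp
qed

text \<open>Taylor expansion to second order, with |Z|^3 \<le> e Z^2 for the remainder. The error is
  proportional to the variance v, so over a row of total variance 1 the errors add up to a quantity
  tending to 0 with e. The assumption \<open>te\<close> keeps t^2 v / 2 within [0, 1], where
  \<open>abs_one_minus_exp_le\<close> applies.\<close>

lemma (in prob_space) char_bounded_approx:
  assumes Z: "random_variable borel Z" and mean: "expectation Z = 0"
    and bd: "\<And>x. \<bar>Z x\<bar> \<le> e" and v: "v = expectation (\<lambda>x. (Z x)\<^sup>2)"
    and te: "t\<^sup>2 * e\<^sup>2 \<le> 2"
  shows "cmod (char (distr M borel Z) t - exp (- (t\<^sup>2 * v / 2))) \<le> (\<bar>t\<bar> ^ 3 * e + t ^ 4 * e\<^sup>2) * v"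
proof -
  have e: "0 \<le> e" using bd[of undefined] by linarith
  have int: "integrable M Z" using Z bd by (intro integrable_const_bound[where B=e]) auto
  have sq: "(Z x)\<^sup>2 \<le> e\<^sup>2" for x using bd[of x] by (metis abs_ge_zero power2_abs power_mono)
  have int2: "integrable M (\<lambda>x. (Z x)\<^sup>2)" using Z sq by (intro integrable_const_bound[where B="e\<^sup>2"]) auto
  have v0: "0 \<le> v" by (simp add: v)
  have ve: "v \<le> e\<^sup>2" unfolding v using int2 sq by (intro integral_le_const) auto
  have int3: "integrable M (\<lambda>x. min (6 * (Z x)\<^sup>2) (\<bar>t\<bar> * \<bar>Z x\<bar> ^ 3))"
  proof (rule integrable_const_bound[where B="6 * e\<^sup>2"])
    have "\<bar>min (6 * (Z x)\<^sup>2) (\<bar>t\<bar> * \<bar>Z x\<bar> ^ 3)\<bar> \<le> 6 * e\<^sup>2" for x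
    proof -
      have "0 \<le> min (6 * (Z x)\<^sup>2) (\<bar>t\<bar> * \<bar>Z x\<bar> ^ 3)" by simp
      then show ?thesis using sq[of x] by linarith
    qed
    then show "AE x in M. norm (min (6 * (Z x)\<^sup>2) (\<bar>t\<bar> * \<bar>Z x\<bar> ^ 3)) \<le> 6 * e\<^sup>2" by simp
  qed (use Z in measurable)
  have "cmod (char (distr M borel Z) t - (1 - t^2 * v / 2)) \<le>
    (t^2 / 6) * expectation (\<lambda>x. min (6 * (Z x)^2) (\<bar>t\<bar> * \<bar>Z x\<bar>^3))"
    by (rule char_approx3'[OF Z int int2 mean _ refl]) (simp add: mean v)
  also have "\<dots> \<le> (t^2 / 6) * expectation (\<lambda>x. \<bar>t\<bar> * e * (Z x)\<^sup>2)"
  proof (intro mult_left_mono integral_mono int3 integrable_mult_right int2)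
    fix x
    have "\<bar>Z x\<bar> ^ 3 = \<bar>Z x\<bar> * (Z x)\<^sup>2" by (simp add: power3_eq_cube power2_eq_square)
    also have "\<dots> \<le> e * (Z x)\<^sup>2" using bd by (intro mult_right_mono) auto
    finally have "\<bar>t\<bar> * \<bar>Z x\<bar> ^ 3 \<le> \<bar>t\<bar> * (e * (Z x)\<^sup>2)" by (intro mult_left_mono) auto
    then show "min (6 * (Z x)\<^sup>2) (\<bar>t\<bar> * \<bar>Z x\<bar> ^ 3) \<le> \<bar>t\<bar> * e * (Z x)\<^sup>2" by (simp add: mult.assoc)
  qed auto
  also have "\<dots> = \<bar>t\<bar> ^ 3 * e * v / 6"
    by (simp add: v power3_eq_cube power2_eq_square abs_mult_self_eq)
  also have "\<dots> \<le> \<bar>t\<bar> ^ 3 * e * v" using e v0 by simp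
  finally have A: "cmod (char (distr M borel Z) t - (1 - t^2 * v / 2)) \<le> \<bar>t\<bar> ^ 3 * e * v" .
  have tv: "t\<^sup>2 * v \<le> t\<^sup>2 * e\<^sup>2" using ve by (intro mult_left_mono) auto
  have "\<bar>(1 - t\<^sup>2 * v / 2) - exp (- (t\<^sup>2 * v / 2))\<bar> \<le> (t\<^sup>2 * v / 2)\<^sup>2"
    using v0 tv te by (intro abs_one_minus_exp_le) auto
  also have "\<dots> = t ^ 4 * v * v / 4" by (simp add: power2_eq_square power4_eq_xxxx)
  also have "\<dots> \<le> t ^ 4 * v * e\<^sup>2 / 4" using ve v0 by (intro divide_right_mono mult_left_mono) auto
  also have "\<dots> \<le> t ^ 4 * e\<^sup>2 * v" using v0 by simp
  finally have B: "cmod (complex_of_real ((1 - t\<^sup>2 * v / 2) - exp (- (t\<^sup>2 * v / 2)))) \<le> t ^ 4 * e\<^sup>2 * v"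
    by (simp only: norm_of_real)
  have "cmod (char (distr M borel Z) t - exp (- (t\<^sup>2 * v / 2)))
      \<le> cmod (char (distr M borel Z) t - (1 - t^2 * v / 2)) + cmod (complex_of_real ((1 - t\<^sup>2 * v / 2) - exp (- (t\<^sup>2 * v / 2))))"
    using norm_triangle_ineq[of "char (distr M borel Z) t - (1 - t^2 * v / 2)"
        "complex_of_real ((1 - t\<^sup>2 * v / 2) - exp (- (t\<^sup>2 * v / 2)))"] by simp
  with A B show "cmod (char (distr M borel Z) t - exp (- (t\<^sup>2 * v / 2))) \<le> (\<bar>t\<bar> ^ 3 * e + t ^ 4 * e\<^sup>2) * v"
    by (simp add: distrib_right)
qed

text \<open>The Lindeberg condition is automatic for uniformly small summands.\<close>
theorem lindeberg_clt_bounded: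
  fixes R :: "nat \<Rightarrow> 'a measure" and Z :: "nat \<Rightarrow> 'i \<Rightarrow> 'a \<Rightarrow> real"
  assumes prob: "\<And>m. prob_space (R m)" and fin: "\<And>m. finite (I m)"
    and ind: "\<And>m. prob_space.indep_vars (R m) (\<lambda>_. borel) (Z m) (I m)"
    and mean: "\<And>m k. k \<in> I m \<Longrightarrow> integral\<^sup>L (R m) (Z m k) = 0"
    and bd: "\<And>m k x. k \<in> I m \<Longrightarrow> \<bar>Z m k x\<bar> \<le> e m" and e: "e \<longlonglongrightarrow> 0"
    and var: "\<forall>\<^sub>F m in sequentially. (\<Sum>k\<in>I m. integral\<^sup>L (R m) (\<lambda>x. (Z m k x)\<^sup>2)) = 1"
  shows "weak_conv_m (\<lambda>m. distr (R m) borel (\<lambda>x. \<Sum>k\<in>I m. Z m k x)) std_normal_distribution"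
proof (rule levy_continuity)
  have rv: "Z m k \<in> borel_measurable (R m)" if "k \<in> I m" for m k
    using prob_space.indep_vars_def2[OF prob] ind[of m] that by metis
  show "real_distribution (distr (R m) borel (\<lambda>x. \<Sum>k\<in>I m. Z m k x))" for m
    using rv by (intro prob_space.real_distribution_distr prob borel_measurable_sum) auto
  show "real_distribution std_normal_distribution" by (rule real_dist_normal_dist)
  fix t :: real
  let ?ch = "\<lambda>m. char (distr (R m) borel (\<lambda>x. \<Sum>k\<in>I m. Z m k x)) t"
  have lim: "(\<lambda>m. \<bar>t\<bar> ^ 3 * e m + t ^ 4 * (e m)\<^sup>2) \<longlonglongrightarrow> 0"
    by (rule tendsto_eq_intros e refl | simp)+
  have "(\<lambda>m. t\<^sup>2 * (e m)\<^sup>2) \<longlonglongrightarrow> 0"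
    by (rule tendsto_eq_intros e refl | simp)+
  then have small: "\<forall>\<^sub>F m in sequentially. t\<^sup>2 * (e m)\<^sup>2 < 2" by (rule order_tendstoD) simp
  have main: "\<forall>\<^sub>F m in sequentially. 
     norm (?ch m - exp (- (t\<^sup>2 / 2))) \<le> \<bar>t\<bar> ^ 3 * e m + t ^ 4 * (e m)\<^sup>2"
    using small var
  proof eventually_elim
    case (elim m)
    interpret prob_space "R m" by (rule prob)
    define v where "v k = expectation (\<lambda>x. (Z m k x)\<^sup>2)" for k
    note ap = char_bounded_approx[OF rv mean bd v_def, where t=t]
    have sumv: "(\<Sum>k\<in>I m. v k) = 1" using elim by (simp add: v_def)
    have "exp (- (t\<^sup>2 / 2)) = exp (\<Sum>k\<in>I m. - (t\<^sup>2 * v k / 2))"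
      using sumv by (simp add: sum_negf sum_divide_distrib[symmetric] sum_distrib_left[symmetric])
    also have "\<dots> = (\<Prod>k\<in>I m. exp (- (t\<^sup>2 * v k / 2)))"
      using fin by (simp add: exp_sum)
    finally have ex: "exp (- (t\<^sup>2 / 2)) = (\<Prod>k\<in>I m. exp (- (t\<^sup>2 * v k / 2)))" .
    have "norm (?ch m - exp (- (t\<^sup>2 / 2)))
       = norm ((\<Prod>k\<in>I m. char (distr (R m) borel (Z m k)) t) - (\<Prod>k\<in>I m. complex_of_real (exp (- (t\<^sup>2 * v k / 2)))))"
      by (simp only: char_distr_sum[OF ind] ex of_real_prod)
    \<comment> \<open>The Gaussian factor has been split along the variances; products of numbers of
      modulus at most 1 differ by at most the sum of the differences of their factors.\<close>
    also have "\<dots> \<le> (\<Sum>k\<in>I m. norm (char (distr (R m) borel (Z m k)) t - complex_of_real (exp (- (t\<^sup>2 * v k / 2)))))"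
    proof (rule norm_prod_diff)
      fix k assume k: "k \<in> I m"
      interpret rd: real_distribution "distr (R m) borel (Z m k)"
        using rv[OF k] by simp
      show "norm (char (distr (R m) borel (Z m k)) t) \<le> 1" by (rule rd.cmod_char_le_1)
      show "norm (complex_of_real (exp (- (t\<^sup>2 * v k / 2)))) \<le> 1"
        by (simp add: v_def)
    qed
    also have "\<dots> \<le> (\<Sum>k\<in>I m. (\<bar>t\<bar> ^ 3 * e m + t ^ 4 * (e m)\<^sup>2) * v k)"
      using ap elim by (intro sum_mono) (auto simp: exp_of_real)
    also have "\<dots> = \<bar>t\<bar> ^ 3 * e m + t ^ 4 * (e m)\<^sup>2"
      using sumv by (simp add: sum_distrib_left[symmetric])
    finally show ?case .
  qed
  have "(\<lambda>m. ?ch m - exp (- (t\<^sup>2 / 2))) \<longlonglongrightarrow> 0"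
    by (rule Lim_null_comparison[OF main lim])
  then have "(\<lambda>m. ?ch m) \<longlonglongrightarrow> exp (- (t\<^sup>2 / 2))"
    by (rule LIM_zero_cancel)
  then show "(\<lambda>m. ?ch m) \<longlonglongrightarrow> char std_normal_distribution t"
    by (simp add: char_std_normal_distribution exp_of_real)
qed

section \<open>The Hilbert curve\<close>

lemma xor_nat_less_exp:
  fixes x y :: nat
  assumes "x < 2 ^ d" "y < 2 ^ d"
  shows "xor x y < 2 ^ d"
proof -
  have "xor x y = take_bit d (xor x y)"
    using assms by (simp add: take_bit_nat_eq_self)
  then show ?thesis by (metis take_bit_nat_less_exp)
qed

lemma xor_left_cancel_nat: "xor c (x::nat) = xor c y \<longleftrightarrow> x = y"
  by (metis xor.assoc xor.left_neutral xor_self_eq)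

lemma gray_less: "w < 2 ^ d \<Longrightarrow> gray w < 2 ^ d"
  unfolding gray_def by (rule xor_nat_less_exp) auto

lemma gray_div2: "gray w div 2 = gray (w div 2)"
proof -
  have "drop_bit 1 (xor w (drop_bit 1 w)) = xor (drop_bit 1 w) (drop_bit 1 (drop_bit 1 w))"
    by (simp only: drop_bit_xor)
  then show ?thesis by (simp add: gray_def drop_bit_eq_div)
qed

text \<open>Halving commutes with the Gray code, so by induction on the number of bits the halves
  agree; since \<open>gray w\<close> is the xor of w with its half, cancelling the half recovers
  w.\<close>

lemma gray_inj: "w < 2 ^ d \<Longrightarrow> w' < 2 ^ d \<Longrightarrow> gray w = gray w' \<Longrightarrow> w = w'"
proof (induction d arbitrary: w w')
  case (Suc d)
  have h: "w div 2 = w' div 2"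
  proof (rule Suc.IH)
    show "gray (w div 2) = gray (w' div 2)"
      unfolding gray_div2[symmetric] Suc.prems(3) ..
  qed (use Suc.prems in auto)
  have "xor (w div 2) w = xor (w div 2) w'"
    using Suc.prems(3) h by (simp add: gray_def xor.commute)
  then show ?case by (simp only: xor_left_cancel_nat)
qed simp

text \<open>Rotation exchanges quotient and remainder. With \<open>D * R = 2 ^ d\<close>, bounds and
  injectivity become statements on division with remainder.\<close>

lemma rotl_alt:
  assumes "0 < d"
  obtains D R :: nat where "D * R = 2 ^ d" "D > 0" "R > 0"
    "\<And>x. rotl d r x = (x mod D) * R + x div D"
proof
  define r' where "r' = r mod d"
  have r': "r' < d" using assms by (simp add: r'_def)
  show eq: "2 ^ (d - r') * 2 ^ r' = (2 ^ d :: nat)"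
    using r' by (simp flip: power_add)
  show "rotl d r x = (x mod 2 ^ (d - r')) * 2 ^ r' + x div 2 ^ (d - r')" for x
    unfolding rotl_def Let_def r'_def[symmetric] eq[symmetric]
    by (simp only: mult_mod_left)
qed auto

lemma rotl_less:
  assumes "0 < d" "x < 2 ^ d"
  shows "rotl d r x < 2 ^ d"
proof -
  obtain D R where DR: "D * R = 2 ^ d" "D > 0" "R > 0" "\<And>x. rotl d r x = (x mod D) * R + x div D"
    using rotl_alt[OF assms(1)] by metis
  have "x div D < R" using assms(2) DR by (simp add: less_mult_imp_div_less mult.commute)
  moreover have "x mod D < D" using DR by simp
  ultimately have "(x mod D) * R + x div D < (x mod D + 1) * R" by simp
  also have "\<dots> \<le> D * R" using \<open>x mod D < D\<close> by (intro mult_right_mono) auto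
  finally show ?thesis using DR by simp
qed

lemma rotl_inj:
  assumes "0 < d" "x < 2 ^ d" "y < 2 ^ d" "rotl d r x = rotl d r y"
  shows "x = y"
proof -
  obtain D R where DR: "D * R = 2 ^ d" "D > 0" "R > 0" "\<And>x. rotl d r x = (x mod D) * R + x div D"
    using rotl_alt[OF assms(1)] by metis
  have DR': "2 ^ d = R * D" using DR(1) by (simp only: mult.commute)
  have "x div D < R" "y div D < R"
    using assms(2,3) unfolding DR' by (blast intro: less_mult_imp_div_less)+
  then have "((x mod D) * R + x div D) div R = x mod D" "((y mod D) * R + y div D) div R = y mod D"
    "((x mod D) * R + x div D) mod R = x div D" "((y mod D) * R + y div D) mod R = y div D"
    using DR(3) by auto
  moreover have "(x mod D) * R + x div D = (y mod D) * R + y div D"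
    using assms(4) DR(4) by simp
  ultimately have "x mod D = y mod D" "x div D = y div D" by metis+
  then show ?thesis by (metis div_mult_mod_eq)
qed

text \<open>The word \<open>l\<close> of \<open>hstep\<close>: bit j tells in which half of the
  current cube, along coordinate j, the sub-cube with index digit w lies.\<close>

definition hilbert_word :: "nat \<Rightarrow> nat \<Rightarrow> nat \<Rightarrow> nat \<Rightarrow> nat" where
  "hilbert_word d e r w = xor (rotl d (r + 1) (gray w)) e"

text \<open>Gray code, rotation and xor with e can each be undone, and an injective map of a finite
  set into itself is onto.\<close>

lemma hilbert_word_surj:
  assumes d: "0 < d" and e: "e < 2 ^ d" and l: "l < 2 ^ d"
  shows "\<exists>w<2 ^ d. hilbert_word d e r w = l"
proof -
  have "inj_on (hilbert_word d e r) {..<2 ^ d}"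
  proof (rule inj_onI)
    fix x y assume *: "x \<in> {..<2 ^ d}" "y \<in> {..<2 ^ d}" "hilbert_word d e r x = hilbert_word d e r y"
    then have "rotl d (r + 1) (gray x) = rotl d (r + 1) (gray y)"
      unfolding hilbert_word_def by (metis xor.commute xor_left_cancel_nat)
    then show "x = y"
      using * rotl_inj[OF d gray_less gray_less] gray_inj by blast
  qed
  moreover have "hilbert_word d e r ` {..<2 ^ d} \<subseteq> {..<2 ^ d}"
    using e by (auto simp: hilbert_word_def intro!: xor_nat_less_exp rotl_less d gray_less)
  ultimately have "hilbert_word d e r ` {..<2 ^ d} = {..<2 ^ d}"
    by (intro endo_inj_surj) auto
  then show ?thesis using l by (metis (no_types, lifting) imageE lessThan_iff)
qed

lemma ex_bits:
  fixes c :: "nat \<Rightarrow> nat"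
  shows "\<exists>l<2 ^ d. \<forall>j<d. l div 2 ^ j mod 2 = c j mod 2"
proof (induction d)
  case (Suc d)
  then obtain l where l: "l < 2 ^ d" "\<And>j. j < d \<Longrightarrow> l div 2 ^ j mod 2 = c j mod 2" by blast
  define e where "e = c d mod 2"
  have e: "e \<le> 1" "c d mod 2 = e" "e mod 2 = e" by (auto simp: e_def)
  define l' where "l' = l + e * 2 ^ d"
  have "l' < 2 ^ Suc d"
  proof -
    have "e * 2 ^ d \<le> 1 * 2 ^ d" using e(1) by (rule mult_right_mono) simp
    then show ?thesis using l(1) unfolding l'_def power_Suc by linarith
  qed
  moreover have "l' div 2 ^ j mod 2 = c j mod 2" if j: "j < Suc d" for j
  proof (cases "j = d")
    case True
    then show ?thesis using l(1) e by (simp add: l'_def)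
  next
    case False
    with j have j: "j < d" by simp
    then obtain i where i: "d = Suc (j + i)" using less_imp_Suc_add by blast
    have "l' div 2 ^ j = (l + (2 * (e * 2 ^ i)) * 2 ^ j) div 2 ^ j"
      unfolding l'_def by (simp add: i power_add ac_simps)
    also have "\<dots> = 2 * (e * 2 ^ i) + l div 2 ^ j"
      by (rule div_mult_self1) simp
    finally show ?thesis using l(2)[OF j] by simp
  qed
  ultimately show ?case by blast
qed simp

section \<open>Recursion of the Hilbert cells over the levels\<close>

definition hilbert_state :: "nat \<Rightarrow> nat \<Rightarrow> nat \<Rightarrow> nat \<times> nat \<times> (nat \<Rightarrow> nat)" where
  "hilbert_state d k h =
     foldl (hstep d) (0, 0, \<lambda>_. 0) (map (\<lambda>i. h div 2 ^ (d * i) mod 2 ^ d) (rev [0..<k]))"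

lemma hilbert_cell_eq_state: "hilbert_cell d k h = snd (snd (hilbert_state d k h))"
  by (simp add: hilbert_cell_def hilbert_state_def)

lemma hilbert_state_0 [simp]: "hilbert_state d 0 h = (0, 0, \<lambda>_. 0)"
  by (simp add: hilbert_state_def)

text \<open>\<open>foldl\<close> reads the leading digit first, so the recursion peels off the last
  digit \<open>h mod 2 ^ d\<close>; the remaining digits are those of the parent index
  \<open>h div 2 ^ d\<close>.\<close>

lemma hilbert_state_Suc:
  "hilbert_state d (Suc k) h = hstep d (hilbert_state d k (h div 2 ^ d)) (h mod 2 ^ d)"
proof -
  have "rev [0..<Suc k] = map Suc (rev [0..<k]) @ [0]"
    by (simp add: upt_conv_Cons rev_map flip: map_Suc_upt del: upt_Suc)
  then show ?thesis
    by (simp add: hilbert_state_def o_def power_add div_mult2_eq del: upt_Suc)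
qed

lemma hilbert_cell_0 [simp]: "hilbert_cell d 0 h j = 0"
  by (simp add: hilbert_cell_eq_state)

text \<open>Supplies the assumption of \<open>hilbert_word_surj\<close> that the entry point is a
  d-bit word. In \<open>hentry\<close> the argument of the Gray code is at most w - 1.\<close>

lemma hilbert_state_entry_less:
  assumes "0 < d"
  shows "fst (hilbert_state d k h) < 2 ^ d"
proof (induction k arbitrary: h)
  case (Suc k)
  define w where "w = h mod 2 ^ d"
  have w: "w < 2 ^ d" by (simp add: w_def)
  have "hentry w < 2 ^ d"
  proof (cases "w = 0")
    case False
    then have "2 * ((w - 1) div 2) < 2 ^ d" using w by linarith
    then show ?thesis using False by (simp add: hentry_def gray_less)
  qed (simp add: hentry_def)
  then have "fst (hstep d s w) < 2 ^ d" if "fst s < 2 ^ d" for s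
    using that assms by (cases s) (simp add: hstep_def Let_def xor_nat_less_exp rotl_less)
  then show ?case
    using Suc[of "h div 2 ^ d"] by (simp add: hilbert_state_Suc w_def)
qed simp

lemma hilbert_cell_Suc:
  fixes d k h
  defines "s \<equiv> hilbert_state d k (h div 2 ^ d)"
  shows "hilbert_cell d (Suc k) h j = 2 * hilbert_cell d k (h div 2 ^ d) j
     + hilbert_word d (fst s) (fst (snd s)) (h mod 2 ^ d) div 2 ^ j mod 2"
  unfolding hilbert_cell_eq_state hilbert_state_Suc s_def[symmetric]
  by (cases s) (simp only: hstep_def hilbert_word_def Let_def prod.case fst_conv snd_conv)

text \<open>Each level appends one bit to every coordinate, so halving a coordinate i times undoes i
  levels. This is what makes cells of different levels nested.\<close>

lemma hilbert_cell_div: "hilbert_cell d (k + i) h j div 2 ^ i = hilbert_cell d k (h div 2 ^ (d * i)) j"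
proof (induction i arbitrary: h)
  case (Suc i)
  have "hilbert_cell d (k + Suc i) h j div 2 ^ Suc i = hilbert_cell d (Suc (k + i)) h j div 2 div 2 ^ i"
    by (simp add: div_mult2_eq)
  also have "hilbert_cell d (Suc (k + i)) h j div 2 = hilbert_cell d (k + i) (h div 2 ^ d) j"
    by (simp add: hilbert_cell_Suc)
  finally show ?case by (simp add: Suc power_add div_mult2_eq)
qed simp

lemma hilbert_cell_less: "hilbert_cell d k h j < 2 ^ k"
proof (induction k arbitrary: h)
  case (Suc k)
  have "2 * x + y mod 2 < 2 ^ Suc k" if "x < 2 ^ k" for x y :: nat
    using that mod_less_divisor[of 2 y] unfolding power_Suc by linarith
  then show ?case using Suc[of "h div 2 ^ d"] unfolding hilbert_cell_Suc by blast
qed simp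

text \<open>The halved target coordinates have a parent cell by induction; the discarded low bits
  form a word, and surjectivity of the refinement step supplies the index digit producing
  it.\<close>

lemma hilbert_cell_surj:
  assumes d: "0 < d"
  shows "(\<And>j. j < d \<Longrightarrow> p j < 2 ^ k) \<Longrightarrow> \<exists>h<2 ^ (d * k). \<forall>j<d. hilbert_cell d k h j = p j"
proof (induction k arbitrary: p)
  case (Suc k)
  have "\<exists>h<2 ^ (d * k). \<forall>j<d. hilbert_cell d k h j = p j div 2"
    using Suc.prems by (intro Suc.IH) (auto simp: less_mult_imp_div_less mult.commute)
  then obtain h where h: "h < 2 ^ (d * k)" "\<And>j. j < d \<Longrightarrow> hilbert_cell d k h j = p j div 2" by blast
  obtain l where l: "l < 2 ^ d" "\<And>j. j < d \<Longrightarrow> l div 2 ^ j mod 2 = p j mod 2"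
    using ex_bits by blast
  let ?s = "hilbert_state d k h"
  obtain w where w: "w < 2 ^ d" "hilbert_word d (fst ?s) (fst (snd ?s)) w = l"
    using hilbert_word_surj[OF d hilbert_state_entry_less[OF d] l(1)] by blast
  let ?h = "h * 2 ^ d + w"
  have "?h < (h + 1) * 2 ^ d" using w by simp
  also have "\<dots> \<le> 2 ^ (d * k) * 2 ^ d" using h(1) by (intro mult_right_mono) auto
  finally have "?h < 2 ^ (d * Suc k)" by (simp add: power_add mult.commute)
  moreover have "hilbert_cell d (Suc k) ?h j = p j" if "j < d" for j
    using w h(2) l(2) that by (simp add: hilbert_cell_Suc)
  ultimately show ?case by blast
next
  case 0
  then have "\<forall>j<d. p j = 0" by simp
  then show ?case by (intro exI[of _ 0]) simp
qed

lemma integral_uniform_measure_unit: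
  fixes F :: "'a::euclidean_space \<Rightarrow> real"
  assumes A: "A \<in> sets borel" "emeasure lborel A = 1" and F: "F \<in> borel_measurable borel"
  shows "integral\<^sup>L (uniform_measure lborel A) F = (LINT x:A|lborel. F x)"
proof -
  have "uniform_measure lborel A = density lborel (\<lambda>x. ennreal (indicator A x))"
    using A by (simp add: uniform_measure_def ennreal_indicator divide_ennreal_def)
  then show ?thesis
    using A F by (simp add: integral_density set_lebesgue_integral_def)
qed

section \<open>Cubes attached to the cells, and the curve as a limit of corners\<close>

lemma coord_idx_bij: "bij_betw coord_idx (UNIV :: 'n::finite set) {..<CARD('n)}"
proof -
  obtain f where "bij_betw f (UNIV :: 'n set) {0..<CARD('n)}"
    using ex_bij_betw_finite_nat[OF finite] by blast
  then have "bij_betw f (UNIV :: 'n set) {..<CARD('n)}" by (simp only: atLeast0LessThan)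
  then show ?thesis unfolding coord_idx_def by (rule someI[of "\<lambda>f. bij_betw f (UNIV :: 'n set) {..<CARD('n)}"])
qed

lemma coord_idx_less: "coord_idx (i :: 'n::finite) < CARD('n)"
  using coord_idx_bij bij_betwE by blast

abbreviation hilbert_coord :: "nat \<Rightarrow> nat \<Rightarrow> 'n::finite \<Rightarrow> nat" where
  "hilbert_coord k h i \<equiv> hilbert_cell CARD('n) k h (coord_idx i)"

definition hilbert_corner :: "nat \<Rightarrow> nat \<Rightarrow> real ^ 'n::finite" where
  "hilbert_corner k h = (\<chi> i. real (hilbert_coord k h i) / 2 ^ k)"

text \<open>Closed, so that limits of corners stay inside. The faces shared by neighbouring cubes
  are handled later by measure.\<close>

definition hilbert_cube :: "nat \<Rightarrow> nat \<Rightarrow> (real ^ 'n::finite) set" where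
  "hilbert_cube k h = cbox (hilbert_corner k h) (hilbert_corner k h + (\<chi> i. 1 / 2 ^ k))"

text \<open>The index inside \<open>hilbert_curve\<close>. The minimum takes effect for x \<ge> 1
  and assigns the endpoint 1 to the last cell.\<close>

definition hilbert_idx :: "nat \<Rightarrow> nat \<Rightarrow> real \<Rightarrow> nat" where
  "hilbert_idx d k x = min (nat \<lfloor>x * 2 ^ (d * k)\<rfloor>) (2 ^ (d * k) - 1)"

lemma hilbert_curve_eq_lim:
  "(hilbert_curve x :: real ^ 'n::finite) = lim (\<lambda>k. hilbert_corner k (hilbert_idx CARD('n) k x))"
  by (simp add: hilbert_curve_def hilbert_corner_def hilbert_idx_def)

lemma mem_hilbert_cube:
  "x \<in> (hilbert_cube k h :: (real ^ 'n::finite) set) \<longleftrightarrow>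
    (\<forall>i. real (hilbert_coord k h i) / 2 ^ k \<le> x $ i \<and>
         x $ i \<le> (real (hilbert_coord k h i) + 1) / 2 ^ k)"
  by (simp add: hilbert_cube_def hilbert_corner_def mem_box_cart add_divide_distrib)

text \<open>The floor of a quotient by a positive integer is the integer quotient of the floor, and
  the caps match, since the fine cap equals \<open>(2 ^ (d * k) - 1) * ?m + (?m - 1)\<close>. Minima
  commute with the monotone division.\<close>

lemma hilbert_idx_div:
  assumes "0 \<le> x"
  shows "hilbert_idx d (k + i) x div 2 ^ (d * i) = hilbert_idx d k x"
proof -
  let ?m = "2 ^ (d * i) :: nat"
  have "\<lfloor>x * 2 ^ (d * k)\<rfloor> = \<lfloor>x * 2 ^ (d * (k + i)) / real_of_int (int ?m)\<rfloor>"
    by (simp add: distrib_left power_add)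
  also have "\<dots> = \<lfloor>x * 2 ^ (d * (k + i))\<rfloor> div int ?m"
    by (rule floor_divide_real_eq_div) simp
  finally have 1: "nat \<lfloor>x * 2 ^ (d * k)\<rfloor> = nat \<lfloor>x * 2 ^ (d * (k + i))\<rfloor> div ?m"
    using assms by (simp add: nat_div_distrib nat_power_eq)
  have "2 ^ (d * (k + i)) - 1 = (2 ^ (d * k) - 1) * ?m + (?m - 1)"
    by (simp add: distrib_left power_add diff_mult_distrib)
  moreover have "(a * m + (m - 1)) div m = a" if "m > 0" for a m :: nat
    using that by (intro div_nat_eqI) (auto simp: algebra_simps)
  ultimately have 2: "(2 ^ (d * (k + i)) - 1) div ?m = 2 ^ (d * k) - 1"
    by (metis zero_less_numeral zero_less_power)
  have "min a b div ?m = min (a div ?m) (b div ?m)" for a b :: nat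
    by (intro min_of_mono[symmetric] monoI div_le_mono)
  then show ?thesis unfolding hilbert_idx_def 1 by (simp only: 2)
qed

lemma hilbert_cube_mono:
  "(hilbert_cube (k + i) h :: (real ^ 'n::finite) set) \<subseteq> hilbert_cube k (h div 2 ^ (CARD('n) * i))"
proof
  fix x :: "real ^ 'n" assume x: "x \<in> hilbert_cube (k + i) h"
  show "x \<in> hilbert_cube k (h div 2 ^ (CARD('n) * i))"
    unfolding mem_hilbert_cube hilbert_cell_div[symmetric]
  proof
    fix j :: 'n
    define c where "c = hilbert_coord (k + i) h j"
    have x: "real c / 2 ^ (k + i) \<le> x $ j" "x $ j \<le> (real c + 1) / 2 ^ (k + i)"
      using x unfolding mem_hilbert_cube c_def by auto
    have scale: "a / 2 ^ (k + i) \<le> B / 2 ^ k" if "a \<le> B * 2 ^ i" for a B :: real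
      using divide_right_mono[OF that, of "2 ^ (k + i)"] by (simp add: power_add)
    have "2 ^ i * (c div 2 ^ i) \<le> c" by simp
    then have "real (2 ^ i * (c div 2 ^ i)) \<le> real c" by (simp only: of_nat_le_iff)
    then have "real (c div 2 ^ i) / 2 ^ k \<le> real c / 2 ^ (k + i)"
      by (simp add: power_add field_simps)
    moreover have "c < 2 ^ i * (c div 2 ^ i) + 2 ^ i"
      by (metis add_less_cancel_left mult_div_mod_eq mod_less_divisor zero_less_numeral zero_less_power)
    then have "c + 1 \<le> 2 ^ i * (c div 2 ^ i) + 2 ^ i" by simp
    then have "real (c + 1) \<le> real (2 ^ i * (c div 2 ^ i) + 2 ^ i)" by (simp only: of_nat_le_iff)
    then have "(real c + 1) / 2 ^ (k + i) \<le> (real (c div 2 ^ i) + 1) / 2 ^ k"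
      by (intro scale) (simp add: algebra_simps)
    ultimately show "real (c div 2 ^ i) / 2 ^ k \<le> x $ j \<and> x $ j \<le> (real (c div 2 ^ i) + 1) / 2 ^ k"
      using x by linarith
  qed
qed

lemma hilbert_corner_in_cube: "hilbert_corner k h \<in> hilbert_cube k h"
  unfolding mem_hilbert_cube by (simp add: hilbert_corner_def divide_right_mono)

lemma dist_hilbert_cube:
  fixes x y :: "real ^ 'n::finite"
  assumes "x \<in> hilbert_cube k h" "y \<in> hilbert_cube k h"
  shows "dist x y \<le> real CARD('n) / 2 ^ k"
proof -
  have "dist x y \<le> (\<Sum>i\<in>UNIV. \<bar>(x - y) $ i\<bar>)"
    unfolding dist_norm by (rule norm_le_l1_cart)
  also have "\<dots> \<le> (\<Sum>i\<in>(UNIV :: 'n set). 1 / 2 ^ k)"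
  proof (rule sum_mono)
    fix i
    show "\<bar>(x - y) $ i\<bar> \<le> 1 / 2 ^ k"
      using assms unfolding mem_hilbert_cube add_divide_distrib vector_minus_component
      by (smt (verit, ccfv_SIG))
  qed
  finally show ?thesis by simp
qed

lemma compact_hilbert_cube: "compact (hilbert_cube k h)"
  unfolding hilbert_cube_def by (rule compact_cbox)

lemma measure_hilbert_cube:
  "measure lborel (hilbert_cube k h :: (real ^ 'n::finite) set) = 1 / 2 ^ (CARD('n) * k)"
proof -
  have "hilbert_cube k h \<noteq> ({} :: (real ^ 'n) set)" using hilbert_corner_in_cube by blast
  then show ?thesis
    unfolding hilbert_cube_def by (subst content_cbox_cart) (simp_all add: power_divide power_mult mult.commute)
qed

lemma hilbert_cube_subset_unit:
  "(hilbert_cube k h :: (real ^ 'n::finite) set) \<subseteq> cbox 0 1"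
proof
  fix x :: "real ^ 'n" assume x: "x \<in> hilbert_cube k h"
  show "x \<in> cbox 0 1"
    unfolding mem_box_cart
  proof
    fix i :: 'n
    let ?c = "hilbert_coord k h i"
    have "?c < 2 ^ k" by (rule hilbert_cell_less)
    then have "real (?c + 1) \<le> 2 ^ k" by (metis Suc_eq_plus1 Suc_leI of_nat_le_iff of_nat_numeral of_nat_power)
    then have "(real ?c + 1) / 2 ^ k \<le> 1" by simp
    moreover have "0 \<le> real ?c / 2 ^ k" by simp
    ultimately show "0 $ i \<le> x $ i \<and> x $ i \<le> 1 $ i"
      using x unfolding mem_hilbert_cube by (smt (verit) one_index zero_index)
  qed
qed

lemma hilbert_cubes_cover:
  "(cbox 0 1 :: (real ^ 'n::finite) set) \<subseteq> (\<Union>h<2 ^ (CARD('n) * k). hilbert_cube k h)"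
proof
  fix z :: "real ^ 'n" assume z: "z \<in> cbox 0 1"
  define q where "q i = min (nat \<lfloor>z $ i * 2 ^ k\<rfloor>) (2 ^ k - 1)" for i
  define p where "p j = q (inv_into UNIV coord_idx j)" for j
  have p: "p (coord_idx i) = q i" for i
    unfolding p_def using coord_idx_bij[where 'n='n] by (simp add: bij_betw_def inv_into_f_f)
  have "p j < 2 ^ k" for j
    unfolding p_def q_def by (rule le_less_trans[OF min.cobounded2]) simp
  then obtain h where h: "h < 2 ^ (CARD('n) * k)" "\<And>j. j < CARD('n) \<Longrightarrow> hilbert_cell CARD('n) k h j = p j"
    using hilbert_cell_surj[of "CARD('n)" p k] by auto
  have "z \<in> hilbert_cube k h"
    unfolding mem_hilbert_cube
  proof
    fix i
    have zi: "0 \<le> z $ i" "z $ i \<le> 1" using z by (auto simp: mem_box_cart)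
    have "real (q i) \<le> z $ i * 2 ^ k \<and> z $ i * 2 ^ k \<le> real (q i) + 1"
    proof (cases "nat \<lfloor>z $ i * 2 ^ k\<rfloor> \<le> 2 ^ k - 1")
      case True
      then have "q i = nat \<lfloor>z $ i * 2 ^ k\<rfloor>" by (simp add: q_def)
      then have "real (q i) = of_int \<lfloor>z $ i * 2 ^ k\<rfloor>" using zi by simp
      then show ?thesis by linarith
    next
      case False
      then have "q i = 2 ^ k - 1" by (simp add: q_def)
      then have r: "real (q i) = 2 ^ k - 1" by (simp add: of_nat_diff)
      from False have "2 ^ k \<le> nat \<lfloor>z $ i * 2 ^ k\<rfloor>" by linarith
      then have "real (2 ^ k) \<le> real (nat \<lfloor>z $ i * 2 ^ k\<rfloor>)" by (simp only: of_nat_le_iff)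
      also have "\<dots> = of_int \<lfloor>z $ i * 2 ^ k\<rfloor>" using zi by simp
      also have "\<dots> \<le> z $ i * 2 ^ k" by (rule of_int_floor_le)
      finally have "2 ^ k \<le> z $ i * 2 ^ k" by simp
      moreover have "z $ i * 2 ^ k \<le> 1 * 2 ^ k" using zi by (intro mult_right_mono) auto
      ultimately show ?thesis using r by simp
    qed
    then show "real (hilbert_coord k h i) / 2 ^ k \<le> z $ i \<and>
         z $ i \<le> (real (hilbert_coord k h i) + 1) / 2 ^ k"
      using h(2)[OF coord_idx_less[of i]] by (simp add: p field_simps)
  qed
  then show "z \<in> (\<Union>h<2 ^ (CARD('n) * k). hilbert_cube k h)" using h(1) by blast
qed

lemma LIMSEQ_const_div_pow2: "(\<lambda>k. c / 2 ^ k :: real) \<longlonglongrightarrow> 0"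
  using tendsto_mult_right_zero[OF LIMSEQ_inverse_realpow_zero[of 2], of c]
  by (simp add: divide_inverse)

text \<open>All later corners lie in the current cube, whose diameter tends to 0. So the corners
  form a Cauchy sequence, the \<open>lim\<close> in the definition is a genuine limit, and
  closedness keeps it in every cube.\<close>

lemma hilbert_curve_in_cube:
  assumes "0 \<le> x"
  shows "(hilbert_curve x :: real ^ 'n::finite) \<in> hilbert_cube k (hilbert_idx CARD('n) k x)"
proof -
  let ?c = "\<lambda>k. hilbert_corner k (hilbert_idx CARD('n) k x) :: real ^ 'n"
  have mem: "?c (k + i) \<in> hilbert_cube k (hilbert_idx CARD('n) k x)" for k i
    using hilbert_corner_in_cube hilbert_cube_mono hilbert_idx_div[OF assms] by (metis subsetD)
  have "Cauchy ?c"
    unfolding Cauchy_altdef2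
  proof (intro allI impI)
    fix e :: real assume "0 < e"
    then have "\<forall>\<^sub>F k in sequentially. real CARD('n) / 2 ^ k < e"
      by (rule order_tendstoD(2)[OF LIMSEQ_const_div_pow2])
    then obtain N where N: "real CARD('n) / 2 ^ N < e"
      using eventually_happens'[OF sequentially_bot] by blast
    have "dist (?c n) (?c N) < e" if "n \<ge> N" for n
      using dist_hilbert_cube[OF mem[of N "n - N"] mem[of N 0]] that N by simp
    then show "\<exists>N. \<forall>n\<ge>N. dist (?c n) (?c N) < e" by blast
  qed
  then have "?c \<longlonglongrightarrow> hilbert_curve x"
    unfolding hilbert_curve_eq_lim by (simp add: Cauchy_convergent_iff convergent_LIMSEQ_iff)
  then have lim: "(\<lambda>i. ?c (i + k)) \<longlonglongrightarrow> hilbert_curve x" by (rule LIMSEQ_ignore_initial_segment)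
  have "?c (i + k) \<in> hilbert_cube k (hilbert_idx CARD('n) k x)" for i
    using mem[of k i] by (simp only: add.commute)
  then show ?thesis
    by (rule closed_sequentially[OF compact_imp_closed[OF compact_hilbert_cube] _ lim])
qed

lemma borel_measurable_hilbert_curve [measurable]:
  "(hilbert_curve :: real \<Rightarrow> real ^ 'n::finite) \<in> borel_measurable borel"
proof -
  have idx: "hilbert_idx CARD('n) k \<in> borel \<rightarrow>\<^sub>M count_space UNIV" for k
    unfolding hilbert_idx_def by measurable
  have "(\<lambda>x. hilbert_corner k (hilbert_idx CARD('n) k x) :: real ^ 'n) \<in> borel_measurable borel" for k
    by (rule measurable_compose[OF idx]) simp
  then show ?thesis unfolding hilbert_curve_eq_lim[abs_def] by (rule borel_measurable_lim_metric)
qed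

section \<open>Dyadic intervals, and measure preservation by the Hilbert curve\<close>

definition dyadic :: "nat \<Rightarrow> nat \<Rightarrow> real set" where
  "dyadic N h = {real h / 2 ^ N..<real (Suc h) / 2 ^ N}"

lemma hilbert_idx_dyadic:
  assumes "x \<in> dyadic (d * k) h" "h < 2 ^ (d * k)"
  shows "hilbert_idx d k x = h"
proof -
  have "real h \<le> x * 2 ^ (d * k)" "x * 2 ^ (d * k) < real h + 1"
    using assms(1) by (auto simp: dyadic_def field_simps)
  then have "\<lfloor>x * 2 ^ (d * k)\<rfloor> = int h" by (simp add: floor_eq_iff)
  then show ?thesis using assms(2) unfolding hilbert_idx_def by simp
qed

lemma dyadic_disjoint: "h \<noteq> h' \<Longrightarrow> dyadic N h \<inter> dyadic N h' = {}"
proof (rule ccontr)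
  assume "h \<noteq> h'" "dyadic N h \<inter> dyadic N h' \<noteq> {}"
  then obtain x where "real h \<le> x * 2 ^ N" "x * 2 ^ N < real (Suc h)"
      "real h' \<le> x * 2 ^ N" "x * 2 ^ N < real (Suc h')"
    by (auto simp: dyadic_def field_simps)
  then have "real h < real (Suc h')" "real h' < real (Suc h)" by linarith+
  with \<open>h \<noteq> h'\<close> show False by (simp only: of_nat_less_iff)
qed

lemma dyadic_nonneg: "x \<in> dyadic N h \<Longrightarrow> 0 \<le> x"
  unfolding dyadic_def by (auto intro: order_trans[rotated])

lemma measure_dyadic: "measure lborel (dyadic N h) = 1 / 2 ^ N"
  by (simp add: dyadic_def divide_right_mono diff_divide_distrib[symmetric])

lemma dyadic_subset_unit: "h < 2 ^ N \<Longrightarrow> dyadic N h \<subseteq> {0..1}"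
proof
  fix x assume "h < 2 ^ N" and x: "x \<in> dyadic N h"
  then have "real (Suc h) \<le> 2 ^ N" by (metis Suc_leI of_nat_le_iff of_nat_numeral of_nat_power)
  then have "real (Suc h) / 2 ^ N \<le> 1" by simp
  moreover have "x < real (Suc h) / 2 ^ N" using x by (simp only: dyadic_def atLeastLessThan_iff)
  ultimately have "x \<le> 1" by linarith
  then show "x \<in> {0..1}" using dyadic_nonneg[OF x] by simp
qed

lemma dyadic_sets [measurable]: "dyadic N h \<in> sets borel"
  by (simp add: dyadic_def)

abbreviation unif :: "real measure" where
  "unif \<equiv> uniform_measure lborel {0..1}"

lemma prob_space_unif: "prob_space unif"
  by (intro prob_space_uniform_measure) auto

lemma measure_unif: "A \<in> sets borel \<Longrightarrow> A \<subseteq> {0..1} \<Longrightarrow> measure unif A = measure lborel A"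
  by (subst measure_uniform_measure) (auto simp: Int_absorb1)

lemma emeasure_unit_cube: "emeasure lborel (cbox 0 1 :: (real ^ 'n::finite) set) = 1"
proof -
  have "0 \<in> (cbox 0 1 :: (real ^ 'n) set)" by (simp add: mem_box_cart)
  then have "(cbox 0 1 :: (real ^ 'n) set) \<noteq> {}" by blast
  then have "measure lborel (cbox 0 1 :: (real ^ 'n) set) = 1" by (subst content_cbox_cart) auto
  moreover have "emeasure lborel (cbox 0 1 :: (real ^ 'n) set) \<noteq> top"
    using emeasure_lborel_cbox_finite by (metis less_irrefl infinity_ennreal_def)
  ultimately show ?thesis by (simp add: emeasure_eq_ennreal_measure)
qed

text \<open>Half-open dyadic intervals are disjoint and are mapped into cubes of the same measure,
  which is the input of the cell criterion.\<close>

theorem distr_hilbert_curve: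
  "distr unif borel hilbert_curve = uniform_measure lborel (cbox 0 1 :: (real ^ 'n::finite) set)"
proof (rule distr_eq_uniform_of_cells[where I="\<lambda>k. {..<2 ^ (CARD('n) * k)}" and Q=hilbert_cube
      and E="\<lambda>k. dyadic (CARD('n) * k)" and \<delta>="\<lambda>k. real CARD('n) / 2 ^ k"])
  show "prob_space unif" by (rule prob_space_unif)
  show "disjoint_family_on (dyadic (CARD('n) * k)) {..<2 ^ (CARD('n) * k)}" for k
    using dyadic_disjoint by (auto simp: disjoint_family_on_def)
  show "hilbert_curve x \<in> (hilbert_cube k h :: (real ^ 'n) set)"
    if "h \<in> {..<2 ^ (CARD('n) * k)}" "x \<in> dyadic (CARD('n) * k) h" for k h x
    using hilbert_curve_in_cube[OF dyadic_nonneg[OF that(2)], of k] hilbert_idx_dyadic that by auto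
  show "measure lborel (hilbert_cube k h :: (real ^ 'n) set) \<le> measure unif (dyadic (CARD('n) * k) h)"
    if "h \<in> {..<2 ^ (CARD('n) * k)}" for k h
    using that dyadic_subset_unit[of h "CARD('n) * k"]
    by (subst measure_unif) (auto simp: measure_dyadic measure_hilbert_cube)
qed (use hilbert_cubes_cover dist_hilbert_cube LIMSEQ_const_div_pow2 compact_hilbert_cube emeasure_unit_cube in auto)

lemma integral_hilbert_curve:
  fixes F :: "real ^ 'n::finite \<Rightarrow> real"
  assumes [measurable]: "F \<in> borel_measurable borel"
  shows "(LINT x:{0..1}|lborel. F (hilbert_curve x)) = (LINT z:cbox 0 1|lborel. F z)"
proof -
  have "(LINT x:{0..1}|lborel. F (hilbert_curve x)) = (\<integral>x. F (hilbert_curve x) \<partial>unif)"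
    by (subst integral_uniform_measure_unit) auto
  also have "\<dots> = integral\<^sup>L (distr unif borel hilbert_curve) F"
    by (subst integral_distr) auto
  also have "\<dots> = (LINT z:cbox 0 1|lborel. F z)"
    unfolding distr_hilbert_curve
    by (intro integral_uniform_measure_unit emeasure_unit_cube) auto
  finally show ?thesis .
qed

text \<open>The preimage A of a cube may exceed the dyadic interval, because other intervals can hit
  its faces. But H preserves measure, so A and the interval have equal measure and differ by a null
  set; the rest is a change of variables with the indicator of the cube.\<close>

lemma integral_dyadic_hilbert_curve:
  fixes F :: "real ^ 'n::finite \<Rightarrow> real"
  assumes F [measurable]: "F \<in> borel_measurable borel" and h: "h < 2 ^ (CARD('n) * k)"
  shows "(LINT x:dyadic (CARD('n) * k) h|lborel. F (hilbert_curve x)) = (LINT z:hilbert_cube k h|lborel. F z)"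
proof -
  let ?J = "dyadic (CARD('n) * k) h" and ?Q = "hilbert_cube k h :: (real ^ 'n) set"
  have [measurable]: "?Q \<in> sets borel" by (simp add: compact_hilbert_cube compact_imp_closed)
  define A where "A = {x \<in> {0..1}. hilbert_curve x \<in> ?Q}"
  interpret u: prob_space unif by (rule prob_space_unif)
  have [measurable]: "A \<in> sets borel" unfolding A_def by measurable
  have "measure unif {x. hilbert_curve x \<in> ?Q} = measure (distr unif borel hilbert_curve) ?Q"
    by (subst measure_distr) (auto simp: vimage_def)
  also have "\<dots> = measure lborel ?Q"
    unfolding distr_hilbert_curve
    by (subst measure_uniform_measure)
      (auto simp: emeasure_unit_cube measure_def Int_absorb1[OF hilbert_cube_subset_unit])
  finally have "measure unif {x. hilbert_curve x \<in> ?Q} = 1 / 2 ^ (CARD('n) * k)"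
    by (simp add: measure_hilbert_cube)
  then have mA: "measure lborel A = 1 / 2 ^ (CARD('n) * k)"
    by (subst (asm) measure_uniform_measure) (auto simp: A_def Int_def)
  have JA: "?J \<subseteq> A"
  proof
    fix x assume x: "x \<in> ?J"
    then show "x \<in> A"
      using dyadic_subset_unit[OF h] hilbert_curve_in_cube[OF dyadic_nonneg[OF x], of k]
        hilbert_idx_dyadic[OF x h] by (auto simp: A_def)
  qed
  have fin: "emeasure lborel A < \<infinity>"
    by (rule le_less_trans[OF emeasure_mono[of _ "{0..1}"]]) (auto simp: A_def)
  have finJ: "emeasure lborel ?J < \<infinity>"
    by (rule le_less_trans[OF emeasure_mono[OF JA] fin]) simp
  have "emeasure lborel ?J = ennreal (measure lborel ?J)"
    by (rule emeasure_eq_ennreal_measure) (use finJ in simp)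
  also have "\<dots> = ennreal (measure lborel A)" by (simp only: mA measure_dyadic)
  also have "\<dots> = emeasure lborel A"
    by (rule emeasure_eq_ennreal_measure[symmetric]) (use fin in simp)
  finally have eq: "emeasure lborel ?J = emeasure lborel A" .
  have "emeasure lborel (A - ?J) = emeasure lborel A - emeasure lborel ?J"
    using JA finJ by (intro emeasure_Diff) auto
  also have "\<dots> = 0"
    using fin by (simp add: eq)
  finally have "A - ?J \<in> null_sets lborel" by (auto simp: null_sets_def)
  then have ae: "AE x in lborel. x \<notin> A - ?J" by (rule AE_not_in)
  have "(LINT x:?J|lborel. F (hilbert_curve x)) = (LINT x:A|lborel. F (hilbert_curve x))"
    unfolding set_lebesgue_integral_def
  proof (rule integral_cong_AE)
    show "AE x in lborel. indicator ?J x *\<^sub>R F (hilbert_curve x) = indicator A x *\<^sub>R F (hilbert_curve x)"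
      using ae by eventually_elim (use JA in \<open>auto simp: indicator_def\<close>)
  qed measurable
  also have "\<dots> = (LINT x:{0..1}|lborel. indicator ?Q (hilbert_curve x) * F (hilbert_curve x))"
    unfolding set_lebesgue_integral_def
    by (intro Bochner_Integration.integral_cong) (auto simp: A_def indicator_def)
  also have "\<dots> = (LINT z:cbox 0 1|lborel. indicator ?Q z * F z)"
    by (rule integral_hilbert_curve) measurable
  also have "\<dots> = (LINT z:?Q|lborel. F z)"
    unfolding set_lebesgue_integral_def using hilbert_cube_subset_unit
    by (intro Bochner_Integration.integral_cong) (auto simp: indicator_def)
  finally show ?thesis .
qed

section \<open>Nested uniform scrambling\<close>

abbreviation perm_measure :: "nat \<Rightarrow> (nat \<Rightarrow> nat) measure" where
  "perm_measure b \<equiv> measure_pmf (pmf_of_set {p. p permutes {..<b}})"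

abbreviation perm_space :: "nat \<Rightarrow> (nat list \<Rightarrow> nat \<Rightarrow> nat) measure" where
  "perm_space b \<equiv> PiM UNIV (\<lambda>_::nat list. perm_measure b)"

lemma permutes_finite_nonempty: "finite {p. p permutes {..<b::nat}}" "{p. p permutes {..<b}} \<noteq> {}"
  using permutes_id[of "{..<b}"] by (blast intro: finite_permutations finite_lessThan)+

text \<open>Composition with the transposition of x and y injects the permutations sending c to x
  into those sending c to y, so the b fibres have equal size.\<close>

lemma measure_perm_eq:
  assumes c: "c < b" and a: "a < b"
  shows "measure (perm_measure b) {p. p c = a} = 1 / real b"
proof -
  let ?S = "{p. p permutes {..<b}}"
  let ?C = "\<lambda>x. {p. p permutes {..<b} \<and> p c = x}"
  have le: "card (?C x) \<le> card (?C y)" if xy: "x < b" "y < b" for x y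
  proof (rule card_inj_on_le)
    show "inj_on ((\<circ>) (Transposition.transpose x y)) (?C x)"
      by (auto simp: inj_on_def fun_eq_iff) (metis transpose_involutory)
    show "(\<circ>) (Transposition.transpose x y) ` ?C x \<subseteq> ?C y"
      using xy by (auto intro!: permutes_compose permutes_swap_id)
    show "finite (?C y)"
      by (rule finite_subset[OF _ permutes_finite_nonempty(1)[of b]]) auto
  qed
  have eq: "card (?C x) = card (?C a)" if "x < b" for x
    using le[OF that a] le[OF a that] by simp
  have "?S = (\<Union>x\<in>{..<b}. ?C x)"
    using permutes_in_image[of _ "{..<b}" c] c by blast
  then have "card ?S = (\<Sum>x<b. card (?C x))"
    by (simp only:) (rule card_UN_disjoint; auto intro: finite_subset[OF _ permutes_finite_nonempty(1)[of b]])
  also have "\<dots> = b * card (?C a)" using eq by simp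
  finally have card: "card ?S = b * card (?C a)" .
  have "?S \<inter> {p. p c = a} = ?C a" by auto
  then have "measure (perm_measure b) {p. p c = a} = card (?C a) / card ?S"
    using permutes_finite_nonempty[of b] by (simp add: measure_pmf_of_set)
  moreover have "card ?S > 0"
    using permutes_finite_nonempty[of b] by (simp add: card_gt_0_iff)
  ultimately show ?thesis unfolding card using c by (simp add: field_simps)
qed

text \<open>Sample points are arbitrary families of functions; being permutations holds almost
  surely, simultaneously at the countably many nodes.\<close>

lemma AE_perm_space: "AE \<omega> in perm_space b. \<forall>l. \<omega> l permutes {..<b}"
proof -
  have "AE p in perm_measure b. p permutes {..<b}"
    using permutes_finite_nonempty[of b] by (auto simp: AE_measure_pmf_iff)
  then have "AE \<omega> in perm_space b. \<omega> l permutes {..<b}" for l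
    by (intro AE_PiM_component) (auto intro: prob_space_measure_pmf)
  then show ?thesis by (simp add: AE_all_countable)
qed

lemma prob_space_perm_space: "prob_space (perm_space b)"
  by (intro prob_space_PiM prob_space_measure_pmf)

section \<open>Base-b expansions with random digits\<close>

primrec digit_prefix :: "nat \<Rightarrow> (nat \<Rightarrow> nat) \<Rightarrow> nat \<Rightarrow> nat" where
  "digit_prefix b a 0 = 0"
| "digit_prefix b a (Suc r) = b * digit_prefix b a r + a r"

definition digit_series :: "nat \<Rightarrow> (nat \<Rightarrow> nat) \<Rightarrow> real" where
  "digit_series b a = (\<Sum>j. real (a j) / real b ^ Suc j)"

lemma digit_prefix_less: "(\<And>j. a j < b) \<Longrightarrow> digit_prefix b a r < b ^ r"
proof (induction r)
  case (Suc r)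
  then have "digit_prefix b a r + 1 \<le> b ^ r" "a r < b" by auto
  then have "b * digit_prefix b a r + a r < b * (digit_prefix b a r + 1)" by simp
  also have "\<dots> \<le> b * b ^ r" using Suc by (intro mult_left_mono) auto
  finally show ?case by simp
qed simp

lemma digit_prefix_eq:
  "h < b ^ r \<Longrightarrow> (\<And>j. j < r \<Longrightarrow> a j = h div b ^ (r - 1 - j) mod b) \<Longrightarrow> digit_prefix b a r = h"
proof (induction r arbitrary: h)
  case (Suc r)
  have "digit_prefix b a r = h div b"
  proof (rule Suc.IH)
    show "h div b < b ^ r" using Suc.prems(1) by (simp add: less_mult_imp_div_less mult.commute)
    fix j assume j: "j < r"
    then have "Suc r - 1 - j = Suc (r - 1 - j)" by simp
    then show "a j = h div b div b ^ (r - 1 - j) mod b"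
      using Suc.prems(2)[of j] j by (simp add: div_mult2_eq)
  qed
  moreover have "a r = h mod b" using Suc.prems(2)[of r] by simp
  ultimately show ?case by simp
qed simp

context
  fixes b :: nat and a :: "nat \<Rightarrow> nat"
  assumes b: "2 \<le> b" and a: "\<And>j. a j < b"
begin

lemma digit_geometric: "(\<lambda>j. (real b - 1) / real b ^ Suc j) sums 1"
proof -
  have "(\<lambda>j. (1 / real b) ^ j) sums (1 / (1 - 1 / real b))" using b by (intro geometric_sums) auto
  then have "(\<lambda>j. ((real b - 1) / real b) * (1 / real b) ^ j) sums (((real b - 1) / real b) * (1 / (1 - 1 / real b)))"
    by (rule sums_mult)
  moreover have "((real b - 1) / real b) * (1 / (1 - 1 / real b)) = 1" using b by (simp add: field_simps)
  ultimately have "(\<lambda>j. ((real b - 1) / real b) * (1 / real b) ^ j) sums 1" by (simp only:)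
  then show ?thesis by (simp add: power_divide)
qed

lemma digit_le: "real (a j) / real b ^ Suc j \<le> (real b - 1) / real b ^ Suc j"
proof (rule divide_right_mono)
  have "a j + 1 \<le> b" using a[of j] by simp
  then have "real (a j + 1) \<le> real b" by (simp only: of_nat_le_iff)
  then show "real (a j) \<le> real b - 1" by simp
qed simp

lemma digit_summable: "summable (\<lambda>j. real (a j) / real b ^ Suc j)"
  by (rule summable_comparison_test'[OF sums_summable[OF digit_geometric]])
    (use digit_le in auto)

lemma digit_series_bounds: "0 \<le> digit_series b a" "digit_series b a \<le> 1"
proof -
  show "0 \<le> digit_series b a" unfolding digit_series_def by (intro suminf_nonneg digit_summable) simp
  have "digit_series b a \<le> (\<Sum>j. (real b - 1) / real b ^ Suc j)" unfolding digit_series_def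
    by (intro suminf_le digit_le digit_summable sums_summable[OF digit_geometric])
  then show "digit_series b a \<le> 1" using sums_unique[OF digit_geometric] by simp
qed

lemma sum_digits: "(\<Sum>j<r. real (a j) / real b ^ Suc j) = real (digit_prefix b a r) / real b ^ r"
  using b by (induction r) (auto simp: field_simps)

text \<open>The first r digits number a b-adic interval of length b^(-r), the shifted series is the
  relative position in it. With r = m this yields the stratum and the position within the
  stratum.\<close>

lemma digit_series_split:
  "digit_series b a = (real (digit_prefix b a r) + digit_series b (\<lambda>j. a (j + r))) / real b ^ r"
proof -
  have "(\<Sum>j. real (a (j + r)) / real b ^ Suc (j + r)) = (\<Sum>j. (1 / real b ^ r) * (real (a (j + r)) / real b ^ Suc j))"
    by (intro suminf_cong) (simp add: power_add)
  also have "\<dots> = (1 / real b ^ r) * digit_series b (\<lambda>j. a (j + r))"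
    unfolding digit_series_def
  proof (rule suminf_mult)
    have "summable (\<lambda>j. real b ^ r * (real (a (j + r)) / real b ^ Suc (j + r)))"
      by (intro summable_mult summable_ignore_initial_segment[OF digit_summable])
    then show "summable (\<lambda>j. real (a (j + r)) / real b ^ Suc j)"
      using b by (simp add: power_add)
  qed
  finally show ?thesis
    unfolding digit_series_def suminf_split_initial_segment[OF digit_summable, of r] sum_digits
    by (simp add: add_divide_distrib)
qed

end

lemma borel_measurable_digit_series [measurable]:
  assumes "\<And>j. (\<lambda>\<omega>. a \<omega> j) \<in> M \<rightarrow>\<^sub>M count_space UNIV"
  shows "(\<lambda>\<omega>. digit_series b (a \<omega>)) \<in> borel_measurable M"
proof -
  note assms[measurable]
  show ?thesis unfolding digit_series_def by measurable
qed

lemma measurable_digit_prefix [measurable]: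
  assumes "\<And>j. j < r \<Longrightarrow> (\<lambda>\<omega>. a \<omega> j) \<in> M \<rightarrow>\<^sub>M count_space UNIV"
  shows "(\<lambda>\<omega>. digit_prefix b (a \<omega>) r) \<in> M \<rightarrow>\<^sub>M count_space UNIV"
  using assms
proof (induction r)
  case (Suc r)
  then have [measurable]: "(\<lambda>\<omega>. digit_prefix b (a \<omega>) r) \<in> M \<rightarrow>\<^sub>M count_space UNIV"
    "(\<lambda>\<omega>. a \<omega> r) \<in> M \<rightarrow>\<^sub>M count_space UNIV" by auto
  show ?case by simp
qed simp

lemma measurable_perm_component:
  assumes "l \<in> I"
  shows "(\<lambda>\<omega>. \<omega> l c) \<in> PiM I (\<lambda>_. perm_measure b) \<rightarrow>\<^sub>M count_space UNIV"
proof (rule measurable_compose[OF measurable_component_singleton[OF assms]])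
  show "(\<lambda>p. p c) \<in> perm_measure b \<rightarrow>\<^sub>M count_space UNIV" by simp
qed

text \<open>Along an injective sequence of nodes the permutations are independent, so their values
  at 0 are independent uniform digits and every b-adic cell has probability b^(-r). The argument is
  0 because van der Corput digits beyond level m vanish for the first b^m indices.\<close>

theorem distr_digit_series:
  fixes l :: "nat \<Rightarrow> nat list"
  assumes b: "2 \<le> b" and l: "inj l"
  shows "distr (perm_space b) borel (\<lambda>\<omega>. digit_series b (\<lambda>j. \<omega> (l j) 0)) = unif"
proof -
  interpret P: prob_space "perm_space b" by (rule prob_space_perm_space)
  interpret PP: product_prob_space "\<lambda>_. perm_measure b" "UNIV :: nat list set"
    by unfold_locales
  have [measurable]: "(\<lambda>\<omega>. \<omega> (l j) 0) \<in> perm_space b \<rightarrow>\<^sub>M count_space UNIV" for j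
    by (rule measurable_perm_component) simp
  \<comment> \<open>Digits below b are demanded at all positions, an almost sure event, so that
    \<open>digit_series_bounds\<close> is available at every sample point of
    \<open>E r h\<close>.\<close>
  define E where "E r h = {\<omega> \<in> space (perm_space b). (\<forall>j. \<omega> (l j) 0 < b) \<and> digit_prefix b (\<lambda>j. \<omega> (l j) 0) r = h}" for r h
  define Q where "Q r h = {real h / real b ^ r .. (real h + 1) / real b ^ r}" for r h
  show ?thesis
  proof (rule distr_eq_uniform_of_cells[where I="\<lambda>r. {..<b ^ r}" and E=E and Q=Q and \<delta>="\<lambda>r. (1 / real b) ^ r"])
    show "(\<lambda>\<omega>. digit_series b (\<lambda>j. \<omega> (l j) 0)) \<in> borel_measurable (perm_space b)"
      by measurable
    show "E r h \<in> sets (perm_space b)" for r h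
      unfolding E_def by measurable
    show "disjoint_family_on (E r) {..<b ^ r}" for r
      by (auto simp: disjoint_family_on_def E_def)
    show "digit_series b (\<lambda>j. \<omega> (l j) 0) \<in> Q r h" if "h \<in> {..<b ^ r}" "\<omega> \<in> E r h" for r h \<omega>
    proof -
      have lt: "\<omega> (l j) 0 < b" for j using that by (auto simp: E_def)
      have "digit_series b (\<lambda>j. \<omega> (l j) 0) = (real h + digit_series b (\<lambda>j. \<omega> (l (j + r)) 0)) / real b ^ r"
        using that digit_series_split[OF b, of "\<lambda>j. \<omega> (l j) 0" r] lt by (simp add: E_def)
      moreover note digit_series_bounds[OF b, of "\<lambda>j. \<omega> (l (j + r)) 0", OF lt]
      ultimately show ?thesis by (simp add: Q_def divide_right_mono)
    qed
    show "compact (Q r h)" for r h by (simp add: Q_def)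
    show "measure lborel (Q r h) \<le> measure (perm_space b) (E r h)" if h: "h \<in> {..<b ^ r}" for r h
    proof -
      \<comment> \<open>\<open>inv l\<close> recovers the position of a node; the set prescribes the
        base-b digit of h at that position, leading digit first.\<close>
      define D where "D t = {p::nat \<Rightarrow> nat. p 0 = h div b ^ (r - 1 - inv l t) mod b}" for t
      have "measure lborel (Q r h) = 1 / real b ^ r"
        by (simp add: Q_def divide_right_mono diff_divide_distrib[symmetric])
      also have "\<dots> = (\<Prod>t\<in>l ` {..<r}. measure (perm_measure b) (D t))"
        using b l by (simp add: D_def measure_perm_eq power_divide)
          (simp add: card_image inj_on_subset[OF l])
      also have "\<dots> = measure (perm_space b) (PP.emb UNIV (l ` {..<r}) (Pi\<^sub>E (l ` {..<r}) D))"
        by (intro PP.measure_PiM_emb[symmetric]) auto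
      also have "\<dots> \<le> measure (perm_space b) (E r h)"
      proof (rule P.finite_measure_mono_AE)
        show "AE \<omega> in perm_space b. \<omega> \<in> PP.emb UNIV (l ` {..<r}) (Pi\<^sub>E (l ` {..<r}) D) \<longrightarrow> \<omega> \<in> E r h"
          using AE_perm_space AE_space
        proof eventually_elim
          case (elim \<omega>)
          have "\<omega> (l j) 0 < b" for j
            using elim b permutes_in_image[of "\<omega> (l j)" "{..<b}" 0] by auto
          moreover have "digit_prefix b (\<lambda>j. \<omega> (l j) 0) r = h"
            if "\<omega> \<in> PP.emb UNIV (l ` {..<r}) (Pi\<^sub>E (l ` {..<r}) D)"
          proof (rule digit_prefix_eq)
            fix j assume "j < r"
            then have "\<omega> (l j) \<in> D (l j)" using that by (auto simp: prod_emb_def PiE_iff)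
            then show "\<omega> (l j) 0 = h div b ^ (r - 1 - j) mod b" by (simp add: D_def inv_f_f[OF l])
          qed (use h in simp)
          ultimately show ?case using elim by (simp add: E_def)
        qed
      qed (auto simp: E_def; measurable)
      finally show ?thesis .
    qed
    show "dist x y \<le> (1 / real b) ^ r" if "x \<in> Q r h" "y \<in> Q r h" for r h x y
      using that by (auto simp: Q_def dist_real_def add_divide_distrib power_divide)
    show "(\<lambda>r. (1 / real b) ^ r) \<longlonglongrightarrow> 0" using b by (intro LIMSEQ_realpow_zero) auto
    show "{0..1} \<subseteq> (\<Union>h\<in>{..<b ^ r}. Q r h)" for r
    proof
      fix x :: real assume x: "x \<in> {0..1}"
      have B: "real b ^ r > 0" using b by simp
      show "x \<in> (\<Union>h\<in>{..<b ^ r}. Q r h)"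
      proof (cases "x = 1")
        \<comment> \<open>The floor would number the endpoint 1 one too high; the closed last cell
          contains it.\<close>
        case True
        have "real (b ^ r - 1) = real b ^ r - 1" using b by (simp add: of_nat_diff)
        then have "x \<in> Q r (b ^ r - 1)" using B True by (simp add: Q_def field_simps)
        then show ?thesis using b by (intro UN_I[of "b ^ r - 1"]) auto
      next
        case False
        define h where "h = nat \<lfloor>x * real b ^ r\<rfloor>"
        have h: "real h = of_int \<lfloor>x * real b ^ r\<rfloor>" using x by (simp add: h_def)
        have "x * real b ^ r < 1 * real b ^ r" using x False B by (intro mult_strict_right_mono) auto
        then have "real h < real (b ^ r)" using h by simp linarith
        then have "h < b ^ r" by (simp only: of_nat_less_iff)
        moreover have "x \<in> Q r h" using B h by (simp add: Q_def field_simps) linarith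
        ultimately show ?thesis by blast
      qed
    qed
  qed (use P.prob_space_axioms in auto)
qed

section \<open>Strata and tails of the scrambled points\<close>

definition scr_digit :: "nat \<Rightarrow> (nat list \<Rightarrow> nat \<Rightarrow> nat) \<Rightarrow> nat \<Rightarrow> nat \<Rightarrow> nat" where
  "scr_digit b \<omega> i j = \<omega> (map (vdc_digit b i) [1..<Suc j]) (vdc_digit b i (Suc j))"

text \<open>The node at which the permutation for digit m + 1 sits: van der Corput digits are
  numbered from 1, positions in \<open>scr_digit\<close> from 0.\<close>

definition vdc_prefix :: "nat \<Rightarrow> nat \<Rightarrow> nat \<Rightarrow> nat list" where
  "vdc_prefix b m i = map (vdc_digit b i) [1..<Suc m]"

lemma scr_vdc_eq: "scr_vdc b \<omega> i = digit_series b (scr_digit b \<omega> i)"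
  by (simp add: scr_vdc_def digit_series_def scr_digit_def)

lemma vdc_digit_less: "2 \<le> b \<Longrightarrow> vdc_digit b i j < b"
  by (simp add: vdc_digit_def)

lemma length_vdc_prefix [simp]: "length (vdc_prefix b m i) = m"
  by (simp add: vdc_prefix_def)

lemma vdc_prefix_Suc: "vdc_prefix b (Suc m) i = vdc_prefix b m i @ [vdc_digit b i (Suc m)]"
  by (simp add: vdc_prefix_def)

lemma scr_digit_eq: "scr_digit b \<omega> i j = \<omega> (vdc_prefix b j i) (vdc_digit b i (Suc j))"
  by (simp add: scr_digit_def vdc_prefix_def)

lemma vdc_digit_zero:
  assumes "2 \<le> b" "i \<in> {1..b ^ m}" "m < j"
  shows "vdc_digit b i j = 0"
proof -
  have "i - 1 < b ^ m" using assms by auto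
  also have "b ^ m \<le> b ^ (j - 1)" using assms by (intro power_increasing) auto
  finally show ?thesis by (simp add: vdc_digit_def)
qed

text \<open>An index up to b^m has no nonzero digit beyond the m-th, so from level m on its path
  through the tree of permutations continues with zeros.\<close>

lemma vdc_prefix_add:
  assumes "2 \<le> b" "i \<in> {1..b ^ m}"
  shows "vdc_prefix b (j + m) i = vdc_prefix b m i @ replicate j 0"
proof (induction j)
  case (Suc j)
  have "vdc_digit b i (Suc (j + m)) = 0" using assms by (intro vdc_digit_zero) auto
  then show ?case by (simp add: Suc vdc_prefix_Suc replicate_append_same)
qed simp

text \<open>Van der Corput digits start with the least significant one, so m of them encode i - 1
  modulo b^m.\<close>

lemma vdc_prefix_mod_inj:
  assumes b: "2 \<le> b"
  shows "vdc_prefix b m i = vdc_prefix b m i' \<Longrightarrow> (i - 1) mod b ^ m = (i' - 1) mod b ^ m"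
proof (induction m)
  case (Suc m)
  then have "(i - 1) mod b ^ m = (i' - 1) mod b ^ m" "vdc_digit b i (Suc m) = vdc_digit b i' (Suc m)"
    by (simp_all add: vdc_prefix_Suc)
  then show ?case
    by (simp add: vdc_digit_def mod_mult2_eq mult.commute[of b])
qed simp

lemma vdc_prefix_inj:
  assumes b: "2 \<le> b"
  shows "inj_on (vdc_prefix b m) {1..b ^ m}"
proof (rule inj_onI)
  fix i i' assume *: "i \<in> {1..b ^ m}" "i' \<in> {1..b ^ m}" "vdc_prefix b m i = vdc_prefix b m i'"
  have "i - 1 < b ^ m" "i' - 1 < b ^ m" using * by auto
  then have "i - 1 = i' - 1" using vdc_prefix_mod_inj[OF b *(3)] by simp
  moreover have "1 \<le> i" "1 \<le> i'" using * by auto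
  ultimately show "i = i'" by linarith
qed

text \<open>The number of the stratum receiving point i; \<open>scr_tail\<close> is the position of
  the point inside it, rescaled to [0, 1].\<close>

definition scr_index :: "nat \<Rightarrow> nat \<Rightarrow> (nat list \<Rightarrow> nat \<Rightarrow> nat) \<Rightarrow> nat \<Rightarrow> nat" where
  "scr_index b m \<omega> i = digit_prefix b (scr_digit b \<omega> i) m"

definition scr_tail :: "nat \<Rightarrow> nat \<Rightarrow> (nat list \<Rightarrow> nat \<Rightarrow> nat) \<Rightarrow> nat \<Rightarrow> real" where
  "scr_tail b m \<omega> i = digit_series b (\<lambda>j. \<omega> (vdc_prefix b m i @ replicate j 0) 0)"

lemma scr_digit_less:
  assumes "2 \<le> b" "\<And>l. \<omega> l permutes {..<b}"
  shows "scr_digit b \<omega> i j < b"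
  using permutes_in_image[OF assms(2)] vdc_digit_less[OF assms(1)] by (simp add: scr_digit_eq)

lemma scr_vdc_split:
  assumes b: "2 \<le> b" and \<omega>: "\<And>l. \<omega> l permutes {..<b}" and i: "i \<in> {1..b ^ m}"
  shows "scr_vdc b \<omega> i = (real (scr_index b m \<omega> i) + scr_tail b m \<omega> i) / real (b ^ m)"
proof -
  have "scr_digit b \<omega> i (j + m) = \<omega> (vdc_prefix b m i @ replicate j 0) 0" for j
    using vdc_prefix_add[OF b i] vdc_digit_zero[OF b i] by (simp add: scr_digit_eq)
  then show ?thesis
    unfolding scr_vdc_eq using digit_series_split[OF b, of "scr_digit b \<omega> i" m] scr_digit_less[OF b \<omega>]
    by (simp add: scr_index_def scr_tail_def)
qed

text \<open>The scrambling can be decoded: by division with remainder, equal indices agree in the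
  last scrambled digit and in the index of the shorter prefix. By induction the nodes coincide, and
  the permutation sitting there is injective.\<close>

lemma scr_index_prefix_inj:
  assumes b: "2 \<le> b" and \<omega>: "\<And>l. \<omega> l permutes {..<b}"
  shows "scr_index b m \<omega> i = scr_index b m \<omega> i' \<Longrightarrow> vdc_prefix b m i = vdc_prefix b m i'"
proof (induction m)
  case (Suc m)
  let ?x = "scr_index b m \<omega> i" and ?x' = "scr_index b m \<omega> i'"
  let ?y = "scr_digit b \<omega> i m" and ?y' = "scr_digit b \<omega> i' m"
  have eq: "b * ?x + ?y = b * ?x' + ?y'" using Suc.prems by (simp add: scr_index_def)
  have lt: "?y < b" "?y' < b" by (rule scr_digit_less[OF b \<omega>])+
  have "(b * ?x + ?y) div b = ?x" "(b * ?x' + ?y') div b = ?x'" using lt by simp_all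
  then have "?x = ?x'" using eq by simp
  moreover from this have "?y = ?y'" using eq by simp
  ultimately have "vdc_prefix b m i = vdc_prefix b m i'" "?y = ?y'" using Suc.IH by auto
  then show ?case
    using permutes_inj[OF \<omega>] by (simp add: scr_digit_eq vdc_prefix_Suc inj_eq)
qed (simp add: vdc_prefix_def)

lemma scr_index_bij:
  assumes b: "2 \<le> b" and \<omega>: "\<And>l. \<omega> l permutes {..<b}"
  shows "bij_betw (scr_index b m \<omega>) {1..b ^ m} {..<b ^ m}"
proof -
  have inj: "inj_on (scr_index b m \<omega>) {1..b ^ m}"
    using scr_index_prefix_inj[OF b \<omega>] vdc_prefix_inj[OF b] by (meson inj_on_def)
  have sub: "scr_index b m \<omega> ` {1..b ^ m} \<subseteq> {..<b ^ m}"
    unfolding scr_index_def using scr_digit_less[OF b \<omega>] by (auto intro: digit_prefix_less)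
  have "card (scr_index b m \<omega> ` {1..b ^ m}) = card {..<b ^ m}"
    using card_image[OF inj] by simp
  then have "scr_index b m \<omega> ` {1..b ^ m} = {..<b ^ m}"
    using sub by (intro card_subset_eq) auto
  then show ?thesis using inj by (simp add: bij_betw_def)
qed

section \<open>The scrambled sum as a stratified sum\<close>

abbreviation strat_space :: "nat \<Rightarrow> (nat \<Rightarrow> real) measure" where
  "strat_space n \<equiv> PiM {..<n} (\<lambda>_. unif)"

abbreviation strat_sum :: "(real \<Rightarrow> real) \<Rightarrow> nat \<Rightarrow> (nat \<Rightarrow> real) \<Rightarrow> real" where
  "strat_sum \<phi> n \<equiv> \<lambda>u. \<Sum>k<n. \<phi> ((real k + u k) / real n)"

abbreviation scr_sum :: "(real \<Rightarrow> real) \<Rightarrow> nat \<Rightarrow> nat \<Rightarrow> (nat list \<Rightarrow> nat \<Rightarrow> nat) \<Rightarrow> real" where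
  "scr_sum \<phi> b m \<equiv> \<lambda>\<omega>. \<Sum>i = 1..b ^ m. \<phi> (scr_vdc b \<omega> i)"

text \<open>The coordinates are independent with the same law, so relabelling them along s leaves
  the joint law unchanged.\<close>

lemma distr_stratified_perm:
  fixes \<phi> :: "real \<Rightarrow> real"
  assumes s: "bij_betw s I {..<n}" and \<phi> [measurable]: "\<phi> \<in> borel_measurable borel" and I: "finite I"
  shows "distr (PiM I (\<lambda>_. unif)) borel (\<lambda>u. \<Sum>i\<in>I. \<phi> ((real (s i) + u i) / real n))
       = distr (strat_space n) borel (strat_sum \<phi> n)"
proof -
  have re: "distr (strat_space n) (PiM I (\<lambda>_. unif)) (\<lambda>\<omega>. \<lambda>i\<in>I. \<omega> (s i)) = PiM I (\<lambda>_. unif)"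
    using s by (intro distr_PiM_reindex prob_space_unif) (auto simp: bij_betw_def)
  have si: "i \<in> I \<Longrightarrow> s i \<in> {..<n}" for i using s by (auto simp: bij_betw_def)
  have [measurable]: "(\<lambda>\<omega>. \<lambda>i\<in>I. \<omega> (s i)) \<in> strat_space n \<rightarrow>\<^sub>M PiM I (\<lambda>_. unif)"
    by (intro measurable_restrict measurable_component_singleton si)
  have "distr (PiM I (\<lambda>_. unif)) borel (\<lambda>u. \<Sum>i\<in>I. \<phi> ((real (s i) + u i) / real n))
     = distr (distr (strat_space n) (PiM I (\<lambda>_. unif)) (\<lambda>\<omega>. \<lambda>i\<in>I. \<omega> (s i))) borel
          (\<lambda>u. \<Sum>i\<in>I. \<phi> ((real (s i) + u i) / real n))"
    by (simp only: re)
  also have "\<dots> = distr (strat_space n) borel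
      ((\<lambda>u. \<Sum>i\<in>I. \<phi> ((real (s i) + u i) / real n)) \<circ> (\<lambda>\<omega>. \<lambda>i\<in>I. \<omega> (s i)))"
  proof (rule distr_distr)
    show "(\<lambda>u. \<Sum>i\<in>I. \<phi> ((real (s i) + u i) / real n)) \<in> borel_measurable (PiM I (\<lambda>_. unif))"
    proof (rule borel_measurable_sum)
      fix i assume "i \<in> I"
      then show "(\<lambda>u. \<phi> ((real (s i) + u i) / real n)) \<in> borel_measurable (PiM I (\<lambda>_. unif))"
        by (intro measurable_compose[OF measurable_component_singleton]) measurable
    qed
  qed measurable
  also have "(\<lambda>u. \<Sum>i\<in>I. \<phi> ((real (s i) + u i) / real n)) \<circ> (\<lambda>\<omega>. \<lambda>i\<in>I. \<omega> (s i))
     = (strat_sum \<phi> n)"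
    by (simp add: fun_eq_iff sum.reindex_bij_betw[OF s, symmetric])
  finally show ?thesis .
qed

lemma indep_perm_components: 
  "prob_space.indep_vars (perm_space b) (\<lambda>_. perm_measure b) (\<lambda>l \<omega>. \<omega> l) UNIV"
proof -
  interpret P: prob_space "perm_space b" by (rule prob_space_perm_space)
  have "distr (perm_space b) (perm_space b) (\<lambda>\<omega>. \<lambda>l\<in>UNIV. \<omega> l) = perm_space b"
    by (subst distr_id2[symmetric]) (auto intro!: distr_cong)
  moreover have "distr (perm_space b) (perm_measure b) (\<lambda>\<omega>. \<omega> l) = perm_measure b" for l
    by (rule distr_PiM_component) (auto intro: prob_space_measure_pmf)
  ultimately show ?thesis
    by (subst P.indep_vars_iff_distr_eq_PiM) auto
qed

text \<open>Point i reads its tail along the zero ray \<open>L i\<close> that starts at its own node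
  of length m. Distinct nodes give disjoint rays, hence independent tails, and each tail is uniform
  by \<open>distr_digit_series\<close>.\<close>

lemma distr_scr_tail:
  assumes b: "2 \<le> b"
  shows "distr (perm_space b) (PiM {1..b ^ m} (\<lambda>_. borel)) (\<lambda>\<omega>. \<lambda>i\<in>{1..b ^ m}. scr_tail b m \<omega> i)
       = PiM {1..b ^ m} (\<lambda>_. unif)"
proof -
  let ?I = "{1..b ^ m}"
  interpret P: prob_space "perm_space b" by (rule prob_space_perm_space)
  define L where "L i = {vdc_prefix b m i @ replicate j 0 | j. True}" for i
  have tail_meas: "(\<lambda>\<omega>. scr_tail b m \<omega> i) \<in> borel_measurable (PiM K (\<lambda>_. perm_measure b))"
    if "L i \<subseteq> K" for i K
    unfolding scr_tail_def using that
    by (intro borel_measurable_digit_series measurable_perm_component) (auto simp: L_def)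
  have "P.indep_vars (\<lambda>i. PiM (L i) (\<lambda>_. perm_measure b)) (\<lambda>i \<omega>. restrict (\<lambda>l. \<omega> l) (L i)) ?I"
  proof (rule P.indep_vars_restrict[OF indep_perm_components])
    show "disjoint_family_on L ?I"
      using vdc_prefix_inj[OF b, of m] unfolding disjoint_family_on_def L_def inj_on_def by auto
  qed auto
  then have "P.indep_vars (\<lambda>_. borel) (\<lambda>i \<omega>. scr_tail b m (restrict (\<lambda>l. \<omega> l) (L i)) i) ?I"
    by (rule P.indep_vars_compose2) (rule tail_meas, simp)
  moreover have "scr_tail b m (restrict (\<lambda>l. \<omega> l) (L i)) i = scr_tail b m \<omega> i" for i and \<omega>
    unfolding scr_tail_def by (intro arg_cong[where f="digit_series b"] ext) (auto simp: L_def)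
  ultimately have "P.indep_vars (\<lambda>_. borel) (\<lambda>i \<omega>. scr_tail b m \<omega> i) ?I" by simp
  then have "distr (perm_space b) (PiM ?I (\<lambda>_. borel)) (\<lambda>\<omega>. \<lambda>i\<in>?I. scr_tail b m \<omega> i)
      = PiM ?I (\<lambda>i. distr (perm_space b) borel (\<lambda>\<omega>. scr_tail b m \<omega> i))"
    using tail_meas[of _ UNIV] b by (subst P.indep_vars_iff_distr_eq_PiM'[symmetric]) auto
  also have "\<dots> = PiM ?I (\<lambda>_. unif)"
    unfolding scr_tail_def
    by (intro PiM_cong refl distr_digit_series b) (auto simp: inj_def)
  finally show ?thesis .
qed

text \<open>The stratum numbers read nodes of length below m, the tails nodes of length at least m.
  Casting the numbers to reals makes both vectors elements of the same Borel product space.\<close>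

lemma indep_scr_index_tail:
  assumes b: "2 \<le> b"
  shows "prob_space.indep_var (perm_space b)
     (PiM {1..b ^ m} (\<lambda>_. borel)) (\<lambda>\<omega>. \<lambda>i\<in>{1..b ^ m}. real (scr_index b m \<omega> i))
     (PiM {1..b ^ m} (\<lambda>_. borel)) (\<lambda>\<omega>. \<lambda>i\<in>{1..b ^ m}. scr_tail b m \<omega> i)"
proof -
  let ?I = "{1..b ^ m}"
  interpret P: prob_space "perm_space b" by (rule prob_space_perm_space)
  define A where "A = {l :: nat list. length l < m}"
  define B where "B = {l :: nat list. m \<le> length l}"
  have "P.indep_var (PiM A (\<lambda>_. perm_measure b)) (\<lambda>\<omega>. restrict (\<lambda>l. \<omega> l) A)
     (PiM B (\<lambda>_. perm_measure b)) (\<lambda>\<omega>. restrict (\<lambda>l. \<omega> l) B)"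
    by (rule P.indep_var_restrict[OF indep_perm_components]) (auto simp: A_def B_def)
  then have "P.indep_var (PiM ?I (\<lambda>_. borel)) ((\<lambda>\<omega>. \<lambda>i\<in>?I. real (scr_index b m \<omega> i)) \<circ> (\<lambda>\<omega>. restrict (\<lambda>l. \<omega> l) A))
     (PiM ?I (\<lambda>_. borel)) ((\<lambda>\<omega>. \<lambda>i\<in>?I. scr_tail b m \<omega> i) \<circ> (\<lambda>\<omega>. restrict (\<lambda>l. \<omega> l) B))"
  proof (rule P.indep_var_compose)
    have index: "(\<lambda>\<omega>. scr_index b m \<omega> i) \<in> PiM A (\<lambda>_. perm_measure b) \<rightarrow>\<^sub>M count_space UNIV" for i
      unfolding scr_index_def scr_digit_eq
      by (intro measurable_digit_prefix measurable_perm_component) (auto simp: A_def)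
    show "(\<lambda>\<omega>. \<lambda>i\<in>?I. real (scr_index b m \<omega> i)) \<in> PiM A (\<lambda>_. perm_measure b) \<rightarrow>\<^sub>M PiM ?I (\<lambda>_. borel)"
      by (rule measurable_restrict, rule measurable_compose[OF index]) simp
    show "(\<lambda>\<omega>. \<lambda>i\<in>?I. scr_tail b m \<omega> i) \<in> PiM B (\<lambda>_. perm_measure b) \<rightarrow>\<^sub>M PiM ?I (\<lambda>_. borel)"
      unfolding scr_tail_def
      by (intro measurable_restrict borel_measurable_digit_series measurable_perm_component) (auto simp: B_def)
  qed
  moreover have prefix_cong: "digit_prefix b a r = digit_prefix b a' r" if "\<And>j. j < r \<Longrightarrow> a j = a' j" for a a' r
    using that by (induction r) auto
  have "scr_index b m (restrict (\<lambda>l. \<omega> l) A) i = scr_index b m \<omega> i" for \<omega> i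
    unfolding scr_index_def by (rule prefix_cong) (simp add: scr_digit_eq A_def)
  moreover have "scr_tail b m (restrict (\<lambda>l. \<omega> l) B) = scr_tail b m \<omega>" for \<omega>
    unfolding scr_tail_def by (intro ext arg_cong[where f="digit_series b"]) (auto simp: B_def)
  ultimately show ?thesis by (simp add: o_def)
qed

lemma borel_measurable_scr_vdc: "(\<lambda>\<omega>. scr_vdc b \<omega> i) \<in> borel_measurable (perm_space b)"
  unfolding scr_vdc_eq scr_digit_eq
  by (intro borel_measurable_digit_series measurable_perm_component) simp

text \<open>Conditionally on the first \<open>m\<close> levels of permutations the points are a stratified sample,
  and the unconditional law does not depend on which point falls into which stratum.\<close>
theorem distr_scr_vdc_sum:
  fixes \<phi> :: "real \<Rightarrow> real"
  assumes b: "2 \<le> b" and \<phi> [measurable]: "\<phi> \<in> borel_measurable borel"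
  shows "distr (perm_space b) borel (scr_sum \<phi> b m)
       = distr (strat_space (b ^ m)) borel (strat_sum \<phi> (b ^ m))"
    (is "?L = ?R")
proof -
  let ?I = "{1..b ^ m}" and ?P = "perm_space b"
  let ?C = "PiM ?I (\<lambda>_. borel :: real measure)" and ?B = "PiM ?I (\<lambda>_. borel :: real measure)"
  interpret P: prob_space ?P by (rule prob_space_perm_space)
  define S where "S = (\<lambda>\<omega>. \<lambda>i\<in>?I. real (scr_index b m \<omega> i))"
  define V where "V = (\<lambda>\<omega>. \<lambda>i\<in>?I. scr_tail b m \<omega> i)"
  define F where "F = (\<lambda>s u. \<Sum>i\<in>?I. \<phi> ((s i + u i) / real (b ^ m)))"
  have ind: "P.indep_var ?C S ?B V"
    unfolding S_def V_def by (rule indep_scr_index_tail[OF b])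
  have [measurable]: "S \<in> ?P \<rightarrow>\<^sub>M ?C" "V \<in> ?P \<rightarrow>\<^sub>M ?B"
    using ind by (auto dest: P.indep_var_rv1 P.indep_var_rv2)
  have F [measurable]: "(\<lambda>(s, u). F s u) \<in> borel_measurable (?C \<Otimes>\<^sub>M ?B)"
    unfolding F_def by measurable
  have V: "distr ?P ?B V = PiM ?I (\<lambda>_. unif)"
    unfolding V_def by (rule distr_scr_tail[OF b])
  interpret VV: prob_space "distr ?P ?B V" by (rule P.prob_space_distr) measurable
  have "?L = distr ?P borel (\<lambda>\<omega>. F (S \<omega>) (V \<omega>))"
  proof (rule distr_cong_AE)
    show "AE \<omega> in ?P. (scr_sum \<phi> b m \<omega>) = F (S \<omega>) (V \<omega>)"
      using AE_perm_space
    proof eventually_elim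
      case (elim \<omega>)
      then have "scr_vdc b \<omega> i = (S \<omega> i + V \<omega> i) / real (b ^ m)" if "i \<in> ?I" for i
        using scr_vdc_split[OF b, of \<omega> i m] that by (simp add: S_def V_def)
      then show ?case unfolding F_def by (intro sum.cong refl) simp
    qed
    show "(scr_sum \<phi> b m) \<in> borel_measurable ?P"
      by (intro borel_measurable_sum measurable_compose[OF borel_measurable_scr_vdc \<phi>])
    show "(\<lambda>\<omega>. F (S \<omega>) (V \<omega>)) \<in> borel_measurable ?P" by measurable
  qed auto
  also have "\<dots> = ?R"
  proof (rule measure_eqI)
    fix X assume "X \<in> sets (distr ?P borel (\<lambda>\<omega>. F (S \<omega>) (V \<omega>)))"
    then have X [measurable]: "X \<in> sets borel" by simp
    \<comment> \<open>The conditional probability of X given stratum numbers s: by independence the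
      tails keep their law while s is fixed.\<close>
    let ?slice = "\<lambda>s. emeasure (distr ?P ?B V) (Pair s -` ((\<lambda>(s, u). F s u) -` X \<inter> space (?C \<Otimes>\<^sub>M ?B)))"
    have "emeasure (distr ?P borel (\<lambda>\<omega>. F (S \<omega>) (V \<omega>))) X
        = emeasure (distr (distr ?P (?C \<Otimes>\<^sub>M ?B) (\<lambda>\<omega>. (S \<omega>, V \<omega>))) borel (\<lambda>(s, u). F s u)) X"
    proof -
      have "distr (distr ?P (?C \<Otimes>\<^sub>M ?B) (\<lambda>\<omega>. (S \<omega>, V \<omega>))) borel (\<lambda>(s, u). F s u)
          = distr ?P borel ((\<lambda>(s, u). F s u) \<circ> (\<lambda>\<omega>. (S \<omega>, V \<omega>)))"
        by (rule distr_distr[OF F]) measurable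
      then show ?thesis by (simp only: o_def prod.case)
    qed
    also have "distr ?P (?C \<Otimes>\<^sub>M ?B) (\<lambda>\<omega>. (S \<omega>, V \<omega>)) = distr ?P ?C S \<Otimes>\<^sub>M distr ?P ?B V"
      using ind unfolding P.indep_var_distribution_eq by auto
    also have "emeasure (distr (distr ?P ?C S \<Otimes>\<^sub>M distr ?P ?B V) borel (\<lambda>(s, u). F s u)) X
       = (\<integral>\<^sup>+ s. ?slice s \<partial>distr ?P ?C S)"
    proof -
      have [measurable]: "(\<lambda>(s, u). F s u) \<in> borel_measurable (distr ?P ?C S \<Otimes>\<^sub>M distr ?P ?B V)"
        using F by (simp cong: measurable_cong_sets)
      have sp: "space (distr ?P ?C S \<Otimes>\<^sub>M distr ?P ?B V) = space (?C \<Otimes>\<^sub>M ?B)"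
        by (simp only: space_pair_measure space_distr)
      have "emeasure (distr (distr ?P ?C S \<Otimes>\<^sub>M distr ?P ?B V) borel (\<lambda>(s, u). F s u)) X
          = emeasure (distr ?P ?C S \<Otimes>\<^sub>M distr ?P ?B V) ((\<lambda>(s, u). F s u) -` X \<inter> space (?C \<Otimes>\<^sub>M ?B))"
        unfolding sp[symmetric] by (rule emeasure_distr) measurable
      also have "\<dots> = (\<integral>\<^sup>+ s. ?slice s \<partial>distr ?P ?C S)"
        unfolding sp[symmetric] by (rule VV.emeasure_pair_measure_alt) measurable
      finally show ?thesis .
    qed
    also have "\<dots> = (\<integral>\<^sup>+ \<omega>. ?slice (S \<omega>) \<partial>?P)"
    proof -
      have "(\<lambda>s. ?slice s) \<in> borel_measurable ?C"
        by (rule VV.measurable_emeasure_Pair)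
          (use measurable_sets[OF F X] in \<open>simp only: sets_pair_measure_cong[OF refl sets_distr]\<close>)
      then show ?thesis
        by (intro nn_integral_distr \<open>S \<in> ?P \<rightarrow>\<^sub>M ?C\<close>) (simp cong: measurable_cong_sets)
    qed
    \<comment> \<open>Almost surely the stratum numbers hit every stratum exactly once, and
      \<open>distr_stratified_perm\<close> gives the same slice for all such assignments.\<close>
    also have "\<dots> = (\<integral>\<^sup>+ \<omega>. emeasure ?R X \<partial>?P)"
    proof (rule nn_integral_cong_AE)
      show "AE \<omega> in ?P. ?slice (S \<omega>) = emeasure ?R X"
        using AE_perm_space AE_space
      proof eventually_elim
        case (elim \<omega>)
        have bij: "bij_betw (scr_index b m \<omega>) ?I {..<b ^ m}"
          using elim by (intro scr_index_bij[OF b]) auto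
        have FS: "F (S \<omega>) = (\<lambda>u. \<Sum>i\<in>?I. \<phi> ((real (scr_index b m \<omega> i) + u i) / real (b ^ m)))"
          by (simp add: F_def S_def)
        have SC: "S \<omega> \<in> space ?C" by (simp add: S_def space_PiM PiE_iff)
        have "Pair (S \<omega>) -` ((\<lambda>(s, u). F s u) -` X \<inter> space (?C \<Otimes>\<^sub>M ?B)) = F (S \<omega>) -` X \<inter> space ?B"
          using SC by (auto simp: space_pair_measure)
        also have "emeasure (distr ?P ?B V) \<dots> = emeasure (distr (distr ?P ?B V) borel (F (S \<omega>))) X"
        proof -
          have "F (S \<omega>) \<in> borel_measurable ?B" using measurable_Pair2[OF F SC] by simp
          then show ?thesis by (subst emeasure_distr) (simp_all cong: measurable_cong_sets)
        qed
        also have "distr (distr ?P ?B V) borel (F (S \<omega>)) = ?R"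
          unfolding V FS by (rule distr_stratified_perm[OF bij]) auto
        finally show ?case .
      qed
    qed
    also have "\<dots> = emeasure ?R X" by (simp add: P.emeasure_space_1)
    finally show "emeasure (distr ?P borel (\<lambda>\<omega>. F (S \<omega>) (V \<omega>))) X = emeasure ?R X" .
  qed simp
  finally show ?thesis .
qed

section \<open>Variance of a nearly affine function on a cube\<close>

text \<open>Lebesgue measure is the image of the product of one-dimensional Lebesgue measures under
  the coordinate expansion, and on the product side the integral factorises.\<close>

lemma integral_lborel_prod:
  fixes h :: "'a::euclidean_space \<Rightarrow> real \<Rightarrow> real"
  assumes h: "\<And>b. b \<in> Basis \<Longrightarrow> integrable lborel (h b)"
  shows "(\<integral>x. (\<Prod>b\<in>Basis. h b (x \<bullet> b)) \<partial>lborel) = (\<Prod>b\<in>Basis. \<integral>y. h b y \<partial>lborel)"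
proof -
  interpret product_sigma_finite "\<lambda>b::'a. lborel :: real measure" ..
  have h_meas: "b \<in> Basis \<Longrightarrow> h b \<in> borel_measurable borel" for b
    using borel_measurable_integrable[OF h] by simp
  have meas: "(\<lambda>x. \<Prod>b\<in>Basis. h b (x \<bullet> b)) \<in> borel_measurable borel"
    by (intro borel_measurable_prod measurable_compose[OF _ h_meas]) auto
  have "(\<integral>x. (\<Prod>b\<in>Basis. h b (x \<bullet> b)) \<partial>lborel)
      = (\<integral>f. (\<Prod>b\<in>Basis. h b ((\<Sum>b\<in>Basis. f b *\<^sub>R b) \<bullet> b)) \<partial>(\<Pi>\<^sub>M b\<in>Basis. lborel))"
    by (subst lborel_eq, subst integral_distr[OF _ meas]) measurable
  also have "\<dots> = (\<integral>f. (\<Prod>b\<in>Basis. h b (f b)) \<partial>(\<Pi>\<^sub>M b\<in>Basis. lborel))"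
    by simp
  also have "\<dots> = (\<Prod>b\<in>Basis. \<integral>y. h b y \<partial>lborel)"
    by (rule product_integral_prod[OF finite_Basis h])
  finally show ?thesis .
qed

lemma set_integrable_lborel_cbox:
  fixes f :: "'a::euclidean_space \<Rightarrow> real"
  shows "continuous_on (cbox a b) f \<Longrightarrow> set_integrable lborel (cbox a b) f"
  unfolding set_integrable_def by (rule borel_integrable_compact[OF compact_cbox])

context
  fixes a b m :: "'a::euclidean_space" and s :: real
  assumes s: "0 < s" and b: "\<And>i. i \<in> Basis \<Longrightarrow> b \<bullet> i = a \<bullet> i + s"
    and m: "\<And>i. i \<in> Basis \<Longrightarrow> m \<bullet> i = a \<bullet> i + s / 2"
begin

text \<open>The moments needed are integrals of products with one factor per coordinate. Coordinates
  are taken relative to the centre m, so that first moments vanish.\<close>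

lemma integral_cube_prod:
  fixes p :: "'a \<Rightarrow> real \<Rightarrow> real"
  assumes p: "\<And>i. i \<in> Basis \<Longrightarrow> continuous_on UNIV (p i)"
    and v: "\<And>i. i \<in> Basis \<Longrightarrow> integral {a \<bullet> i..a \<bullet> i + s} (\<lambda>y. p i (y - (a \<bullet> i + s / 2))) = v i"
  shows "integral (cbox a b) (\<lambda>x. \<Prod>i\<in>Basis. p i ((x - m) \<bullet> i)) = (\<Prod>i\<in>Basis. v i)"
proof -
  have cont: "continuous_on X (\<lambda>y. p i (y - c))" if "i \<in> Basis" for i c X
    by (rule continuous_on_compose2[OF p[OF that]]) (auto intro!: continuous_intros)
  have int: "set_integrable lborel {a \<bullet> i..a \<bullet> i + s} (\<lambda>y. p i (y - (a \<bullet> i + s / 2)))" if "i \<in> Basis" for i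
    unfolding set_integrable_def using cont[OF that] by (intro borel_integrable_compact) auto
  have contQ: "continuous_on (cbox a b) (\<lambda>x. \<Prod>i\<in>Basis. p i ((x - m) \<bullet> i))"
    by (intro continuous_on_prod continuous_on_compose2[OF p]) (auto intro!: continuous_intros)
  have "integral (cbox a b) (\<lambda>x. \<Prod>i\<in>Basis. p i ((x - m) \<bullet> i))
      = (LINT x:cbox a b|lborel. \<Prod>i\<in>Basis. p i ((x - m) \<bullet> i))"
    by (intro set_borel_integral_eq_integral(2)[symmetric] set_integrable_lborel_cbox contQ)
  also have "\<dots> = (\<integral>x. (\<Prod>i\<in>Basis. indicator {a \<bullet> i..a \<bullet> i + s} (x \<bullet> i) *\<^sub>R p i (x \<bullet> i - (a \<bullet> i + s / 2))) \<partial>lborel)"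
    unfolding set_lebesgue_integral_def
  proof (rule Bochner_Integration.integral_cong[OF refl])
    fix x :: 'a
    have "indicator (cbox a b) x = (\<Prod>i\<in>Basis. indicator {a \<bullet> i..a \<bullet> i + s} (x \<bullet> i) :: real)"
      using b by (auto simp: indicator_def mem_box prod.neutral)
    then show "indicator (cbox a b) x *\<^sub>R (\<Prod>i\<in>Basis. p i ((x - m) \<bullet> i))
        = (\<Prod>i\<in>Basis. indicator {a \<bullet> i..a \<bullet> i + s} (x \<bullet> i) *\<^sub>R p i (x \<bullet> i - (a \<bullet> i + s / 2)))"
      using m by (simp add: prod.distrib inner_diff_left)
  qed
  also have "\<dots> = (\<Prod>i\<in>Basis. \<integral>y. indicator {a \<bullet> i..a \<bullet> i + s} y *\<^sub>R p i (y - (a \<bullet> i + s / 2)) \<partial>lborel)"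
    using int unfolding set_integrable_def
    by (rule integral_lborel_prod[where h="\<lambda>i y. indicator {a \<bullet> i..a \<bullet> i + s} y *\<^sub>R p i (y - (a \<bullet> i + s / 2))"])
  also have "\<dots> = (\<Prod>i\<in>Basis. v i)"
  proof (rule prod.cong[OF refl])
    fix i :: 'a assume i: "i \<in> Basis"
    show "(\<integral>y. indicator {a \<bullet> i..a \<bullet> i + s} y *\<^sub>R p i (y - (a \<bullet> i + s / 2)) \<partial>lborel) = v i"
      using set_borel_integral_eq_integral(2)[OF int[OF i]] v[OF i] by (simp add: set_lebesgue_integral_def)
  qed
  finally show ?thesis .
qed

lemma integral_centred_1: "integral {\<alpha>..\<alpha> + s} (\<lambda>y. y - (\<alpha> + s / 2)) = 0"
proof -
  have "((\<lambda>y. y - (\<alpha> + s / 2)) has_integral ((\<alpha> + s - (\<alpha> + s / 2))\<^sup>2 / 2 - (\<alpha> - (\<alpha> + s / 2))\<^sup>2 / 2)) {\<alpha>..\<alpha> + s}"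
    using s by (intro fundamental_theorem_of_calculus)
      (auto intro!: derivative_eq_intros simp flip: has_real_derivative_iff_has_vector_derivative)
  moreover have "(\<alpha> + s - (\<alpha> + s / 2))\<^sup>2 / 2 - (\<alpha> - (\<alpha> + s / 2))\<^sup>2 / 2 = 0"
    by (simp add: power2_eq_square field_simps)
  ultimately show ?thesis by (simp only: integral_unique)
qed

lemma integral_centred_2: "integral {\<alpha>..\<alpha> + s} (\<lambda>y. (y - (\<alpha> + s / 2))\<^sup>2) = s ^ 3 / 12"
proof -
  have "((\<lambda>y. (y - (\<alpha> + s / 2))\<^sup>2) has_integral ((\<alpha> + s - (\<alpha> + s / 2)) ^ 3 / 3 - (\<alpha> - (\<alpha> + s / 2)) ^ 3 / 3)) {\<alpha>..\<alpha> + s}"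
    using s by (intro fundamental_theorem_of_calculus)
      (auto intro!: derivative_eq_intros simp flip: has_real_derivative_iff_has_vector_derivative)
  moreover have "(\<alpha> + s - (\<alpha> + s / 2)) ^ 3 / 3 - (\<alpha> - (\<alpha> + s / 2)) ^ 3 / 3 = s ^ 3 / 12"
    by (simp add: power3_eq_cube field_simps)
  ultimately show ?thesis by (simp only: integral_unique)
qed

lemma integral_cube_const: "integral (cbox a b) (\<lambda>x. 1 :: real) = s ^ DIM('a)"
  using integral_cube_prod[of "\<lambda>_ _. 1" "\<lambda>_. s"] s by simp

lemma integral_cube_coord:
  assumes e: "e \<in> Basis"
  shows "integral (cbox a b) (\<lambda>x. (x - m) \<bullet> e) = 0"
proof -
  have "(\<Prod>i\<in>Basis. (if i = e then (x - m) \<bullet> i else 1)) = (x - m) \<bullet> e" for x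
    using e by (simp add: prod.delta)
  moreover have "integral (cbox a b) (\<lambda>x. \<Prod>i\<in>Basis. (if i = e then (x - m) \<bullet> i else 1))
      = (\<Prod>i\<in>Basis. if i = e then 0 else s)"
  proof (rule integral_cube_prod[where p="\<lambda>i y. if i = e then y else 1"])
    fix i :: 'a
    show "continuous_on UNIV (\<lambda>y. if i = e then y else 1 :: real)"
      by (cases "i = e") (auto intro!: continuous_intros)
    show "integral {a \<bullet> i..a \<bullet> i + s} (\<lambda>y. if i = e then y - (a \<bullet> i + s / 2) else 1) = (if i = e then 0 else s)"
      using s by (cases "i = e") (simp_all add: integral_centred_1)
  qed
  moreover have "(\<Prod>i\<in>Basis. if i = e then 0 else s) = 0"
    using e by (intro prod_zero) auto
  ultimately show ?thesis by simp
qed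

lemma integral_cube_coord2:
  assumes e: "e \<in> Basis" "e' \<in> Basis"
  shows "integral (cbox a b) (\<lambda>x. ((x - m) \<bullet> e) * ((x - m) \<bullet> e')) = (if e = e' then s ^ (DIM('a) + 2) / 12 else 0)"
proof (cases "e = e'")
  case True
  have "(\<Prod>i\<in>Basis. (if i = e then ((x - m) \<bullet> i)\<^sup>2 else 1)) = ((x - m) \<bullet> e) * ((x - m) \<bullet> e')" for x
    using e True by (simp add: prod.delta power2_eq_square)
  moreover have "integral (cbox a b) (\<lambda>x. \<Prod>i\<in>Basis. (if i = e then ((x - m) \<bullet> i)\<^sup>2 else 1))
      = (\<Prod>i\<in>Basis. if i = e then s ^ 3 / 12 else s)"
  proof (rule integral_cube_prod[where p="\<lambda>i y. if i = e then y\<^sup>2 else 1"])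
    fix i :: 'a
    show "continuous_on UNIV (\<lambda>y. if i = e then y\<^sup>2 else 1 :: real)"
      by (cases "i = e") (auto intro!: continuous_intros)
    show "integral {a \<bullet> i..a \<bullet> i + s} (\<lambda>y. if i = e then (y - (a \<bullet> i + s / 2))\<^sup>2 else 1) = (if i = e then s ^ 3 / 12 else s)"
      using s by (cases "i = e") (simp_all add: integral_centred_2)
  qed
  moreover have "(\<Prod>i\<in>Basis. if i = e then s ^ 3 / 12 else s) = s ^ 3 / 12 * s ^ (DIM('a) - 1)"
  proof -
    have "(\<Prod>i\<in>Basis - {e}. if i = e then s ^ 3 / 12 else s) = (\<Prod>i\<in>Basis - {e}. s)"
      by (intro prod.cong) auto
    then show ?thesis
      by (simp add: prod.remove[OF finite_Basis e(1)] card_Diff_singleton[OF e(1)])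
  qed
  moreover have "s ^ 3 / 12 * s ^ (DIM('a) - 1) = s ^ (DIM('a) + 2) / 12"
    using DIM_positive[where 'a='a] by (simp flip: power_add)
  ultimately show ?thesis using True by simp
next
  case False
  have "(\<Prod>i\<in>Basis. (if i = e then (x - m) \<bullet> i else 1) * (if i = e' then (x - m) \<bullet> i else 1)) = ((x - m) \<bullet> e) * ((x - m) \<bullet> e')" for x
    using e by (simp add: prod.delta prod.distrib)
  moreover have "integral (cbox a b) (\<lambda>x. \<Prod>i\<in>Basis. (if i = e then (x - m) \<bullet> i else 1) * (if i = e' then (x - m) \<bullet> i else 1))
      = (\<Prod>i\<in>Basis. if i = e \<or> i = e' then 0 else s)"
  proof (rule integral_cube_prod[where p="\<lambda>i y. (if i = e then y else 1) * (if i = e' then y else 1)"])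
    fix i :: 'a
    show "continuous_on UNIV (\<lambda>y. (if i = e then y else 1) * (if i = e' then y else 1) :: real)"
      by (cases "i = e"; cases "i = e'") (auto intro!: continuous_intros)
    show "integral {a \<bullet> i..a \<bullet> i + s} (\<lambda>y. (if i = e then y - (a \<bullet> i + s / 2) else 1) * (if i = e' then y - (a \<bullet> i + s / 2) else 1))
        = (if i = e \<or> i = e' then 0 else s)"
      using s False by (cases "i = e"; cases "i = e'") (simp_all add: integral_centred_1)
  qed
  moreover have "(\<Prod>i\<in>Basis. if i = e \<or> i = e' then 0 else s) = 0"
    using e by (intro prod_zero) auto
  ultimately show ?thesis using False by simp
qed

text \<open>The mixed term is linear in the centred coordinates and integrates to 0, and distinct
  coordinates are uncorrelated; only the diagonal second moments s^(d+2) / 12 and the constant part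
  survive.\<close>

lemma integral_cube_affine_sq:
  "integral (cbox a b) (\<lambda>x. (v \<bullet> (x - m) - c)\<^sup>2) = s ^ (DIM('a) + 2) / 12 * (norm v)\<^sup>2 + c\<^sup>2 * s ^ DIM('a)"
proof -
  let ?w = "\<lambda>x i. (x - m) \<bullet> i"
  have int: "f integrable_on cbox a b" if "continuous_on (cbox a b) f" for f :: "'a \<Rightarrow> real"
    by (rule integrable_continuous[OF that])
  have vw: "v \<bullet> (x - m) = (\<Sum>i\<in>Basis. (v \<bullet> i) * ?w x i)" for x
    by (rule euclidean_inner)
  have "(v \<bullet> (x - m) - c)\<^sup>2 = (\<Sum>i\<in>Basis. \<Sum>j\<in>Basis. (v \<bullet> i) * (v \<bullet> j) * (?w x i * ?w x j))
      - 2 * c * (\<Sum>i\<in>Basis. (v \<bullet> i) * ?w x i) + c\<^sup>2 * 1" for x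
    unfolding power2_diff vw by (simp add: power2_eq_square sum_product ac_simps)
  then have "integral (cbox a b) (\<lambda>x. (v \<bullet> (x - m) - c)\<^sup>2)
     = integral (cbox a b) (\<lambda>x. (\<Sum>i\<in>Basis. \<Sum>j\<in>Basis. (v \<bullet> i) * (v \<bullet> j) * (?w x i * ?w x j))
      - 2 * c * (\<Sum>i\<in>Basis. (v \<bullet> i) * ?w x i) + c\<^sup>2 * 1)"
    by presburger
  also have "\<dots> = integral (cbox a b) (\<lambda>x. \<Sum>i\<in>Basis. \<Sum>j\<in>Basis. (v \<bullet> i) * (v \<bullet> j) * (?w x i * ?w x j))
      - integral (cbox a b) (\<lambda>x. 2 * c * (\<Sum>i\<in>Basis. (v \<bullet> i) * ?w x i)) + integral (cbox a b) (\<lambda>x. c\<^sup>2 * 1)"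
    by (subst integral_add integral_diff; (intro int continuous_intros)?; simp)+
  also have "integral (cbox a b) (\<lambda>x. \<Sum>i\<in>Basis. \<Sum>j\<in>Basis. (v \<bullet> i) * (v \<bullet> j) * (?w x i * ?w x j))
     = (\<Sum>i\<in>Basis. \<Sum>j\<in>Basis. (v \<bullet> i) * (v \<bullet> j) * integral (cbox a b) (\<lambda>x. ?w x i * ?w x j))"
    by (subst integral_sum; (intro finite_Basis int continuous_intros)?)+ simp
  also have "\<dots> = (\<Sum>i\<in>Basis. (v \<bullet> i) * (v \<bullet> i) * (s ^ (DIM('a) + 2) / 12))"
    by (intro sum.cong refl) (simp add: integral_cube_coord2 if_distrib[of "(*) _"] cong: if_cong)
  also have "\<dots> = s ^ (DIM('a) + 2) / 12 * (norm v)\<^sup>2"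
    unfolding power2_norm_eq_inner euclidean_inner[of v v] by (simp add: sum_distrib_left mult.commute)
  also have "integral (cbox a b) (\<lambda>x. 2 * c * (\<Sum>i\<in>Basis. (v \<bullet> i) * ?w x i)) = 0"
    by (simp add: integral_sum int continuous_intros integral_cube_coord)
  also have "integral (cbox a b) (\<lambda>x. c\<^sup>2 * 1) = c\<^sup>2 * s ^ DIM('a)"
    unfolding integral_mult_right integral_cube_const ..
  finally show ?thesis by simp
qed

text \<open>The constant c is arbitrary, because in a stratum the centring is not the mean over a
  single cube. The linearisation error is split off by a weighted inequality: it costs the fraction
  \<theta> of the main term and \<eta>^2 / \<theta> per unit volume.\<close>

lemma cube_variance_lower:
  fixes g :: "'a \<Rightarrow> real"
  assumes g: "continuous_on (cbox a b) g" and \<theta>: "0 < \<theta>" "\<theta> < 1"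
    and lin: "\<And>x. x \<in> cbox a b \<Longrightarrow> \<bar>g x - g0 - v \<bullet> (x - m)\<bar> \<le> \<eta>"
  shows "s ^ (DIM('a) + 2) / 12 * ((1 - \<theta>) * (norm v)\<^sup>2) - \<eta>\<^sup>2 / \<theta> * s ^ DIM('a)
     \<le> (LINT x:cbox a b|lborel. (g x - c)\<^sup>2)"
proof -
  have int: "f integrable_on cbox a b" if "continuous_on (cbox a b) f" for f :: "'a \<Rightarrow> real"
    by (rule integrable_continuous[OF that])
  have ptw: "(1 - \<theta>) * (v \<bullet> (x - m) - (c - g0))\<^sup>2 - \<eta>\<^sup>2 / \<theta> * 1 \<le> (g x - c)\<^sup>2" if x: "x \<in> cbox a b" for x
  proof -
    define p q where "p = g x - c" and "q = v \<bullet> (x - m) - (c - g0)"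
    have "\<bar>p - q\<bar> \<le> \<eta>" using lin[OF x] by (simp add: p_def q_def algebra_simps)
    then have "(p - q)\<^sup>2 \<le> \<eta>\<^sup>2" by (metis abs_ge_zero power2_abs power_mono)
    then have "(p - q)\<^sup>2 / \<theta> \<le> \<eta>\<^sup>2 / \<theta>" using \<theta> by (intro divide_right_mono) auto
    moreover have "(1 - \<theta>) * q\<^sup>2 - (p - q)\<^sup>2 / \<theta> \<le> p\<^sup>2"
    proof -
      \<comment> \<open>Both terms on the right are nonnegative; dividing by \<theta> gives the
        weighted inequality.\<close>
      have "\<theta> * (p\<^sup>2 - (1 - \<theta>) * q\<^sup>2) + (p - q)\<^sup>2 = (p - (1 - \<theta>) * q)\<^sup>2 + \<theta> * (p - q)\<^sup>2"
        by (simp add: power2_eq_square algebra_simps)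
      then have "0 \<le> \<theta> * (p\<^sup>2 - (1 - \<theta>) * q\<^sup>2) + (p - q)\<^sup>2" using \<theta> by simp
      then have "0 \<le> (\<theta> * (p\<^sup>2 - (1 - \<theta>) * q\<^sup>2) + (p - q)\<^sup>2) / \<theta>" using \<theta> by simp
      then show ?thesis using \<theta> by (simp add: add_divide_distrib)
    qed
    ultimately show ?thesis unfolding p_def q_def by simp
  qed
  have c1: "continuous_on (cbox a b) (\<lambda>x. (1 - \<theta>) * (v \<bullet> (x - m) - (c - g0))\<^sup>2)"
    by (intro continuous_intros)
  have c2: "continuous_on (cbox a b) (\<lambda>x. (g x - c)\<^sup>2)" by (intro continuous_intros g)
  have "s ^ (DIM('a) + 2) / 12 * ((1 - \<theta>) * (norm v)\<^sup>2) - \<eta>\<^sup>2 / \<theta> * s ^ DIM('a)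
     \<le> (1 - \<theta>) * (s ^ (DIM('a) + 2) / 12 * (norm v)\<^sup>2 + (c - g0)\<^sup>2 * s ^ DIM('a)) - \<eta>\<^sup>2 / \<theta> * s ^ DIM('a)"
    using \<theta> s by (simp add: distrib_left)
  also have "\<dots> = integral (cbox a b) (\<lambda>x. (1 - \<theta>) * (v \<bullet> (x - m) - (c - g0))\<^sup>2 - \<eta>\<^sup>2 / \<theta> * 1)"
    by (subst integral_diff, rule int[OF c1], rule int, intro continuous_intros)
      (simp only: integral_mult_right integral_cube_affine_sq integral_cube_const)
  also have "\<dots> \<le> integral (cbox a b) (\<lambda>x. (g x - c)\<^sup>2)"
    by (intro integral_le int c2 continuous_on_diff c1 continuous_on_const ptw)
  also have "\<dots> = (LINT x:cbox a b|lborel. (g x - c)\<^sup>2)"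
    by (intro set_borel_integral_eq_integral(2)[symmetric] set_integrable_lborel_cbox c2)
  finally show ?thesis .
qed

end

section \<open>Stratified sampling\<close>

text \<open>Boundedness supplies all integrability, and independence makes the mixed moments of the
  centred variables vanish.\<close>

lemma (in prob_space) variance_sum_indep_bounded:
  fixes X :: "'i \<Rightarrow> 'a \<Rightarrow> real"
  assumes fin: "finite I" and ind: "indep_vars (\<lambda>_. borel) X I" and bd: "\<And>i x. i \<in> I \<Longrightarrow> \<bar>X i x\<bar> \<le> B"
  shows "variance (\<lambda>x. \<Sum>i\<in>I. X i x) = (\<Sum>i\<in>I. variance (X i))"
proof -
  have rv [measurable]: "i \<in> I \<Longrightarrow> random_variable borel (X i)" for i
    using ind unfolding indep_vars_def2 by blast
  have int: "i \<in> I \<Longrightarrow> integrable M (X i)" for i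
    using bd rv by (intro integrable_const_bound[where B=B]) auto
  define Y where "Y i x = X i x - expectation (X i)" for i x
  have intY: "i \<in> I \<Longrightarrow> integrable M (Y i)" for i
    unfolding Y_def using int by (intro Bochner_Integration.integrable_diff) auto
  have meanY: "expectation (Y i) = 0" if "i \<in> I" for i
    unfolding Y_def using int[OF that] by (simp add: prob_space)
  have intYY: "integrable M (\<lambda>x. Y i x * Y j x)" if ij: "i \<in> I" "j \<in> I" for i j
  proof (rule integrable_const_bound[where B="(B + \<bar>expectation (X i)\<bar>) * (B + \<bar>expectation (X j)\<bar>)"])
    have "\<bar>Y i x\<bar> \<le> B + \<bar>expectation (X i)\<bar>" if "i \<in> I" for i x
      using bd[OF that, of x] unfolding Y_def by linarith
    then have "\<bar>Y i x * Y j x\<bar> \<le> (B + \<bar>expectation (X i)\<bar>) * (B + \<bar>expectation (X j)\<bar>)" for x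
      unfolding abs_mult using ij by (intro mult_mono) (auto intro: order_trans[OF abs_ge_zero])
    then show "AE x in M. norm (Y i x * Y j x) \<le> (B + \<bar>expectation (X i)\<bar>) * (B + \<bar>expectation (X j)\<bar>)" by simp
    show "random_variable borel (\<lambda>x. Y i x * Y j x)" unfolding Y_def using ij by measurable
  qed
  have cross: "expectation (\<lambda>x. Y i x * Y j x) = 0" if ij: "i \<in> I" "j \<in> I" "i \<noteq> j" for i j
  proof -
    have "indep_vars (\<lambda>_. borel) Y I"
      unfolding Y_def using ind by (rule indep_vars_compose2) measurable
    then have "indep_vars (\<lambda>_. borel) Y {i, j}" by (rule indep_vars_subset) (use ij in auto)
    then have "expectation (\<lambda>x. \<Prod>k\<in>{i, j}. Y k x) = (\<Prod>k\<in>{i, j}. expectation (Y k))"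
      using ij intY by (intro indep_vars_lebesgue_integral) auto
    then show ?thesis using ij meanY by simp
  qed
  have "(\<Sum>i\<in>I. X i x) - expectation (\<lambda>x. \<Sum>i\<in>I. X i x) = (\<Sum>i\<in>I. Y i x)" for x
    unfolding Y_def using int by (simp add: Bochner_Integration.integral_sum sum_subtractf)
  then have "variance (\<lambda>x. \<Sum>i\<in>I. X i x) = expectation (\<lambda>x. \<Sum>i\<in>I. \<Sum>j\<in>I. Y i x * Y j x)"
    by (simp add: power2_eq_square sum_product)
  also have "\<dots> = (\<Sum>i\<in>I. \<Sum>j\<in>I. expectation (\<lambda>x. Y i x * Y j x))"
    using intYY by (simp add: Bochner_Integration.integral_sum Bochner_Integration.integrable_sum)
  also have "\<dots> = (\<Sum>i\<in>I. \<Sum>j\<in>I. if i = j then variance (X i) else 0)"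
    using cross by (intro sum.cong refl) (auto simp: Y_def power2_eq_square)
  also have "\<dots> = (\<Sum>i\<in>I. variance (X i))" using fin by simp
  finally show ?thesis .
qed

section \<open>Means and deviations on single strata\<close>

definition stratum :: "nat \<Rightarrow> nat \<Rightarrow> real set" where
  "stratum n k = {real k / real n..<(real k + 1) / real n}"

definition stratum_mean :: "(real \<Rightarrow> real) \<Rightarrow> nat \<Rightarrow> nat \<Rightarrow> real" where
  "stratum_mean \<phi> n k = real n * (LINT x:stratum n k|lborel. \<phi> x)"

text \<open>Not normalised: a uniform point of the stratum has density n there, so the variance of
  one summand is n times this quantity.\<close>

definition stratum_dev :: "(real \<Rightarrow> real) \<Rightarrow> nat \<Rightarrow> nat \<Rightarrow> real" where
  "stratum_dev \<phi> n k = (LINT x:stratum n k|lborel. (\<phi> x - stratum_mean \<phi> n k)\<^sup>2)"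

lemma stratum_sets [measurable]: "stratum n k \<in> sets borel"
  by (simp add: stratum_def)

lemma prob_space_strat: "prob_space (strat_space n)"
  by (intro prob_space_PiM prob_space_unif)

text \<open>The marginal law of coordinate k, followed by the substitution x = (k + y) / n. The
  endpoint y = 1 belongs to the support of \<open>unif\<close> but not to the half-open stratum, and
  it is null.\<close>

lemma integral_stratum:
  fixes \<psi> :: "real \<Rightarrow> real"
  assumes [measurable]: "\<psi> \<in> borel_measurable borel" and n: "0 < n" and k: "k < n"
  shows "(\<integral>u. \<psi> ((real k + u k) / real n) \<partial>strat_space n) = real n * (LINT x:stratum n k|lborel. \<psi> x)"
proof -
  let ?G = "\<lambda>x. indicator (stratum n k) x *\<^sub>R \<psi> x"
  have "(\<integral>u. \<psi> ((real k + u k) / real n) \<partial>strat_space n)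
      = (\<integral>y. \<psi> ((real k + y) / real n) \<partial>distr (strat_space n) unif (\<lambda>u. u k))"
    using k by (subst integral_distr) auto
  also have "distr (strat_space n) unif (\<lambda>u. u k) = unif"
    using k by (intro distr_PiM_component prob_space_unif) auto
  also have "(\<integral>y. \<psi> ((real k + y) / real n) \<partial>unif) = (LINT y:{0..1}|lborel. \<psi> ((real k + y) / real n))"
    by (intro integral_uniform_measure_unit) auto
  also have "\<dots> = (\<integral>y. ?G (real k / real n + 1 / real n * y) \<partial>lborel)"
    unfolding set_lebesgue_integral_def
  proof (rule integral_cong_AE)
    show "AE y in lborel. indicator {0..1} y *\<^sub>R \<psi> ((real k + y) / real n)
        = ?G (real k / real n + 1 / real n * y)"
      using AE_lborel_singleton[of 1]
    proof eventually_elim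
      case (elim y)
      have "real k / real n \<le> real k / real n + 1 / real n * y \<longleftrightarrow> 0 \<le> y"
        using n by (simp add: zero_le_divide_iff)
      moreover have "real k / real n + 1 / real n * y < (real k + 1) / real n \<longleftrightarrow> y < 1"
        using n by (simp add: add_divide_distrib divide_less_cancel)
      ultimately show ?case using elim
        by (auto simp: stratum_def indicator_def add_divide_distrib)
    qed
  qed measurable
  also have "\<dots> = real n * (\<bar>1 / real n\<bar> *\<^sub>R \<dots>)" using n by simp
  also have "\<bar>1 / real n\<bar> *\<^sub>R (\<integral>y. ?G (real k / real n + 1 / real n * y) \<partial>lborel)
      = (\<integral>x. indicator (stratum n k) x *\<^sub>R \<psi> x \<partial>lborel)"
    using n by (intro lborel_integral_real_affine[symmetric]) simp
  finally show ?thesis by (simp only: set_lebesgue_integral_def)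
qed

lemma indep_strat_components:
  assumes "0 < n"
  shows "prob_space.indep_vars (strat_space n) (\<lambda>_. unif) (\<lambda>k u. u k) {..<n}"
proof -
  interpret prob_space "strat_space n" by (rule prob_space_strat)
  have "distr (strat_space n) (strat_space n) (\<lambda>u. \<lambda>k\<in>{..<n}. u k) = distr (strat_space n) (strat_space n) (\<lambda>u. u)"
  proof (rule distr_cong[OF refl refl])
    fix u assume "u \<in> space (strat_space n)"
    then have "u \<in> (\<Pi>\<^sub>E k\<in>{..<n}. space unif)" by (simp only: space_PiM)
    then show "(\<lambda>k\<in>{..<n}. u k) = u" by (rule PiE_restrict)
  qed
  moreover have "PiM {..<n} (\<lambda>k. distr (strat_space n) unif (\<lambda>u. u k)) = strat_space n"
    by (intro PiM_cong refl distr_PiM_component prob_space_unif) auto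
  ultimately show ?thesis
    using assms by (subst indep_vars_iff_distr_eq_PiM') auto
qed

context
  fixes \<phi> :: "real \<Rightarrow> real" and B :: real and n :: nat
  assumes \<phi> [measurable]: "\<phi> \<in> borel_measurable borel" and B: "\<And>x. \<bar>\<phi> x\<bar> \<le> B" and n: "0 < n"
begin

interpretation prob_space "strat_space n" by (rule prob_space_strat)

abbreviation "strat_val k u \<equiv> \<phi> ((real k + u k) / real n)"

lemma indep_strat_val: "indep_vars (\<lambda>_. borel) (\<lambda>k u. strat_val k u) {..<n}"
  by (rule indep_vars_compose2[OF indep_strat_components[OF n], of "\<lambda>k y. \<phi> ((real k + y) / real n)"]) measurable

lemma strat_val_rv: "k < n \<Longrightarrow> random_variable borel (strat_val k)"
  using indep_strat_val unfolding indep_vars_def2 by simp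

lemma strat_val_integrable: "k < n \<Longrightarrow> integrable (strat_space n) (strat_val k)"
  using B strat_val_rv by (intro integrable_const_bound[where B=B]) auto

lemma expectation_strat_val: "k < n \<Longrightarrow> expectation (strat_val k) = stratum_mean \<phi> n k"
  unfolding stratum_mean_def by (rule integral_stratum[OF \<phi> n])

lemma variance_strat_val:
  assumes k: "k < n"
  shows "variance (strat_val k) = real n * stratum_dev \<phi> n k"
  unfolding expectation_strat_val[OF k] stratum_dev_def
  by (rule integral_stratum[OF _ n k, of "\<lambda>x. (\<phi> x - stratum_mean \<phi> n k)\<^sup>2"]) measurable

lemma stratum_mean_abs_le: "k < n \<Longrightarrow> \<bar>stratum_mean \<phi> n k\<bar> \<le> B"
proof -
  assume k: "k < n"
  have "\<bar>expectation (strat_val k)\<bar> \<le> expectation (\<lambda>u. \<bar>strat_val k u\<bar>)" by (rule integral_abs_bound)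
  also have "\<dots> \<le> B"
    using B strat_val_integrable[OF k] by (intro integral_le_const) auto
  finally show ?thesis using expectation_strat_val[OF k] by simp
qed

lemma expectation_strat_sum:
  "expectation (\<lambda>u. \<Sum>k<n. strat_val k u) = real n * (LINT x:{0..1}|lborel. \<phi> x)"
proof -
  have int: "set_integrable lborel A \<phi>" if "A \<in> sets borel" "A \<subseteq> {0..1}" for A
    unfolding set_integrable_def
  proof (rule Bochner_Integration.integrable_bound)
    have "set_integrable lborel {0..1::real} (\<lambda>x. B)"
      unfolding set_integrable_def by (intro borel_integrable_compact) auto
    then show "integrable lborel (\<lambda>x. indicator {0..1::real} x *\<^sub>R B)" by (simp add: set_integrable_def)
    show "AE x in lborel. norm (indicator A x *\<^sub>R \<phi> x) \<le> norm (indicator {0..1::real} x *\<^sub>R B)"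
      using that B order_trans[OF abs_ge_zero B] by (intro AE_I2) (auto simp: indicator_def)
  qed (use that in measurable)
  have sub: "stratum n k \<subseteq> {0..1}" if "k < n" for k
  proof
    fix x assume "x \<in> stratum n k"
    then have x: "real k / real n \<le> x" "x < (real k + 1) / real n" by (simp_all add: stratum_def)
    have k: "0 \<le> real k / real n" "(real k + 1) / real n \<le> 1" using that by (simp_all add: field_simps)
    show "x \<in> {0..1}"
      using order_trans[OF k(1) x(1)] less_le_trans[OF x(2) k(2)] by simp
  qed
  have disj: "disjoint_family_on (stratum n) {..<n}"
    unfolding disjoint_family_on_def
  proof (intro ballI impI)
    fix k k' :: nat assume "k \<noteq> k'"
    show "stratum n k \<inter> stratum n k' = {}"
    proof (rule ccontr)
      assume "stratum n k \<inter> stratum n k' \<noteq> {}"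
      then obtain x where x: "x \<in> stratum n k" "x \<in> stratum n k'" by blast
      have "real k \<le> x * real n \<and> x * real n < real k + 1" "real k' \<le> x * real n \<and> x * real n < real k' + 1"
        using x n by (simp_all add: stratum_def field_simps)
      then have "real k < real (Suc k')" "real k' < real (Suc k)" by auto
      with \<open>k \<noteq> k'\<close> show False by (simp only: of_nat_less_iff)
    qed
  qed
  have Un: "(\<Union>k\<in>{..<n}. stratum n k) = {0..<1}"
  proof (rule equalityI[OF _ subsetI])
    show "(\<Union>k\<in>{..<n}. stratum n k) \<subseteq> {0..<1}"
    proof
      fix x assume "x \<in> (\<Union>k\<in>{..<n}. stratum n k)"
      then obtain k where k: "k < n" "x \<in> stratum n k" by auto
      have "(real k + 1) / real n \<le> 1" using k(1) by (simp add: field_simps)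
      moreover have "x < (real k + 1) / real n" using k(2) by (simp add: stratum_def)
      ultimately show "x \<in> {0..<1}" using sub[OF k(1)] k(2) by auto
    qed
    fix x :: real assume x: "x \<in> {0..<1}"
    define k where "k = nat \<lfloor>x * real n\<rfloor>"
    have k: "real k \<le> x * real n" "x * real n < real k + 1" unfolding k_def using x by (auto simp: le_nat_floor)
    have "x * real n < 1 * real n" using x n by (intro mult_strict_right_mono) auto
    then have "real k < real n" using k by linarith
    moreover have "x \<in> stratum n k" using k n by (simp add: stratum_def field_simps)
    ultimately show "x \<in> (\<Union>k\<in>{..<n}. stratum n k)" by auto
  qed
  have "expectation (\<lambda>u. \<Sum>k<n. strat_val k u) = (\<Sum>k<n. expectation (strat_val k))"
    using strat_val_integrable by (intro Bochner_Integration.integral_sum) auto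
  also have "\<dots> = (\<Sum>k<n. real n * (LINT x:stratum n k|lborel. \<phi> x))"
    by (intro sum.cong refl) (simp add: expectation_strat_val stratum_mean_def)
  also have "\<dots> = real n * (\<Sum>k<n. (LINT x:stratum n k|lborel. \<phi> x))" by (simp add: sum_distrib_left)
  also have "(\<Sum>k<n. (LINT x:stratum n k|lborel. \<phi> x)) = (LINT x:(\<Union>k\<in>{..<n}. stratum n k)|lborel. \<phi> x)"
    using int sub disj by (intro set_integral_finite_Union[symmetric]) auto
  also have "\<dots> = (LINT x:{0..1}|lborel. \<phi> x)"
    unfolding Un set_lebesgue_integral_def
    by (rule integral_cong_AE) (use AE_lborel_singleton[of "1::real"] in \<open>auto elim!: eventually_mono simp: indicator_def\<close>)
  finally show ?thesis .
qed

lemma variance_strat_sum: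
  "variance (\<lambda>u. \<Sum>k<n. strat_val k u) = real n * (\<Sum>k<n. stratum_dev \<phi> n k)"
proof -
  have "variance (\<lambda>u. \<Sum>k<n. strat_val k u) = (\<Sum>k<n. variance (strat_val k))"
    by (rule variance_sum_indep_bounded[OF _ indep_strat_val, of B]) (use B in auto)
  also have "\<dots> = (\<Sum>k<n. real n * stratum_dev \<phi> n k)"
    by (intro sum.cong refl) (simp add: variance_strat_val)
  finally show ?thesis by (simp add: sum_distrib_left)
qed

end

section \<open>Lower bound for the stratified variance\<close>

text \<open>Take the least K whose cells have length at most 1 / (2n); the previous level is too
  coarse, and one factor 2^d more bounds 2^(dK) from above. Half the stratum length guarantees a
  full aligned cell in every stratum.\<close>

lemma ex_dyadic_scale:
  assumes d: "0 < d" and n: "0 < n"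
  shows "\<exists>K. 2 * real n \<le> 2 ^ (d * K) \<and> 2 ^ (d * K) < 2 ^ (d + 1) * real n"
proof -
  define P where "P K \<longleftrightarrow> 2 * real n \<le> 2 ^ (d * K)" for K
  have "\<exists>K. P K"
  proof
    have "2 * n \<le> 2 ^ (2 * n)" using less_exp[of "2 * n"] by simp
    also have "\<dots> \<le> (2::nat) ^ (d * (2 * n))" using d by (intro power_increasing) auto
    finally have "real (2 * n) \<le> real (2 ^ (d * (2 * n)))" by (simp only: of_nat_le_iff)
    then show "P (2 * n)" by (simp add: P_def)
  qed
  then have P: "P (Least P)" by (metis LeastI)
  have "Least P \<noteq> 0"
  proof
    assume "Least P = 0"
    then have "2 * real n \<le> 1" using P by (simp add: P_def)
    then show False using n by linarith
  qed
  then obtain K where K: "Least P = Suc K" by (metis not0_implies_Suc)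
  have "\<not> P K" using K by (intro not_less_Least) simp
  then have "2 ^ (d * K) < 2 * real n" by (simp add: P_def)
  then have "2 ^ (d * Suc K) < 2 ^ (d + 1) * real n" by (simp add: power_add)
  then show ?thesis using P K P_def by metis
qed

text \<open>A stratum of length \<open>1/n\<close> has \<open>L = 2^(dK)/n\<close> cells' length, where \<open>2 \<le> L < 2^(d+1)\<close>. One whole
  cell is always inside, and a second one if \<open>L\<close> exceeds three quarters of its upper bound; the
  resulting factor 4/3 is the slack that absorbs all limiting errors.\<close>
lemma dyadic_scale_constant:
  assumes d: "0 < d" and n: "0 < n" and K: "2 * real n \<le> 2 ^ (d * K)" "2 ^ (d * K) < 2 ^ (d + 1) * real n"
  shows "\<exists>j::nat. real j + 1 \<le> 2 ^ (d * K) / real n \<and>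
     4 / 3 * (2 powr (- 2 / real d - real d) / 96 * real n powr (- 2 / real d))
       \<le> real j * real n * ((1 / 2 ^ K) ^ (d + 2) / 12)"
proof -
  define L where "L = 2 ^ (d * K) / real n"
  \<comment> \<open>\<open>p\<close> is the exponent in s^(d+2) = (n L)^(-p) for the cube side s; E
    is the strict upper bound for L that takes its place in the final constant.\<close>
  define p where "p = 1 + 2 / real d"
  define E :: real where "E = 2 ^ (d + 1)"
  have L: "2 \<le> L" "L < E" using K n by (simp_all add: L_def E_def field_simps)
  have p: "1 \<le> p" by (simp add: p_def)
  have E4: "4 \<le> E"
  proof -
    have "(2::real) ^ 2 \<le> 2 ^ (d + 1)" using d by (intro power_increasing) auto
    then show ?thesis by (simp add: E_def)
  qed
  obtain j :: nat where j: "real j + 1 \<le> L" "4 / 3 \<le> real j * (E / L) powr p"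
  proof (cases "L \<le> 3 / 4 * E")
    case True
    then have "4 / 3 \<le> E / L" using L by (simp add: field_simps)
    also have "E / L \<le> (E / L) powr p"
      using powr_mono[OF p, of "E / L"] L by simp
    finally show ?thesis using L by (intro that[of 1]) auto
  next
    \<comment> \<open>Here L > 3/4 * E \<ge> 3, so j = 2 satisfies j + 1 \<le> L.\<close>
    case False
    have "1 \<le> (E / L) powr p" using L p by (intro ge_one_powr_ge_zero) auto
    then show ?thesis using False E4 by (intro that[of 2]) auto
  qed
  have nL: "real n * L = 2 ^ (d * K)" using n by (simp add: L_def)
  have e1: "(1 / 2 ^ K) ^ d = 1 / (real n * L)"
    unfolding nL by (simp add: power_divide power_mult mult.commute)
  have "(1 / 2 ^ K :: real) = (1 / 2 ^ (d * K)) powr (1 / real d)"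
    using d by (simp add: powr_divide powr_realpow[symmetric] powr_powr)
  then have "(1 / 2 ^ K :: real) ^ 2 = (1 / (real n * L)) powr (2 / real d)"
    unfolding nL by (simp add: powr_power)
  then have "(1 / 2 ^ K) ^ (d + 2) = 1 / (real n * L) * (real n * L) powr (- 2 / real d)"
    unfolding power_add e1 using n L by (simp add: powr_divide powr_minus_divide)
  also have "\<dots> = L powr (- p) * (real n powr (- 2 / real d) / real n)"
    using n L by (simp add: p_def powr_mult powr_add powr_diff powr_minus_divide minus_add_distrib
        del: minus_add)
  finally have e2: "real j * real n * ((1 / 2 ^ K) ^ (d + 2) / 12) = real j * L powr (- p) * real n powr (- 2 / real d) / 12"
    using n by simp
  have "E = 2 powr (real d + 1)" by (simp add: E_def powr_realpow[symmetric] powr_add)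
  then have "E powr (- p) = 2 powr ((real d + 1) * (- p))" by (simp add: powr_powr)
  also have "(real d + 1) * (- p) = - 2 / real d - real d - 3"
    using d by (simp add: p_def field_simps)
  also have "2 powr (- 2 / real d - real d - 3) = 2 powr (- 2 / real d - real d) / (8::real)"
    by (simp add: powr_diff)
  finally have e3: "2 powr (- 2 / real d - real d) / 96 = E powr (- p) / 12" by simp
  have "4 / 3 * E powr (- p) \<le> real j * (E / L) powr p * E powr (- p)"
    using j by (intro mult_right_mono) auto
  also have "\<dots> = real j * L powr (- p)"
    using L by (simp add: powr_divide powr_minus field_simps)
  finally have "4 / 3 * E powr (- p) * (real n powr (- 2 / real d) / 12) \<le> real j * L powr (- p) * (real n powr (- 2 / real d) / 12)"
    by (intro mult_right_mono) auto
  then have T: "4 / 3 * (E powr (- p) / 12 * real n powr (- 2 / real d)) \<le> real j * L powr (- p) * real n powr (- 2 / real d) / 12"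
    by (simp only: times_divide_eq_right times_divide_eq_left mult.assoc)
  show ?thesis
  proof (intro exI conjI)
    show "real j + 1 \<le> 2 ^ (d * K) / real n" using j(1) by (simp only: L_def)
    show "4 / 3 * (2 powr (- 2 / real d - real d) / 96 * real n powr (- 2 / real d))
       \<le> real j * real n * ((1 / 2 ^ K) ^ (d + 2) / 12)"
      unfolding e2 e3 by (rule T)
  qed
qed

section \<open>Counting cells in strata and strata in coarse cells\<close>

lemma nat_ceiling_bounds:
  fixes x :: real
  assumes "0 \<le> x"
  shows "x \<le> real (nat \<lceil>x\<rceil>)" "real (nat \<lceil>x\<rceil>) < x + 1"
  using assms by linarith+

text \<open>Rounding the left end of the stratum up to the grid loses less than one cell, so j whole
  cells fit into a length of j + 1 cells.\<close>

lemma dyadic_subset_stratum: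
  assumes n: "0 < n" and j: "real j + 1 \<le> 2 ^ N / real n" and i: "i < j"
  shows "dyadic N (nat \<lceil>real k * (2 ^ N / real n)\<rceil> + i) \<subseteq> stratum n k"
proof -
  define L where "L = 2 ^ N / real n"
  define c where "c = nat \<lceil>real k * L\<rceil>"
  have c: "real k * L \<le> real c" "real c < real k * L + 1"
    unfolding c_def by (rule nat_ceiling_bounds; simp add: L_def)+
  have "real i + 1 \<le> real j" using i by linarith
  then have "real k * L \<le> real (c + i)" "real (Suc (c + i)) \<le> (real k + 1) * L"
    using c j unfolding L_def[symmetric] by (simp_all add: distrib_right)
  then have "real k * L / 2 ^ N \<le> real (c + i) / 2 ^ N" "real (Suc (c + i)) / 2 ^ N \<le> (real k + 1) * L / 2 ^ N"
    by (simp_all only: divide_right_mono zero_le_power zero_le_numeral)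
  then have "real k / real n \<le> real (c + i) / 2 ^ N" "real (Suc (c + i)) / 2 ^ N \<le> (real k + 1) / real n"
    by (simp_all add: L_def)
  then show ?thesis unfolding c_def[unfolded L_def, symmetric] dyadic_def stratum_def by (rule ivl_subset[THEN iffD2, OF disjI2[OF conjI]])
qed

text \<open>The interval is as long as n / 2^N strata, and rounding at each of its two ends loses
  less than one.\<close>

lemma card_strata_in_dyadic:
  assumes n: "0 < n" and q: "q < 2 ^ N"
  shows "real n / 2 ^ N - 2 \<le> real (card {k. k < n \<and> stratum n k \<subseteq> dyadic N q})"
proof -
  define x where "x = real q * (real n / 2 ^ N)"
  define y where "y = real (Suc q) * (real n / 2 ^ N)"
  have x: "0 \<le> x" and y: "0 \<le> y" by (simp_all add: x_def y_def)
  have xy: "y = x + real n / 2 ^ N" by (simp add: x_def y_def distrib_right add_divide_distrib)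
  have "real (Suc q) \<le> 2 ^ N" using q by (metis Suc_leI of_nat_le_iff of_nat_numeral of_nat_power)
  then have "y \<le> 2 ^ N * (real n / 2 ^ N)" unfolding y_def by (intro mult_right_mono) auto
  then have yn: "y \<le> real n" by simp
  let ?c = "nat \<lceil>x\<rceil>" and ?e = "nat \<lfloor>y\<rfloor>"
  have c: "x \<le> real ?c" "real ?c < x + 1" using nat_ceiling_bounds[OF x] by auto
  have e: "real ?e \<le> y" "y < real ?e + 1" using y by linarith+
  have "{?c..<?e} \<subseteq> {k. k < n \<and> stratum n k \<subseteq> dyadic N q}"
  proof
    fix k assume k: "k \<in> {?c..<?e}"
    then have "real ?c \<le> real k" "real (Suc k) \<le> real ?e" by (simp_all only: of_nat_le_iff atLeastLessThan_iff Suc_le_eq)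
    then have b: "x \<le> real k" "real k + 1 \<le> y" using c(1) e(1) by linarith+
    then have "x / real n \<le> real k / real n" "(real k + 1) / real n \<le> y / real n"
      by (simp_all only: divide_right_mono of_nat_0_le_iff)
    then have "real q / 2 ^ N \<le> real k / real n" "(real k + 1) / real n \<le> real (Suc q) / 2 ^ N"
      using n by (simp_all add: x_def y_def)
    then have "stratum n k \<subseteq> dyadic N q"
      unfolding dyadic_def stratum_def by (rule ivl_subset[THEN iffD2, OF disjI2[OF conjI]])
    moreover have "real k < real n" using b yn by linarith
    ultimately show "k \<in> {k. k < n \<and> stratum n k \<subseteq> dyadic N q}" by simp
  qed
  then have "card {?c..<?e} \<le> card {k. k < n \<and> stratum n k \<subseteq> dyadic N q}"
    by (intro card_mono) auto
  then have "real (?e - ?c) \<le> real (card {k. k < n \<and> stratum n k \<subseteq> dyadic N q})" by simp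
  moreover have "real ?e - real ?c \<le> real (?e - ?c)" by simp
  ultimately show ?thesis using c e xy by linarith
qed

text \<open>The left endpoint of the small interval lies in both intervals and so determines both
  indices; dropping digits of the fine one gives the coarse one. Nesting of intervals thus becomes
  nesting of cubes.\<close>

lemma hilbert_cube_subset_of_dyadic:
  assumes K: "K0 \<le> K" and q: "q < 2 ^ (CARD('n) * K0)"
    and sub: "dyadic (CARD('n) * K) h \<subseteq> dyadic (CARD('n) * K0) q"
  shows "h < 2 ^ (CARD('n) * K)" "(hilbert_cube K h :: (real ^ 'n::finite) set) \<subseteq> hilbert_cube K0 q"
proof -
  let ?d = "CARD('n)"
  define x where "x = real h / 2 ^ (?d * K)"
  have xh: "x \<in> dyadic (?d * K) h" by (simp add: x_def dyadic_def divide_strict_right_mono)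
  then have xq: "x \<in> dyadic (?d * K0) q" using sub by blast
  have "real (Suc q) \<le> 2 ^ (?d * K0)" using q by (metis Suc_leI of_nat_le_iff of_nat_numeral of_nat_power)
  then have q1: "real (Suc q) / 2 ^ (?d * K0) \<le> 1" by simp
  have "x < real (Suc q) / 2 ^ (?d * K0)" using xq by (simp only: dyadic_def atLeastLessThan_iff)
  then have "x < 1" using q1 by (rule less_le_trans)
  then have "real h < real (2 ^ (?d * K))" by (simp add: x_def)
  then show h: "h < 2 ^ (?d * K)" by (simp only: of_nat_less_iff)
  have "hilbert_idx ?d (K0 + (K - K0)) x div 2 ^ (?d * (K - K0)) = hilbert_idx ?d K0 x"
    by (rule hilbert_idx_div[OF dyadic_nonneg[OF xq]])
  then have "h div 2 ^ (?d * (K - K0)) = q"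
    using hilbert_idx_dyadic[OF xh h] hilbert_idx_dyadic[OF xq q] K by simp
  then show "(hilbert_cube K h :: (real ^ 'n) set) \<subseteq> hilbert_cube K0 q"
    using hilbert_cube_mono[where 'n='n, of K0 "K - K0" h] K by simp
qed

lemma convex_hilbert_cube: "convex (hilbert_cube k h)"
  by (simp add: hilbert_cube_def convex_box)

text \<open>The centring in \<open>stratum_dev\<close> is the mean over the whole stratum, so
  \<beta> is required for every c. The j disjoint cells contribute \<beta> each, and the rest of the
  stratum is nonnegative.\<close>

lemma stratum_dev_ge:
  fixes \<phi> :: "real \<Rightarrow> real"
  assumes \<phi> [measurable]: "\<phi> \<in> borel_measurable borel" and B: "\<And>x. \<bar>\<phi> x\<bar> \<le> B"
    and n: "0 < n" and j: "real j + 1 \<le> 2 ^ N / real n"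
    and cell: "\<And>h c. dyadic N h \<subseteq> stratum n k \<Longrightarrow> \<beta> \<le> (LINT x:dyadic N h|lborel. (\<phi> x - c)\<^sup>2)"
  shows "real j * \<beta> \<le> stratum_dev \<phi> n k"
proof -
  define c where "c = nat \<lceil>real k * (2 ^ N / real n)\<rceil>"
  define F where "F x = (\<phi> x - stratum_mean \<phi> n k)\<^sup>2" for x
  have sub: "dyadic N (c + i) \<subseteq> stratum n k" if "i < j" for i
    unfolding c_def using dyadic_subset_stratum[OF n j that] .
  have F0: "0 \<le> F x" for x by (simp add: F_def)
  have Fb: "\<bar>F x\<bar> \<le> (B + \<bar>stratum_mean \<phi> n k\<bar>)\<^sup>2" for x
  proof -
    have "\<bar>\<phi> x - stratum_mean \<phi> n k\<bar> \<le> B + \<bar>stratum_mean \<phi> n k\<bar>" using B[of x] by linarith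
    then have "\<bar>\<phi> x - stratum_mean \<phi> n k\<bar>\<^sup>2 \<le> (B + \<bar>stratum_mean \<phi> n k\<bar>)\<^sup>2" by (intro power_mono) auto
    then show ?thesis by (simp add: F_def)
  qed
  have [measurable]: "F \<in> borel_measurable borel" unfolding F_def by measurable
  have "set_integrable lborel {real k / real n..(real k + 1) / real n} (\<lambda>x. (B + \<bar>stratum_mean \<phi> n k\<bar>)\<^sup>2)"
    unfolding set_integrable_def by (intro borel_integrable_compact) auto
  then have int: "set_integrable lborel (stratum n k) F"
    unfolding set_integrable_def
    by (rule Bochner_Integration.integrable_bound) (use Fb in \<open>auto simp: stratum_def indicator_def\<close>)
  then have int': "set_integrable lborel (dyadic N (c + i)) F" if "i < j" for i
    by (rule set_integrable_subset) (use sub[OF that] in auto)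
  have "real j * \<beta> = (\<Sum>i<j. \<beta>)" by simp
  also have "\<dots> \<le> (\<Sum>i<j. (LINT x:dyadic N (c + i)|lborel. F x))"
    unfolding F_def by (intro sum_mono cell sub) simp
  also have "\<dots> = (LINT x:(\<Union>i\<in>{..<j}. dyadic N (c + i))|lborel. F x)"
    using int' dyadic_disjoint by (intro set_integral_finite_Union[symmetric]) (auto simp: disjoint_family_on_def)
  also have "\<dots> \<le> (LINT x:stratum n k|lborel. F x)"
    unfolding set_lebesgue_integral_def
  proof (rule integral_mono)
    have "set_integrable lborel (\<Union>i\<in>{..<j}. dyadic N (c + i)) F"
      using int by (rule set_integrable_subset) (use sub in auto)
    then show "integrable lborel (\<lambda>x. indicator (\<Union>i\<in>{..<j}. dyadic N (c + i)) x *\<^sub>R F x)"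
      by (simp add: set_integrable_def)
    show "integrable lborel (\<lambda>x. indicator (stratum n k) x *\<^sub>R F x)"
      using int by (simp add: set_integrable_def)
    show "indicator (\<Union>i\<in>{..<j}. dyadic N (c + i)) x *\<^sub>R F x \<le> indicator (stratum n k) x *\<^sub>R F x" for x
      using sub F0[of x] by (auto simp: indicator_def)
  qed
  finally show ?thesis by (simp add: stratum_dev_def F_def)
qed

lemma hilbert_cube_Basis:
  fixes k h
  defines "A \<equiv> hilbert_corner k h :: real ^ 'n::finite"
  obtains b m :: "real ^ 'n" where "hilbert_cube k h = cbox A b"
    "\<And>i. i \<in> Basis \<Longrightarrow> b \<bullet> i = A \<bullet> i + 1 / 2 ^ k"
    "\<And>i. i \<in> Basis \<Longrightarrow> m \<bullet> i = A \<bullet> i + 1 / 2 ^ k / 2" "m \<in> hilbert_cube k h"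
proof
  show "hilbert_cube k h = cbox A (A + (\<chi> i. 1 / 2 ^ k))" by (simp add: hilbert_cube_def A_def)
  show "(A + (\<chi> i. 1 / 2 ^ k)) \<bullet> i = A \<bullet> i + 1 / 2 ^ k" if "i \<in> Basis" for i
    using that by (auto simp: Basis_vec_def inner_axis inner_add_left)
  show "(A + (\<chi> i. 1 / 2 ^ k / 2)) \<bullet> i = A \<bullet> i + 1 / 2 ^ k / 2" if "i \<in> Basis" for i
    using that by (auto simp: Basis_vec_def inner_axis inner_add_left)
  show "A + (\<chi> i. 1 / 2 ^ k / 2) \<in> hilbert_cube k h"
    unfolding hilbert_cube_def A_def[symmetric] by (simp add: mem_box_cart field_simps)
qed

text \<open>The bound aimed at for the sum of all \<open>stratum_dev\<close>, per unit of
  \<open>\<sigma>2\<close>; the variance of the estimate is that sum divided by n.\<close>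

definition var_rate :: "nat \<Rightarrow> nat \<Rightarrow> real" where
  "var_rate d n = 2 powr (- 2 / real d - real d) / 96 * real n powr (- 2 / real d)"

text \<open>W will be the interior of \<Omega>. \<open>W_exhaust\<close> is the form in which the
  boundary condition enters: the cells inside W fill it up to measure tending to 0.\<close>

locale c1_on_open =
  fixes g :: "real ^ 'n::finite \<Rightarrow> real" and Dg :: "real ^ 'n \<Rightarrow> real ^ 'n" and W :: "(real ^ 'n) set"
  assumes g_deriv: "\<And>x. x \<in> cbox 0 1 \<Longrightarrow> (g has_derivative (\<lambda>h. Dg x \<bullet> h)) (at x within cbox 0 1)"
    and Dg_cont: "continuous_on (cbox 0 1) Dg"
    and W_open: "open W" and W_sub: "W \<subseteq> cbox 0 1"
    and W_exhaust: "(\<lambda>k. measure lborel (W - (\<Union>h\<in>{h. h < 2 ^ (CARD('n) * k) \<and> hilbert_cube k h \<subseteq> W}. hilbert_cube k h))) \<longlonglongrightarrow> 0"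
    and nonconst: "0 < (LINT x:W|lborel. (norm (Dg x))\<^sup>2)"
begin

definition "\<sigma>2 = (LINT x:W|lborel. (norm (Dg x))\<^sup>2)"
definition "inner_cells k = {h. h < 2 ^ (CARD('n) * k) \<and> (hilbert_cube k h :: (real ^ 'n) set) \<subseteq> W}"
text \<open>The constants come from \<open>cube_variance_lower\<close> with \<open>\<theta> = 1/8\<close> and \<open>\<eta> = d 2^(-K) \<delta>\<close>.\<close>
definition "cell_gain \<delta> v = 7 / 8 * (norm v)\<^sup>2 - 96 * (real CARD('n) * \<delta>)\<^sup>2" for v :: "real ^ 'n"

text \<open>With \<open>W\<close> the interior of \<open>\<Omega>\<close>, this is a Borel version of \<open>f\<close>, which itself is only Lebesgue measurable.\<close>
definition "f0 x = indicator W x * g x"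
definition "\<phi> x = f0 (hilbert_curve x)"

section \<open>Deviation bounds for the integrand on cells and strata\<close>

lemma g_cont: "continuous_on (cbox 0 1) g"
  by (rule has_derivative_continuous_on[OF g_deriv])

lemma inner_cells_finite: "finite (inner_cells k)"
  by (rule finite_subset[of _ "{..<2 ^ (CARD('n) * k)}"]) (auto simp: inner_cells_def)

lemma inner_cells_density: "real (card (inner_cells k)) / 2 ^ (CARD('n) * k) \<le> 1"
proof -
  have "card (inner_cells k) \<le> card {..<2 ^ (CARD('n) * k) :: nat}"
    by (intro card_mono) (auto simp: inner_cells_def)
  then have "real (card (inner_cells k)) \<le> real (2 ^ (CARD('n) * k))" by (simp only: of_nat_le_iff card_lessThan)
  then show ?thesis by simp
qed

lemma borel_f0 [measurable]: "f0 \<in> borel_measurable borel"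
proof -
  have "(\<lambda>x. indicator W x *\<^sub>R g x) \<in> borel_measurable borel"
    using W_open continuous_on_subset[OF g_cont W_sub] by (intro borel_measurable_continuous_on_indicator) auto
  then show ?thesis unfolding f0_def[abs_def] by simp
qed

lemma borel_\<phi> [measurable]: "\<phi> \<in> borel_measurable borel"
  unfolding \<phi>_def[abs_def] by measurable

lemma f0_bounded: obtains B where "\<And>x. \<bar>f0 x\<bar> \<le> B"
proof -
  have "compact (g ` cbox 0 1)" by (intro compact_continuous_image g_cont compact_cbox)
  then have "bounded (g ` cbox 0 1)" by (rule compact_imp_bounded)
  then obtain B where "\<forall>y\<in>g ` cbox 0 1. norm y \<le> B" unfolding bounded_iff ..
  then have B: "\<And>x. x \<in> cbox 0 1 \<Longrightarrow> \<bar>g x\<bar> \<le> B" by simp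
  have "\<bar>f0 x\<bar> \<le> max B 0" for x
    using B[of x] W_sub by (auto simp: f0_def indicator_def)
  then show ?thesis by (rule that)
qed

lemma Dg_bounded: obtains M where "0 \<le> M" "\<And>x. x \<in> cbox 0 1 \<Longrightarrow> norm (Dg x) \<le> M"
proof -
  have "compact (Dg ` cbox 0 1)" by (intro compact_continuous_image Dg_cont compact_cbox)
  then have "bounded (Dg ` cbox 0 1)" by (rule compact_imp_bounded)
  then obtain M where "\<forall>y\<in>Dg ` cbox 0 1. norm y \<le> M" unfolding bounded_iff ..
  then have M: "\<And>x. x \<in> cbox 0 1 \<Longrightarrow> norm (Dg x) \<le> M" by simp
  have "(0 :: real ^ 'n) \<in> cbox 0 1" by (simp add: mem_box_cart)
  from M[OF this] have "0 \<le> M" using norm_ge_zero order_trans by blast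
  then show ?thesis using M by (rule that)
qed

text \<open>The coarse cube controls the oscillation of the gradient, the fine cube inside it is the
  domain of integration. By the mean value inequality g differs there from an affine function with
  the fixed gradient v by at most the diameter bound times \<delta>.\<close>

lemma cube_dev_lower:
  assumes sub: "(hilbert_cube K h :: (real ^ 'n) set) \<subseteq> hilbert_cube K0 q" and q: "hilbert_cube K0 q \<subseteq> W"
    and \<delta>: "\<And>x. x \<in> hilbert_cube K0 q \<Longrightarrow> norm (Dg x - v) \<le> \<delta>" and v: "v = Dg (hilbert_corner K0 q)"
  shows "(1 / 2 ^ K) ^ (CARD('n) + 2) / 12 * cell_gain \<delta> v
     \<le> (LINT z:hilbert_cube K h|lborel. (f0 z - c)\<^sup>2)"
proof -
  let ?S = "hilbert_cube K0 q :: (real ^ 'n) set"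
  obtain b m :: "real ^ 'n" where bm: "hilbert_cube K h = cbox (hilbert_corner K h) b"
    "\<And>i. i \<in> Basis \<Longrightarrow> b \<bullet> i = hilbert_corner K h \<bullet> i + 1 / 2 ^ K"
    "\<And>i. i \<in> Basis \<Longrightarrow> m \<bullet> i = hilbert_corner K h \<bullet> i + 1 / 2 ^ K / 2" "m \<in> hilbert_cube K h"
    by (rule hilbert_cube_Basis[where k=K and h=h]) blast
  have Sunit: "?S \<subseteq> cbox 0 1" by (rule hilbert_cube_subset_unit)
  have \<delta>0: "0 \<le> \<delta>" using \<delta>[OF hilbert_corner_in_cube] norm_ge_zero order_trans by blast
  have lin: "\<bar>g x - g m - v \<bullet> (x - m)\<bar> \<le> real CARD('n) / 2 ^ K * \<delta>" if x: "x \<in> hilbert_cube K h" for x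
  proof -
    have "norm (g x - g m - v \<bullet> (x - m)) \<le> norm (x - m) * \<delta>"
      unfolding v
    proof (rule differentiable_bound_linearization[where S="?S" and f'="\<lambda>x h. Dg x \<bullet> h"])
      show "m + t *\<^sub>R (x - m) \<in> ?S" if "t \<in> {0..1}" for t
      proof -
        have "(1 - t) *\<^sub>R m + t *\<^sub>R x \<in> ?S"
          using that x bm(4) sub by (intro convexD[OF convex_hilbert_cube]) auto
        then show ?thesis by (simp add: algebra_simps)
      qed
      show "(g has_derivative (\<lambda>h. Dg y \<bullet> h)) (at y within ?S)" if "y \<in> ?S" for y
        using that Sunit by (intro has_derivative_subset[OF g_deriv Sunit]) auto
      show "onorm ((\<lambda>h. Dg y \<bullet> h) - (\<lambda>h. Dg (hilbert_corner K0 q) \<bullet> h)) \<le> \<delta>" if y: "y \<in> ?S" for y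
      proof (rule onorm_le)
        fix h :: "real ^ 'n"
        have "norm (((\<lambda>h. Dg y \<bullet> h) - (\<lambda>h. Dg (hilbert_corner K0 q) \<bullet> h)) h) = norm ((Dg y - v) \<bullet> h)"
          by (simp add: v inner_diff_left)
        also have "\<dots> \<le> norm (Dg y - v) * norm h" using Cauchy_Schwarz_ineq2 by simp
        also have "\<dots> \<le> \<delta> * norm h" using \<delta>[OF y] by (intro mult_right_mono) auto
        finally show "norm (((\<lambda>h. Dg y \<bullet> h) - (\<lambda>h. Dg (hilbert_corner K0 q) \<bullet> h)) h) \<le> \<delta> * norm h" .
      qed
    qed (rule hilbert_corner_in_cube)
    also have "\<dots> \<le> real CARD('n) / 2 ^ K * \<delta>"
      using dist_hilbert_cube[OF x bm(4)] \<delta>0 by (intro mult_right_mono) (auto simp: dist_norm)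
    finally show ?thesis by simp
  qed
  have cont: "continuous_on (cbox (hilbert_corner K h) b) g"
    using bm(1) sub Sunit by (intro continuous_on_subset[OF g_cont]) auto
  \<comment> \<open>With s = 2^(-K) and \<theta> = 1/8 the loss is 8 (d s \<delta>)^2 s^d = 96 (d
    \<delta>)^2 s^(d+2) / 12, hence the 96 in \<open>cell_gain\<close>.\<close>
  have "(1 / 2 ^ K) ^ (CARD('n) + 2) / 12 * cell_gain \<delta> v
     = (1 / 2 ^ K) ^ (DIM(real ^ 'n) + 2) / 12 * ((1 - 1 / 8) * (norm v)\<^sup>2) - (real CARD('n) / 2 ^ K * \<delta>)\<^sup>2 / (1 / 8) * (1 / 2 ^ K) ^ DIM(real ^ 'n)"
    by (simp add: cell_gain_def power_add power2_eq_square field_simps)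
  also have "\<dots> \<le> (LINT z:cbox (hilbert_corner K h) b|lborel. (g z - c)\<^sup>2)"
    by (rule cube_variance_lower[where m=m and ?g0.0="g m"]) (use bm cont lin in auto)
  also have "\<dots> = (LINT z:hilbert_cube K h|lborel. (f0 z - c)\<^sup>2)"
    unfolding bm(1)[symmetric] set_lebesgue_integral_def
    by (intro Bochner_Integration.integral_cong refl) (use sub q in \<open>auto simp: indicator_def f0_def\<close>)
  finally show ?thesis .
qed

text \<open>\<open>cell_gain\<close> can be negative where the gradient is small; the trivial bound
  0 is then used, whence the maximum.\<close>

lemma stratum_dev_lower:
  assumes n: "0 < n" and q: "q \<in> inner_cells K0" and k: "stratum n k \<subseteq> dyadic (CARD('n) * K0) q"
    and n_large: "2 ^ (CARD('n) * K0) \<le> n"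
    and \<delta>: "\<And>x. x \<in> hilbert_cube K0 q \<Longrightarrow> norm (Dg x - v) \<le> \<delta>" and v: "v = Dg (hilbert_corner K0 q)"
  shows "4 / 3 * var_rate CARD('n) n * max 0 (cell_gain \<delta> v) \<le> real n * stratum_dev \<phi> n k"
proof -
  let ?G = "cell_gain \<delta> v"
  obtain K where K: "2 * real n \<le> 2 ^ (CARD('n) * K)" "2 ^ (CARD('n) * K) < 2 ^ (CARD('n) + 1) * real n"
    using ex_dyadic_scale[OF _ n, of "CARD('n)"] by auto
  obtain j :: nat where j: "real j + 1 \<le> 2 ^ (CARD('n) * K) / real n"
     "4 / 3 * var_rate CARD('n) n \<le> real j * real n * ((1 / 2 ^ K) ^ (CARD('n) + 2) / 12)"
    using dyadic_scale_constant[OF _ n K] unfolding var_rate_def by auto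
  \<comment> \<open>Fine cells must lie inside the coarse one: otherwise 2n \<le> 2^(d K) \<le> 2^(d
    K0) \<le> n.\<close>
  have K0K: "K0 \<le> K"
  proof (rule ccontr)
    assume "\<not> K0 \<le> K"
    then have "(2::real) ^ (CARD('n) * K) \<le> 2 ^ (CARD('n) * K0)" by (intro power_increasing) auto
    moreover have "real (2 ^ (CARD('n) * K0)) \<le> real n" using n_large by (simp only: of_nat_le_iff)
    then have "(2::real) ^ (CARD('n) * K0) \<le> real n" by (simp only: of_nat_power of_nat_numeral)
    moreover have "0 < real n" using n by simp
    ultimately show False using K(1) by linarith
  qed
  obtain B where B: "\<And>x. \<bar>f0 x\<bar> \<le> B" using f0_bounded by blast
  have dev: "real j * ((1 / 2 ^ K) ^ (CARD('n) + 2) / 12 * ?G) \<le> stratum_dev \<phi> n k"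
  proof (rule stratum_dev_ge[OF borel_\<phi> _ n j(1), of B])
    show "\<bar>\<phi> x\<bar> \<le> B" for x using B by (simp add: \<phi>_def)
    fix h c assume "dyadic (CARD('n) * K) h \<subseteq> stratum n k"
    then have sub: "dyadic (CARD('n) * K) h \<subseteq> dyadic (CARD('n) * K0) q" using k by blast
    have qW: "q < 2 ^ (CARD('n) * K0)" "(hilbert_cube K0 q :: (real ^ 'n) set) \<subseteq> W" using q by (auto simp: inner_cells_def)
    note hc = hilbert_cube_subset_of_dyadic[where 'n='n, OF K0K qW(1) sub]
    have "(1 / 2 ^ K) ^ (CARD('n) + 2) / 12 * ?G \<le> (LINT z:hilbert_cube K h|lborel. (f0 z - c)\<^sup>2)"
      by (rule cube_dev_lower[OF hc(2) qW(2) \<delta> v])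
    also have "\<dots> = (LINT x:dyadic (CARD('n) * K) h|lborel. (f0 (hilbert_curve x) - c)\<^sup>2)"
      using hc(1) by (intro integral_dyadic_hilbert_curve[symmetric]) measurable
    finally show "(1 / 2 ^ K) ^ (CARD('n) + 2) / 12 * ?G \<le> (LINT x:dyadic (CARD('n) * K) h|lborel. (\<phi> x - c)\<^sup>2)"
      by (simp add: \<phi>_def)
  qed
  have dev0: "0 \<le> stratum_dev \<phi> n k"
    unfolding stratum_dev_def set_lebesgue_integral_def by (intro Bochner_Integration.integral_nonneg) simp
  have scale: "real n * (real j * \<gamma>) * max 0 G \<le> real n * D" if "real j * (\<gamma> * G) \<le> D" "0 \<le> D" for \<gamma> G D
  proof (cases "0 \<le> G")
    case True
    then show ?thesis using mult_left_mono[OF that(1), of "real n"] by (simp only: max_absorb2 mult.assoc)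
  next
    case False
    then show ?thesis using that(2) by simp
  qed
  have "real n * (real j * ((1 / 2 ^ K) ^ (CARD('n) + 2) / 12)) * max 0 ?G \<le> real n * stratum_dev \<phi> n k"
    by (rule scale[OF dev dev0])
  moreover have "4 / 3 * var_rate CARD('n) n * max 0 ?G \<le> real n * (real j * ((1 / 2 ^ K) ^ (CARD('n) + 2) / 12)) * max 0 ?G"
    using j(2) by (intro mult_right_mono) (simp_all add: mult_ac)
  ultimately show ?thesis by (rule order_trans[rotated])
qed

lemma stratum_dev_nonneg: "0 \<le> stratum_dev \<psi> n k"
  unfolding stratum_dev_def set_lebesgue_integral_def by (intro Bochner_Integration.integral_nonneg) simp

text \<open>Each inner coarse interval contains at least n / 2^(d K0) - 2 strata, and no stratum
  lies in two of them. Dropping the strata that cross a coarse endpoint accounts for the term 2 /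
  n.\<close>

lemma sum_stratum_dev_lower:
  assumes n: "0 < n" and n_large: "2 ^ (CARD('n) * K0) \<le> n"
    and \<delta>: "\<And>q x. q \<in> inner_cells K0 \<Longrightarrow> x \<in> hilbert_cube K0 q \<Longrightarrow> norm (Dg x - Dg (hilbert_corner K0 q)) \<le> \<delta>"
  shows "4 / 3 * var_rate CARD('n) n * (1 / 2 ^ (CARD('n) * K0) - 2 / real n)
       * (\<Sum>q\<in>inner_cells K0. max 0 (cell_gain \<delta> (Dg (hilbert_corner K0 q))))
     \<le> (\<Sum>k<n. stratum_dev \<phi> n k)"
proof -
  let ?G = "\<lambda>q. max 0 (cell_gain \<delta> (Dg (hilbert_corner K0 q)))"
  define A where "A q = {k. k < n \<and> stratum n k \<subseteq> dyadic (CARD('n) * K0) q}" for q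
  have r0: "0 \<le> var_rate CARD('n) n" by (simp add: var_rate_def)
  have finA: "finite (A q)" for q by (simp add: A_def)
  have disj: "A q \<inter> A q' = {}" if "q \<noteq> q'" for q q'
  proof (rule ccontr)
    assume "A q \<inter> A q' \<noteq> {}"
    then obtain k where k: "stratum n k \<subseteq> dyadic (CARD('n) * K0) q" "stratum n k \<subseteq> dyadic (CARD('n) * K0) q'" by (auto simp: A_def)
    have "real k / real n \<in> stratum n k" using n by (simp add: stratum_def divide_strict_right_mono)
    then show False using k dyadic_disjoint[OF that] by blast
  qed
  have q_bound: "(real n / 2 ^ (CARD('n) * K0) - 2) * (4 / 3 * var_rate CARD('n) n * ?G q) \<le> (\<Sum>k\<in>A q. real n * stratum_dev \<phi> n k)"
    if q: "q \<in> inner_cells K0" for q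
  proof -
    have "real n / 2 ^ (CARD('n) * K0) - 2 \<le> real (card (A q))"
      unfolding A_def using q by (intro card_strata_in_dyadic n) (auto simp: inner_cells_def)
    then have "(real n / 2 ^ (CARD('n) * K0) - 2) * (4 / 3 * var_rate CARD('n) n * ?G q) \<le> real (card (A q)) * (4 / 3 * var_rate CARD('n) n * ?G q)"
      using r0 by (intro mult_right_mono) auto
    also have "\<dots> = (\<Sum>k\<in>A q. 4 / 3 * var_rate CARD('n) n * ?G q)" by simp
    also have "\<dots> \<le> (\<Sum>k\<in>A q. real n * stratum_dev \<phi> n k)"
      by (intro sum_mono stratum_dev_lower[OF n q _ n_large \<delta>[OF q] refl]) (auto simp: A_def)
    finally show ?thesis .
  qed
  have "(real n / 2 ^ (CARD('n) * K0) - 2) * (4 / 3 * var_rate CARD('n) n) * (\<Sum>q\<in>inner_cells K0. ?G q)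
      = (\<Sum>q\<in>inner_cells K0. (real n / 2 ^ (CARD('n) * K0) - 2) * (4 / 3 * var_rate CARD('n) n * ?G q))"
    by (simp add: sum_distrib_left mult.assoc)
  also have "\<dots> \<le> (\<Sum>q\<in>inner_cells K0. \<Sum>k\<in>A q. real n * stratum_dev \<phi> n k)"
    by (intro sum_mono q_bound)
  also have "\<dots> = (\<Sum>k\<in>(\<Union>q\<in>inner_cells K0. A q). real n * stratum_dev \<phi> n k)"
    using inner_cells_finite finA disj by (intro sum.UNION_disjoint[symmetric]) auto
  also have "\<dots> \<le> (\<Sum>k<n. real n * stratum_dev \<phi> n k)"
    using stratum_dev_nonneg by (intro sum_mono2) (auto simp: A_def)
  also have "\<dots> = real n * (\<Sum>k<n. stratum_dev \<phi> n k)" by (simp add: sum_distrib_left)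
  finally have "(real n / 2 ^ (CARD('n) * K0) - 2) * (4 / 3 * var_rate CARD('n) n) * (\<Sum>q\<in>inner_cells K0. ?G q) / real n
      \<le> (\<Sum>k<n. stratum_dev \<phi> n k)" using n by (simp add: divide_le_eq mult.commute)
  moreover have "(real n / 2 ^ (CARD('n) * K0) - 2) * (4 / 3 * var_rate CARD('n) n) * (\<Sum>q\<in>inner_cells K0. ?G q) / real n
     = 4 / 3 * var_rate CARD('n) n * (1 / 2 ^ (CARD('n) * K0) - 2 / real n) * (\<Sum>q\<in>inner_cells K0. ?G q)"
    using n by (simp add: field_simps)
  ultimately show ?thesis by (simp only:)
qed

text \<open>Freezing the gradient at a corner costs at most 2 M \<delta> + \<delta>^2 per unit
  volume, the cells have total volume at most 1, and the uncovered part is bounded by M^2. Shared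
  faces are counted several times, which is harmless in an upper bound.\<close>

lemma \<sigma>2_le_cells:
  assumes M: "0 \<le> M" "\<And>x. x \<in> cbox 0 1 \<Longrightarrow> norm (Dg x) \<le> M"
    and \<delta>: "\<And>q x. q \<in> inner_cells K0 \<Longrightarrow> x \<in> hilbert_cube K0 q \<Longrightarrow> norm (Dg x - Dg (hilbert_corner K0 q)) \<le> \<delta>" "0 \<le> \<delta>"
  shows "\<sigma>2 \<le> (\<Sum>q\<in>inner_cells K0. (norm (Dg (hilbert_corner K0 q)))\<^sup>2) / 2 ^ (CARD('n) * K0) + (2 * M * \<delta> + \<delta>\<^sup>2)
     + M\<^sup>2 * measure lborel (W - (\<Union>h\<in>inner_cells K0. hilbert_cube K0 h))"
proof -
  let ?v = "\<lambda>q. norm (Dg (hilbert_corner K0 q))"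
  let ?Q = "hilbert_cube K0 :: nat \<Rightarrow> (real ^ 'n) set"
  let ?R = "W - (\<Union>h\<in>inner_cells K0. ?Q h)"
  define \<kappa> where "\<kappa> = 2 * M * \<delta> + \<delta>\<^sup>2"
  let ?s = "\<lambda>x. \<Sum>q\<in>inner_cells K0. indicator (?Q q) x * ((?v q)\<^sup>2 + \<kappa>)"
  have \<kappa>0: "0 \<le> \<kappa>" using M \<delta> by (simp add: \<kappa>_def)
  have Qb [measurable]: "?Q q \<in> sets borel" for q by (simp add: compact_hilbert_cube compact_imp_closed)
  have [measurable]: "W \<in> sets borel" using W_open by simp
  have intQ: "integrable lborel (\<lambda>x. indicator (?Q q) x * c)" for q and c :: real
    by (intro integrable_mult_left integrable_real_indicator) 
      (use emeasure_bounded_finite[OF compact_imp_bounded[OF compact_hilbert_cube]] in auto)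
  have [measurable]: "?R \<in> sets borel" by (intro sets.Diff sets.finite_UN inner_cells_finite) auto
  have "emeasure lborel ?R < \<infinity>"
    by (rule emeasure_bounded_finite) (rule bounded_subset[OF bounded_cbox[of 0 1]], use W_sub in auto)
  then have intR: "integrable lborel (\<lambda>x. indicator ?R x * c)" for c :: real
    by (intro integrable_mult_left integrable_real_indicator) auto
  have "emeasure lborel W < \<infinity>"
    by (rule emeasure_bounded_finite) (rule bounded_subset[OF bounded_cbox[of 0 1] W_sub])
  then have intW: "integrable lborel (\<lambda>x. indicator W x * M\<^sup>2)"
    by (intro integrable_mult_left integrable_real_indicator) auto
  have sq: "(norm (Dg x))\<^sup>2 \<le> M\<^sup>2" if "x \<in> W" for x
    using M W_sub that by (intro power_mono) auto
  have "(\<lambda>x. indicator W x *\<^sub>R (norm (Dg x))\<^sup>2) \<in> borel_measurable borel"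
    by (intro borel_measurable_continuous_on_indicator continuous_intros continuous_on_subset[OF Dg_cont W_sub]) auto
  then have intD: "integrable lborel (\<lambda>x. indicator W x *\<^sub>R (norm (Dg x))\<^sup>2)"
    by (intro Bochner_Integration.integrable_bound[OF intW]) (use sq in \<open>auto simp: indicator_def\<close>)
  have cell: "(norm (Dg x))\<^sup>2 \<le> (?v q)\<^sup>2 + \<kappa>" if q: "q \<in> inner_cells K0" and x: "x \<in> ?Q q" for q x
  proof -
    have "norm (Dg x) \<le> ?v q + \<delta>"
      using norm_triangle_ineq[of "Dg (hilbert_corner K0 q)" "Dg x - Dg (hilbert_corner K0 q)"] \<delta>(1)[OF q x] by simp
    then have "(norm (Dg x))\<^sup>2 \<le> (?v q + \<delta>)\<^sup>2" by (intro power_mono) auto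
    also have "\<dots> = (?v q)\<^sup>2 + 2 * ?v q * \<delta> + \<delta>\<^sup>2" by (simp add: power2_sum)
    also have "?v q \<le> M" using hilbert_corner_in_cube hilbert_cube_subset_unit by (intro M(2)) blast
    then have "2 * ?v q * \<delta> \<le> 2 * M * \<delta>" using \<delta>(2) by (intro mult_right_mono) auto
    finally show ?thesis by (simp add: \<kappa>_def)
  qed
  have "\<sigma>2 \<le> (\<integral>x. ?s x + indicator ?R x * M\<^sup>2 \<partial>lborel)"
    unfolding \<sigma>2_def set_lebesgue_integral_def
  proof (rule integral_mono[OF intD])
    show "integrable lborel (\<lambda>x. ?s x + indicator ?R x * M\<^sup>2)"
      by (intro Bochner_Integration.integrable_add Bochner_Integration.integrable_sum intQ intR)
    fix x :: "real ^ 'n"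
    have nn: "0 \<le> ?s x"
      using \<kappa>0 by (intro sum_nonneg mult_nonneg_nonneg) auto
    show "indicator W x *\<^sub>R (norm (Dg x))\<^sup>2 \<le> ?s x + indicator ?R x * M\<^sup>2"
    proof (cases "x \<in> W")
      case True
      show ?thesis
      proof (cases "x \<in> ?R")
        case True
        then show ?thesis using nn sq[OF \<open>x \<in> W\<close>] by simp
      next
        case False
        then obtain q where q: "q \<in> inner_cells K0" "x \<in> ?Q q" using True by auto
        have "(norm (Dg x))\<^sup>2 \<le> indicator (?Q q) x * ((?v q)\<^sup>2 + \<kappa>)" using cell[OF q] q by simp
        also have "\<dots> \<le> ?s x"
          using \<kappa>0 by (intro member_le_sum[OF q(1) _ inner_cells_finite]) auto
        finally show ?thesis using True False by simp
      qed
    next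
      case False
      then show ?thesis using nn by simp
    qed
  qed
  also have "\<dots> = (\<Sum>q\<in>inner_cells K0. \<integral>x. indicator (?Q q) x * ((?v q)\<^sup>2 + \<kappa>) \<partial>lborel) + (\<integral>x. indicator ?R x * M\<^sup>2 \<partial>lborel)"
    unfolding Bochner_Integration.integral_add[OF Bochner_Integration.integrable_sum[OF intQ] intR]
      Bochner_Integration.integral_sum[OF intQ] ..
  also have "\<dots> = (\<Sum>q\<in>inner_cells K0. ((?v q)\<^sup>2 + \<kappa>) / 2 ^ (CARD('n) * K0)) + M\<^sup>2 * measure lborel ?R"
    by (simp add: measure_hilbert_cube mult.commute)
  also have "(\<Sum>q\<in>inner_cells K0. ((?v q)\<^sup>2 + \<kappa>) / 2 ^ (CARD('n) * K0))
      = (\<Sum>q\<in>inner_cells K0. (?v q)\<^sup>2) / 2 ^ (CARD('n) * K0) + real (card (inner_cells K0)) / 2 ^ (CARD('n) * K0) * \<kappa>"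
    by (simp add: sum_divide_distrib[symmetric] sum.distrib add_divide_distrib)
  also have "real (card (inner_cells K0)) / 2 ^ (CARD('n) * K0) * \<kappa> \<le> 1 * \<kappa>"
    by (intro mult_right_mono inner_cells_density \<kappa>0)
  finally show ?thesis by (simp add: \<kappa>_def)
qed

end

section \<open>Choice of the coarse level, and large n\<close>

context c1_on_open
begin

text \<open>\<delta> is chosen before K0: it limits the linearisation losses to a share of
  \<open>\<sigma>2\<close>, and a fine enough level then meets both uniform continuity of
  \<open>Dg\<close> and exhaustion of W. The share 3/4 is the reciprocal of the factor 4/3 gained in
  \<open>dyadic_scale_constant\<close>.\<close>

lemma ex_fine_cells:
  "\<exists>K0 \<delta>. (\<forall>q\<in>inner_cells K0. \<forall>x\<in>hilbert_cube K0 q. norm (Dg x - Dg (hilbert_corner K0 q)) \<le> \<delta>) \<and>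
     3 / 4 * \<sigma>2 < (\<Sum>q\<in>inner_cells K0. max 0 (cell_gain \<delta> (Dg (hilbert_corner K0 q)))) / 2 ^ (CARD('n) * K0)"
proof -
  obtain M where M: "0 \<le> M" "\<And>x. x \<in> cbox 0 1 \<Longrightarrow> norm (Dg x) \<le> M" using Dg_bounded by blast
  have \<sigma>2: "0 < \<sigma>2" using nonconst by (simp add: \<sigma>2_def)
  have "((\<lambda>\<delta>. 7 / 8 * (2 * M * \<delta> + \<delta>\<^sup>2) + 96 * (real CARD('n) * \<delta>)\<^sup>2) \<longlongrightarrow> 7 / 8 * (2 * M * 0 + 0\<^sup>2) + 96 * (real CARD('n) * 0)\<^sup>2) (at_right 0)"
    by (intro tendsto_intros)
  then have "\<forall>\<^sub>F \<delta> in at_right 0. 7 / 8 * (2 * M * \<delta> + \<delta>\<^sup>2) + 96 * (real CARD('n) * \<delta>)\<^sup>2 < \<sigma>2 / 16"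
    by (rule order_tendstoD(2)) (use \<sigma>2 in simp)
  moreover have "\<forall>\<^sub>F \<delta> in at_right 0. 0 < (\<delta>::real)" by (rule eventually_at_right_less)
  ultimately have "\<forall>\<^sub>F \<delta> in at_right 0. 0 < \<delta> \<and> 7 / 8 * (2 * M * \<delta> + \<delta>\<^sup>2) + 96 * (real CARD('n) * \<delta>)\<^sup>2 < \<sigma>2 / 16"
    by eventually_elim simp
  then obtain \<delta> where \<delta>: "0 < \<delta>" "7 / 8 * (2 * M * \<delta> + \<delta>\<^sup>2) + 96 * (real CARD('n) * \<delta>)\<^sup>2 < \<sigma>2 / 16"
    using eventually_happens'[OF trivial_limit_at_right_real] by blast
  have "uniformly_continuous_on (cbox 0 1) Dg"
    by (rule compact_uniformly_continuous[OF Dg_cont compact_cbox])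
  then obtain \<eta> where \<eta>: "0 < \<eta>" "\<And>x y. x \<in> cbox 0 1 \<Longrightarrow> y \<in> cbox 0 1 \<Longrightarrow> dist y x < \<eta> \<Longrightarrow> dist (Dg y) (Dg x) < \<delta>"
    using \<delta>(1) unfolding uniformly_continuous_on_def by metis
  define R where "R k = measure lborel (W - (\<Union>h\<in>inner_cells k. hilbert_cube k h))" for k
  have "R \<longlonglongrightarrow> 0" using W_exhaust unfolding R_def inner_cells_def .
  then have "(\<lambda>k. M\<^sup>2 * R k) \<longlonglongrightarrow> M\<^sup>2 * 0" by (intro tendsto_intros)
  then have "\<forall>\<^sub>F k in sequentially. M\<^sup>2 * R k < \<sigma>2 / 32"
    by (rule order_tendstoD(2)) (use \<sigma>2 in simp)
  moreover have "\<forall>\<^sub>F k in sequentially. real CARD('n) / 2 ^ k < \<eta>"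
    by (rule order_tendstoD(2)[OF LIMSEQ_const_div_pow2 \<eta>(1)])
  ultimately have "\<forall>\<^sub>F k in sequentially. M\<^sup>2 * R k < \<sigma>2 / 32 \<and> real CARD('n) / 2 ^ k < \<eta>"
    by eventually_elim simp
  then obtain K0 where K0: "M\<^sup>2 * R K0 < \<sigma>2 / 32" "real CARD('n) / 2 ^ K0 < \<eta>"
    using eventually_happens'[OF sequentially_bot] by blast
  have osc: "norm (Dg x - Dg (hilbert_corner K0 q)) \<le> \<delta>" if "x \<in> hilbert_cube K0 q" for q x
  proof -
    have "dist x (hilbert_corner K0 q) < \<eta>"
      using dist_hilbert_cube[OF that hilbert_corner_in_cube] K0(2) by linarith
    then have "dist (Dg x) (Dg (hilbert_corner K0 q)) < \<delta>"
      using that hilbert_corner_in_cube[of K0 q] hilbert_cube_subset_unit[of K0 q] by (intro \<eta>(2)) auto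
    then show ?thesis by (simp add: dist_norm)
  qed
  define A where "A = (\<Sum>q\<in>inner_cells K0. (norm (Dg (hilbert_corner K0 q)))\<^sup>2) / 2 ^ (CARD('n) * K0)"
  define T where "T = 96 * (real CARD('n) * \<delta>)\<^sup>2"
  have "\<sigma>2 \<le> A + (2 * M * \<delta> + \<delta>\<^sup>2) + M\<^sup>2 * R K0"
    unfolding A_def R_def using M osc \<delta>(1) by (intro \<sigma>2_le_cells) auto
  \<comment> \<open>The budget: 7/8 - 1/16 - 7/8 * 1/32 still exceeds 3/4.\<close>
  moreover have "3 / 4 * s < 7 / 8 * A - t" if "s \<le> A + \<kappa> + e" "7 / 8 * \<kappa> + t < s / 16" "e < s / 32" "0 < s" for s \<kappa> e t
    using that by linarith
  ultimately have "3 / 4 * \<sigma>2 < 7 / 8 * A - T"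
    using \<delta>(2)[folded T_def] K0(1) \<sigma>2 by blast
  also have "\<dots> \<le> 7 / 8 * A - real (card (inner_cells K0)) / 2 ^ (CARD('n) * K0) * T"
    using mult_right_mono[OF inner_cells_density[of K0], of T] by (simp add: T_def)
  also have "\<dots> = (\<Sum>q\<in>inner_cells K0. 7 / 8 * (norm (Dg (hilbert_corner K0 q)))\<^sup>2 - T) / 2 ^ (CARD('n) * K0)"
    by (simp add: A_def sum_subtractf diff_divide_distrib flip: sum_distrib_left sum_divide_distrib)
  also have "\<dots> \<le> (\<Sum>q\<in>inner_cells K0. max 0 (cell_gain \<delta> (Dg (hilbert_corner K0 q)))) / 2 ^ (CARD('n) * K0)"
    unfolding cell_gain_def T_def by (intro divide_right_mono sum_mono) auto
  finally show ?thesis using osc by blast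
qed

text \<open>With K0 fixed, n enters the prefactor through 2 / n alone. The limit, 4/3 times a
  quantity strictly above 3/4 of \<open>\<sigma>2\<close>, strictly exceeds
  \<open>\<sigma>2\<close>, so the bound holds for all large n.\<close>

theorem sum_stratum_dev_asymp:
  "\<forall>\<^sub>F n in sequentially. \<sigma>2 * var_rate CARD('n) n \<le> (\<Sum>k<n. stratum_dev \<phi> n k)"
proof -
  obtain K0 \<delta> where K0: "\<And>q x. q \<in> inner_cells K0 \<Longrightarrow> x \<in> hilbert_cube K0 q \<Longrightarrow> norm (Dg x - Dg (hilbert_corner K0 q)) \<le> \<delta>"
     "3 / 4 * \<sigma>2 < (\<Sum>q\<in>inner_cells K0. max 0 (cell_gain \<delta> (Dg (hilbert_corner K0 q)))) / 2 ^ (CARD('n) * K0)"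
    using ex_fine_cells by blast
  define S where "S = (\<Sum>q\<in>inner_cells K0. max 0 (cell_gain \<delta> (Dg (hilbert_corner K0 q))))"
  have "(\<lambda>n. 4 / 3 * (1 / 2 ^ (CARD('n) * K0) - 2 / real n) * S) \<longlonglongrightarrow> 4 / 3 * (1 / 2 ^ (CARD('n) * K0) - 0) * S"
    by (intro tendsto_intros lim_const_over_n)
  moreover have "\<sigma>2 < 4 / 3 * (1 / 2 ^ (CARD('n) * K0) - 0) * S"
  proof -
    have "4 / 3 * (1 / 2 ^ (CARD('n) * K0) - 0) * S = 4 / 3 * (S / 2 ^ (CARD('n) * K0))" by simp
    then show ?thesis using K0(2)[folded S_def] by linarith
  qed
  ultimately have "\<forall>\<^sub>F n in sequentially. \<sigma>2 < 4 / 3 * (1 / 2 ^ (CARD('n) * K0) - 2 / real n) * S"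
    by (rule order_tendstoD(1))
  then show ?thesis
    using eventually_ge_at_top[of "2 ^ (CARD('n) * K0)"] eventually_gt_at_top[of 0]
  proof eventually_elim
    case (elim n)
    have "\<sigma>2 * var_rate CARD('n) n \<le> 4 / 3 * (1 / 2 ^ (CARD('n) * K0) - 2 / real n) * S * var_rate CARD('n) n"
      using elim by (intro mult_right_mono) (auto simp: var_rate_def)
    also have "\<dots> = 4 / 3 * var_rate CARD('n) n * (1 / 2 ^ (CARD('n) * K0) - 2 / real n) * S" by simp
    also have "\<dots> \<le> (\<Sum>k<n. stratum_dev \<phi> n k)"
      unfolding S_def by (rule sum_stratum_dev_lower[OF _ _ K0(1)]) (use elim in auto)
    finally show ?case .
  qed
qed

end

section \<open>Null boundaries and completed measures\<close>

text \<open>The estimate for f will be such a function: it equals a Borel one off a null event, and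
  the exceptional part of a preimage is a subset of a null set.\<close>

lemma borel_measurable_completion_AE:
  fixes f f0 :: "'a \<Rightarrow> real"
  assumes f0: "f0 \<in> borel_measurable M" and eq: "AE x in M. f x = f0 x"
  shows "f \<in> borel_measurable (completion M)"
proof (rule measurableI)
  fix A :: "real set" assume A: "A \<in> sets borel"
  obtain N where N: "N \<in> null_sets M" "{x \<in> space M. f x \<noteq> f0 x} \<subseteq> N"
    using eq by (auto elim!: AE_E intro: null_setsI)
  have "f0 -` A \<inter> space M - N \<in> sets M" using measurable_sets[OF f0 A] N by auto
  then have 1: "f0 -` A \<inter> space M - N \<in> sets (completion M)" by simp
  have 2: "f -` A \<inter> space M \<inter> N \<in> sets (completion M)"
    by (rule sets_completionI_sub[OF N(1)]) auto
  have "f -` A \<inter> space (completion M) = (f0 -` A \<inter> space M - N) \<union> (f -` A \<inter> space M \<inter> N)"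
    using N(2) by auto
  then show "f -` A \<inter> space (completion M) \<in> sets (completion M)"
    using sets.Un[OF 1 2] by (simp only:)
qed simp

lemma integral_completion_AE:
  fixes f f0 :: "'a \<Rightarrow> real"
  assumes f0: "f0 \<in> borel_measurable M" and eq: "AE x in M. f x = f0 x"
  shows "integral\<^sup>L (completion M) f = integral\<^sup>L M f0"
proof -
  have "integral\<^sup>L (completion M) f = integral\<^sup>L (completion M) f0"
    using f0 eq by (intro integral_cong_AE borel_measurable_completion_AE[OF f0 eq] measurable_completion AE_completion) auto
  also have "\<dots> = integral\<^sup>L M f0" by (rule integral_completion[OF f0])
  finally show ?thesis .
qed

lemma distr_completion_AE:
  fixes f f0 :: "'a \<Rightarrow> real"
  assumes f0: "f0 \<in> borel_measurable M" and eq: "AE x in M. f x = f0 x"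
  shows "distr (completion M) borel f = distr M borel f0"
proof -
  have "distr (completion M) borel f = distr (completion M) borel f0"
    using f0 eq by (intro distr_cong_AE borel_measurable_completion_AE[OF f0 eq] measurable_completion AE_completion) auto
  also have "\<dots> = distr M borel f0" by (rule distr_completion[OF f0])
  finally show ?thesis .
qed

lemma compact_eps_nbhd: "compact A \<Longrightarrow> compact (eps_nbhd A \<epsilon>)"
  using compact_sums[of A "cball 0 \<epsilon>"] by (simp add: eps_nbhd_def)

text \<open>The ratio has a finite limit, and multiplying by 2 \<epsilon> sends it to 0.\<close>

lemma minkowski_nbhd_tendsto:
  assumes "has_minkowski_content A"
  shows "((\<lambda>\<epsilon>. measure lborel (eps_nbhd A \<epsilon>)) \<longlongrightarrow> 0) (at_right 0)"
proof -
  obtain L :: real where L: "((\<lambda>\<epsilon>. measure lborel (eps_nbhd A \<epsilon>) / (2 * \<epsilon>)) \<longlongrightarrow> L) (at_right 0)"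
    using assms unfolding has_minkowski_content_def by blast
  have "((\<lambda>\<epsilon>. measure lborel (eps_nbhd A \<epsilon>) / (2 * \<epsilon>) * (2 * \<epsilon>)) \<longlongrightarrow> L * (2 * 0)) (at_right 0)"
    by (intro tendsto_intros L)
  then have "((\<lambda>\<epsilon>. measure lborel (eps_nbhd A \<epsilon>) / (2 * \<epsilon>) * (2 * \<epsilon>)) \<longlongrightarrow> 0) (at_right 0)" by simp
  moreover have "\<forall>\<^sub>F \<epsilon> in at_right 0. measure lborel (eps_nbhd A \<epsilon>) / (2 * \<epsilon>) * (2 * \<epsilon>) = measure lborel (eps_nbhd A \<epsilon>)"
    using eventually_at_right_less[of 0] by eventually_elim simp
  ultimately show ?thesis by (rule Lim_transform_eventually)
qed

lemma minkowski_null: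
  fixes A :: "'a::euclidean_space set"
  assumes A: "compact A" and mink: "has_minkowski_content A"
  shows "A \<in> null_sets lborel"
proof -
  have le: "measure lborel A \<le> measure lborel (eps_nbhd A \<epsilon>)" if "0 < \<epsilon>" for \<epsilon>
  proof (rule measure_mono_fmeasurable)
    show "A \<subseteq> eps_nbhd A \<epsilon>"
    proof
      fix x assume "x \<in> A"
      then show "x \<in> eps_nbhd A \<epsilon>" unfolding eps_nbhd_def using that
        by (intro CollectI exI[of _ x] exI[of _ 0]) auto
    qed
    show "A \<in> sets lborel" using A by (simp add: compact_imp_closed)
    have "compact (eps_nbhd A \<epsilon>)" by (rule compact_eps_nbhd[OF A])
    then show "eps_nbhd A \<epsilon> \<in> fmeasurable lborel"
      by (intro fmeasurableI emeasure_bounded_finite) (auto simp: compact_imp_closed compact_imp_bounded)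
  qed
  have "\<forall>\<^sub>F \<epsilon> in at_right 0. measure lborel A \<le> measure lborel (eps_nbhd A \<epsilon>)"
    using eventually_at_right_less[of "0::real"] by eventually_elim (rule le)
  then have "measure lborel A \<le> 0"
    using tendsto_lowerbound[OF minkowski_nbhd_tendsto[OF mink] _ trivial_limit_at_right_real] by blast
  then have "measure lborel A = 0" by (simp add: measure_le_0_iff)
  moreover have "emeasure lborel A \<noteq> \<infinity>"
    using emeasure_bounded_finite[OF compact_imp_bounded[OF A]] by simp
  ultimately have "emeasure lborel A = 0" by (simp add: emeasure_eq_ennreal_measure)
  then show ?thesis using A by (simp add: null_sets_def compact_imp_closed)
qed

text \<open>An uncovered point of the interior lies in a cube that leaves the interior; being
  connected, this cube meets the frontier. So the uncovered part sits in neighbourhoods of the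
  frontier whose radius, a bound for the cube diameter, shrinks to 0.\<close>

lemma interior_exhausted_by_cells:
  fixes \<Omega> :: "(real ^ 'n::finite) set"
  assumes sub: "\<Omega> \<subseteq> cbox 0 1" and mink: "has_minkowski_content (frontier \<Omega>)"
  shows "(\<lambda>k. measure lborel (interior \<Omega> - (\<Union>h\<in>{h. h < 2 ^ (CARD('n) * k) \<and> hilbert_cube k h \<subseteq> interior \<Omega>}. hilbert_cube k h))) \<longlonglongrightarrow> 0"
    (is "?R \<longlonglongrightarrow> 0")
proof -
  let ?I = "\<lambda>k. {h. h < 2 ^ (CARD('n) * k) \<and> hilbert_cube k h \<subseteq> interior \<Omega>}"
  let ?e = "\<lambda>k. real CARD('n) / 2 ^ k"
  have comp: "compact (frontier \<Omega>)"
    by (rule compact_frontier_bounded) (rule bounded_subset[OF bounded_cbox sub])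
  have le: "\<forall>\<^sub>F k in sequentially. ?R k \<le> measure lborel (eps_nbhd (frontier \<Omega>) (?e k))"
  proof (rule always_eventually, rule allI, rule measure_mono_fmeasurable)
    fix k
    show "interior \<Omega> - (\<Union>h\<in>?I k. hilbert_cube k h)
        \<subseteq> eps_nbhd (frontier \<Omega>) (?e k)"
    proof
      fix x assume x: "x \<in> interior \<Omega> - (\<Union>h\<in>?I k. hilbert_cube k h)"
      then have "x \<in> cbox 0 1" using sub interior_subset by blast
      then obtain h where h: "h < 2 ^ (CARD('n) * k)" "x \<in> hilbert_cube k h"
        using hilbert_cubes_cover by blast
      then have "\<not> hilbert_cube k h \<subseteq> interior \<Omega>" using x by blast
      then have "hilbert_cube k h \<inter> frontier (interior \<Omega>) \<noteq> {}"
        using x h by (intro connected_Int_frontier convex_connected convex_hilbert_cube) auto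
      moreover have "frontier (interior \<Omega>) \<subseteq> frontier \<Omega>"
        by (auto simp: frontier_def intro: subsetD[OF closure_mono[OF interior_subset]])
      ultimately obtain y where y: "y \<in> hilbert_cube k h" "y \<in> frontier \<Omega>" by blast
      have "norm (x - y) \<le> ?e k" using dist_hilbert_cube[OF h(2) y(1)] by (simp add: dist_norm)
      then show "x \<in> eps_nbhd (frontier \<Omega>) (?e k)"
        unfolding eps_nbhd_def using y(2) by (intro CollectI exI[of _ y] exI[of _ "x - y"]) auto
    qed
    have "finite (?I k)"
      by (rule finite_subset[of _ "{..<2 ^ (CARD('n) * k)}"]) auto
    then show "interior \<Omega> - (\<Union>h\<in>?I k. hilbert_cube k h) \<in> sets lborel"
      by (intro sets.Diff sets.finite_UN) (auto simp: compact_imp_closed compact_hilbert_cube)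
    have "compact (eps_nbhd (frontier \<Omega>) (?e k))" by (rule compact_eps_nbhd[OF comp])
    then show "eps_nbhd (frontier \<Omega>) (?e k) \<in> fmeasurable lborel"
      by (intro fmeasurableI emeasure_bounded_finite) (auto simp: compact_imp_closed compact_imp_bounded)
  qed
  have "filterlim ?e (at_right 0) sequentially"
    unfolding filterlim_at using LIMSEQ_const_div_pow2 by (auto intro!: always_eventually)
  then have "(\<lambda>k. measure lborel (eps_nbhd (frontier \<Omega>) (?e k))) \<longlonglongrightarrow> 0"
    by (rule filterlim_compose[OF minkowski_nbhd_tendsto[OF mink]])
  moreover have "\<forall>\<^sub>F k in sequentially. 0 \<le> ?R k" by simp
  ultimately show ?thesis using le by (intro tendsto_sandwich[OF _ le tendsto_const])
qed

section \<open>Variance and normal limit of the estimate\<close>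

lemma borel_measurable_scr_sum [measurable]:
  fixes \<psi> :: "real \<Rightarrow> real"
  assumes "\<psi> \<in> borel_measurable borel"
  shows "(scr_sum \<psi> b m) \<in> borel_measurable (perm_space b)"
  by (intro borel_measurable_sum measurable_compose[OF borel_measurable_scr_vdc assms])

lemma borel_measurable_strat_sum [measurable]:
  fixes \<psi> :: "real \<Rightarrow> real"
  assumes [measurable]: "\<psi> \<in> borel_measurable borel"
  shows "(strat_sum \<psi> n) \<in> borel_measurable (strat_space n)"
proof (rule borel_measurable_sum)
  fix k assume "k \<in> {..<n}"
  then show "(\<lambda>u. \<psi> ((real k + u k) / real n)) \<in> borel_measurable (strat_space n)"
    by (intro measurable_compose[OF measurable_component_singleton]) measurable
qed

lemma distr_scr_transfer:
  fixes \<psi> h :: "real \<Rightarrow> real"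
  assumes b: "2 \<le> b" and \<psi> [measurable]: "\<psi> \<in> borel_measurable borel" and h [measurable]: "h \<in> borel_measurable borel"
  shows "distr (perm_space b) borel (\<lambda>\<omega>. h (scr_sum \<psi> b m \<omega>))
       = distr (strat_space (b ^ m)) borel (\<lambda>u. h (strat_sum \<psi> (b ^ m) u))"
proof -
  have "distr (perm_space b) borel (\<lambda>\<omega>. h (scr_sum \<psi> b m \<omega>))
      = distr (distr (perm_space b) borel (scr_sum \<psi> b m)) borel h"
    using distr_distr[OF h borel_measurable_scr_sum[OF \<psi>, of b m]] by (simp only: o_def)
  also have "\<dots> = distr (strat_space (b ^ m)) borel (\<lambda>u. h (strat_sum \<psi> (b ^ m) u))"
    unfolding distr_scr_vdc_sum[OF b \<psi>]
    using distr_distr[OF h borel_measurable_strat_sum[OF \<psi>, of "b ^ m"]] by (simp only: o_def)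
  finally show ?thesis .
qed

lemma integral_scr_transfer:
  fixes \<psi> h :: "real \<Rightarrow> real"
  assumes b: "2 \<le> b" and \<psi>: "\<psi> \<in> borel_measurable borel" and h [measurable]: "h \<in> borel_measurable borel"
  shows "(\<integral>\<omega>. h (scr_sum \<psi> b m \<omega>) \<partial>perm_space b)
       = (\<integral>u. h (strat_sum \<psi> (b ^ m) u) \<partial>strat_space (b ^ m))"
proof -
  have "(\<integral>\<omega>. h (scr_sum \<psi> b m \<omega>) \<partial>perm_space b)
      = integral\<^sup>L (distr (perm_space b) borel (scr_sum \<psi> b m)) h"
    by (rule integral_distr[symmetric, OF borel_measurable_scr_sum[OF \<psi>] h])
  also have "\<dots> = (\<integral>u. h (strat_sum \<psi> (b ^ m) u) \<partial>strat_space (b ^ m))"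
    unfolding distr_scr_vdc_sum[OF b \<psi>]
    by (rule integral_distr[OF borel_measurable_strat_sum[OF \<psi>] h])
  finally show ?thesis .
qed

text \<open>\<open>T\<close> counts the points falling into N. By unbiasedness of the stratified sum
  and measure preservation of H, its expectation is n times the measure of N inside the cube, which
  is 0.\<close>

lemma AE_scr_avoids_null:
  fixes N :: "(real ^ 'n::finite) set"
  assumes b: "2 \<le> b" and N: "N \<in> null_sets lborel"
  shows "AE \<omega> in perm_space b. \<forall>i\<in>{1..b ^ m}. hilbert_curve (scr_vdc b \<omega> i) \<notin> N"
proof -
  interpret P: prob_space "perm_space b" by (rule prob_space_perm_space)
  have [measurable]: "N \<in> sets borel" using N by (auto simp: null_sets_def)
  define \<psi> :: "real \<Rightarrow> real" where "\<psi> x = indicator N (hilbert_curve x)" for x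
  have \<psi> [measurable]: "\<psi> \<in> borel_measurable borel" unfolding \<psi>_def by measurable
  define T where "T \<omega> = (scr_sum \<psi> b m \<omega>)" for \<omega>
  have T0: "0 \<le> T \<omega>" for \<omega> unfolding T_def \<psi>_def by (intro sum_nonneg) simp
  have Tb: "T \<omega> \<le> real (b ^ m)" for \<omega>
  proof -
    have "T \<omega> \<le> (\<Sum>i = 1..b ^ m. 1)" unfolding T_def \<psi>_def by (intro sum_mono) (simp add: indicator_le_1)
    then show ?thesis by simp
  qed
  have [measurable]: "T \<in> borel_measurable (perm_space b)"
    unfolding T_def by (rule borel_measurable_scr_sum[OF \<psi>])
  have "integral\<^sup>L (perm_space b) T = (\<integral>u. (strat_sum \<psi> (b ^ m) u) \<partial>strat_space (b ^ m))"
    unfolding T_def using integral_scr_transfer[OF b \<psi>, of "\<lambda>x. x"] by simp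
  also have "\<dots> = real (b ^ m) * (LINT x:{0..1}|lborel. \<psi> x)"
    by (rule expectation_strat_sum[OF \<psi>, of 1]) (use b in \<open>auto simp: \<psi>_def indicator_def\<close>)
  also have "(LINT x:{0..1}|lborel. \<psi> x) = (LINT z:cbox 0 1|lborel. indicator N z)"
    unfolding \<psi>_def by (rule integral_hilbert_curve) measurable
  also have "\<dots> = 0"
    unfolding set_lebesgue_integral_def
    by (rule integral_eq_zero_AE) (use AE_not_in[OF N] in \<open>auto elim!: eventually_mono\<close>)
  finally have "integral\<^sup>L (perm_space b) T = 0" by simp
  moreover have "integrable (perm_space b) T"
    using T0 Tb by (intro P.integrable_const_bound[where B="real (b ^ m)"]) auto
  ultimately have "AE \<omega> in perm_space b. T \<omega> = 0"
    using T0 by (subst integral_nonneg_eq_0_iff_AE[symmetric]) auto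
  then show ?thesis
  proof eventually_elim
    case (elim \<omega>)
    then have "\<forall>i\<in>{1..b ^ m}. \<psi> (scr_vdc b \<omega> i) = 0"
      unfolding T_def by (subst (asm) sum_nonneg_eq_0_iff) (auto simp: \<psi>_def)
    then show ?case by (auto simp: \<psi>_def indicator_def split: if_splits)
  qed
qed

section \<open>Moments and normal limit for the Borel version\<close>

context c1_on_open
begin

definition "strat_var n = (\<Sum>k<n. stratum_dev \<phi> n k) / real n"
definition "mean_f0 = (LINT z:cbox 0 1|lborel. f0 z)"
definition "est b m \<omega> = (scr_sum \<phi> b m \<omega>) / real (b ^ m)"

lemma strat_var_nonneg: "0 \<le> strat_var n"
  unfolding strat_var_def by (intro divide_nonneg_nonneg sum_nonneg stratum_dev_nonneg) simp

lemma borel_est [measurable]: "est b m \<in> borel_measurable (perm_space b)"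
  unfolding est_def[abs_def] by (intro borel_measurable_divide borel_measurable_scr_sum) auto

lemma \<phi>_bounded: obtains B where "0 \<le> B" "\<And>x. \<bar>\<phi> x\<bar> \<le> B"
proof -
  obtain B where B: "\<And>x. \<bar>f0 x\<bar> \<le> B" using f0_bounded by blast
  have "0 \<le> B" using order_trans[OF abs_ge_zero B] .
  then show ?thesis by (rule that) (simp add: \<phi>_def B)
qed

lemma integral_\<phi>: "(LINT x:{0..1}|lborel. \<phi> x) = mean_f0"
  unfolding \<phi>_def mean_f0_def by (rule integral_hilbert_curve) measurable

lemma strat_expectation:
  assumes "0 < n"
  shows "(\<integral>u. (strat_sum \<phi> n u) \<partial>strat_space n) = real n * mean_f0"
proof -
  obtain B where "0 \<le> B" "\<And>x. \<bar>\<phi> x\<bar> \<le> B" using \<phi>_bounded by blast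
  from expectation_strat_sum[OF borel_\<phi> this(2) assms] show ?thesis by (simp only: integral_\<phi>)
qed

lemma est_expectation:
  assumes b: "2 \<le> b"
  shows "integral\<^sup>L (perm_space b) (est b m) = mean_f0"
proof -
  have n: "0 < b ^ m" using b by simp
  have "integral\<^sup>L (perm_space b) (est b m)
     = (\<integral>u. (strat_sum \<phi> (b ^ m) u) / real (b ^ m) \<partial>strat_space (b ^ m))"
    unfolding est_def[abs_def] by (rule integral_scr_transfer[OF b borel_\<phi>, of "\<lambda>x. x / real (b ^ m)"]) measurable
  also have "\<dots> = mean_f0" using n by (simp add: strat_expectation[OF n, simplified])
  finally show ?thesis .
qed

lemma est_variance:
  assumes b: "2 \<le> b"
  shows "(\<integral>\<omega>. (est b m \<omega> - mean_f0)\<^sup>2 \<partial>perm_space b) = strat_var (b ^ m)"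
proof -
  let ?n = "b ^ m"
  let ?T = "\<lambda>u. \<Sum>k<?n. \<phi> ((real k + u k) / real ?n)"
  have n: "0 < ?n" using b by simp
  obtain B where B: "0 \<le> B" "\<And>x. \<bar>\<phi> x\<bar> \<le> B" using \<phi>_bounded by blast
  have "(\<integral>\<omega>. (est b m \<omega> - mean_f0)\<^sup>2 \<partial>perm_space b) = (\<integral>u. (?T u / real ?n - mean_f0)\<^sup>2 \<partial>strat_space ?n)"
    unfolding est_def by (rule integral_scr_transfer[OF b borel_\<phi>, of "\<lambda>x. (x / real ?n - mean_f0)\<^sup>2"]) measurable
  also have "\<dots> = (\<integral>u. (?T u - real ?n * mean_f0)\<^sup>2 / (real ?n)\<^sup>2 \<partial>strat_space ?n)"
    using n by (intro Bochner_Integration.integral_cong refl) (simp add: power_divide[symmetric] diff_divide_distrib)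
  also have "\<dots> = (\<integral>u. (?T u - real ?n * mean_f0)\<^sup>2 \<partial>strat_space ?n) / (real ?n)\<^sup>2"
    by (rule integral_divide_zero)
  also have "(\<integral>u. (?T u - real ?n * mean_f0)\<^sup>2 \<partial>strat_space ?n) = real ?n * (\<Sum>k<?n. stratum_dev \<phi> ?n k)"
    using variance_strat_sum[OF borel_\<phi> B(2) n] by (simp only: strat_expectation[OF n])
  finally show ?thesis using n by (simp add: strat_var_def power2_eq_square)
qed

lemma strat_var_lower:
  "\<forall>\<^sub>F n in sequentially. \<sigma>2 * var_rate CARD('n) n / real n \<le> strat_var n"
  using sum_stratum_dev_asymp
  by eventually_elim (simp add: strat_var_def divide_right_mono)

lemma filterlim_base_power: "2 \<le> b \<Longrightarrow> filterlim (\<lambda>m. b ^ m :: nat) sequentially sequentially"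
proof (rule filterlim_at_top_mono[OF filterlim_ident])
  assume b: "2 \<le> b"
  have "m \<le> b ^ m" for m
    using less_exp[of m] power_mono[of 2 b m] b by linarith
  then show "\<forall>\<^sub>F m in sequentially. m \<le> b ^ m" by simp
qed

text \<open>This is the standard deviation of the sum of the n terms. By the variance bound it is at
  least of order n^(1/2 - 1/d), an exponent that is positive for d > 2.\<close>

lemma strat_scale_at_top:
  assumes d: "2 < CARD('n)"
  shows "filterlim (\<lambda>n. real n * sqrt (strat_var n)) at_top sequentially"
proof (rule filterlim_at_top_mono)
  define c where "c = \<sigma>2 * (2 powr (- 2 / real CARD('n) - real CARD('n)) / 96)"
  have c: "0 < c" using nonconst by (simp add: c_def \<sigma>2_def)
  define a where "a = 1 - 2 / real CARD('n)"
  have a: "0 < a" using d by (simp add: a_def)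
  have ev: "\<forall>\<^sub>F n in sequentially. exp (a * ln (real n)) = real n powr a"
    using eventually_gt_at_top[of 0] by eventually_elim (simp add: powr_def)
  have "filterlim (\<lambda>n. exp (a * ln (real n))) at_top sequentially"
    by (intro filterlim_compose[OF exp_at_top] filterlim_tendsto_pos_mult_at_top[OF tendsto_const a]
        filterlim_compose[OF ln_at_top filterlim_real_sequentially])
  then have "filterlim (\<lambda>n. real n powr a) at_top sequentially"
    by (rule filterlim_cong[OF refl refl ev, THEN iffD1])
  then have "filterlim (\<lambda>n. c * real n powr a) at_top sequentially"
    by (rule filterlim_tendsto_pos_mult_at_top[OF tendsto_const c])
  then show "filterlim (\<lambda>n. sqrt (c * real n powr a)) at_top sequentially"
    by (rule filterlim_compose[OF sqrt_at_top])
  show "\<forall>\<^sub>F n in sequentially. sqrt (c * real n powr a) \<le> real n * sqrt (strat_var n)"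
    using strat_var_lower eventually_gt_at_top[of 0]
  proof eventually_elim
    case (elim n)
    have "c * real n powr a = real n * real n * (\<sigma>2 * var_rate CARD('n) n / real n)"
      using elim(2) by (simp add: c_def a_def var_rate_def powr_diff powr_minus_divide mult_ac)
    also have "\<dots> \<le> real n * real n * strat_var n" using elim(1) by (intro mult_left_mono) auto
    finally have "sqrt (c * real n powr a) \<le> sqrt (real n * real n * strat_var n)" by simp
    then show ?case by (simp add: real_sqrt_mult)
  qed
qed

text \<open>Each term deviates from its mean by at most 2B while the normaliser \<open>D\<close>
  tends to infinity, so the normalised terms are uniformly small. The limit theorem is applied to
  the stratified sum, and equality of laws carries it to the scrambled one.\<close>

theorem est_clt:
  assumes b: "2 \<le> b" and d: "2 < CARD('n)"
  shows "weak_conv_m (\<lambda>m. distr (perm_space b) borel (\<lambda>\<omega>. (est b m \<omega> - mean_f0) / sqrt (strat_var (b ^ m))))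
     std_normal_distribution"
proof -
  obtain B where B: "0 \<le> B" "\<And>x. \<bar>\<phi> x\<bar> \<le> B" using \<phi>_bounded by blast
  define N where "N m = b ^ m" for m
  have N: "0 < N m" for m using b by (simp add: N_def)
  define D where "D m = real (N m) * sqrt (strat_var (N m))" for m
  have D0: "0 \<le> D m" for m by (simp add: D_def strat_var_nonneg)
  have D_top: "filterlim D at_top sequentially"
    unfolding D_def N_def by (rule filterlim_compose[OF strat_scale_at_top[OF d] filterlim_base_power[OF b]])
  define c where "c m k = stratum_mean \<phi> (N m) k" for m k
  define val where "val m k u = \<phi> ((real k + u k) / real (N m))" for m k and u :: "nat \<Rightarrow> real"
  define Z where "Z m k u = (val m k u - c m k) / D m" for m k and u :: "nat \<Rightarrow> real"
  note strat = borel_\<phi> B(2) N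
  have ex: "integral\<^sup>L (strat_space (N m)) (val m k) = c m k" if "k < N m" for m k
    unfolding val_def c_def using expectation_strat_val[OF strat that] by simp
  have int: "integrable (strat_space (N m)) (val m k)" if "k < N m" for m k
    unfolding val_def using strat_val_integrable[OF strat that] by simp
  have sum_c: "(\<Sum>k<N m. c m k) = real (N m) * mean_f0" for m
  proof -
    have "(\<Sum>k<N m. c m k) = (\<Sum>k<N m. integral\<^sup>L (strat_space (N m)) (val m k))" by (simp add: ex)
    also have "\<dots> = (\<integral>u. (\<Sum>k<N m. val m k u) \<partial>strat_space (N m))"
      using int by (intro Bochner_Integration.integral_sum[symmetric]) auto
    also have "\<dots> = real (N m) * mean_f0" unfolding val_def by (rule strat_expectation[OF N])
    finally show ?thesis .
  qed
  have Zsum: "(\<Sum>k<N m. Z m k u) = ((\<Sum>k<N m. val m k u) / real (N m) - mean_f0) / sqrt (strat_var (N m))" for m u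
  proof -
    have "(\<Sum>k<N m. Z m k u) = ((\<Sum>k<N m. val m k u) - real (N m) * mean_f0) / D m"
      unfolding Z_def sum_divide_distrib[symmetric] sum_subtractf sum_c ..
    also have "(\<Sum>k<N m. val m k u) - real (N m) * mean_f0 = real (N m) * ((\<Sum>k<N m. val m k u) / real (N m) - mean_f0)"
      using N[of m] by (simp add: right_diff_distrib)
    finally show ?thesis using N[of m] by (simp add: D_def)
  qed
  have "weak_conv_m (\<lambda>m. distr (strat_space (N m)) borel (\<lambda>u. \<Sum>k<N m. Z m k u)) std_normal_distribution"
  proof (rule lindeberg_clt_bounded[where e="\<lambda>m. 2 * B / D m"])
    show "prob_space (strat_space (N m))" for m by (rule prob_space_strat)
    show "prob_space.indep_vars (strat_space (N m)) (\<lambda>_. borel) (Z m) {..<N m}" for m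
      unfolding Z_def[abs_def] val_def
      by (rule prob_space.indep_vars_compose2[OF prob_space_strat indep_strat_val[OF strat], of m "\<lambda>k y. (y - c m k) / D m"]) simp
    show "integral\<^sup>L (strat_space (N m)) (Z m k) = 0" if "k \<in> {..<N m}" for m k
    proof -
      interpret prob_space "strat_space (N m)" by (rule prob_space_strat)
      have "k < N m" using that by simp
      then show ?thesis unfolding Z_def using int ex by (simp add: prob_space)
    qed
    show "\<bar>Z m k u\<bar> \<le> 2 * B / D m" if "k \<in> {..<N m}" for m k u
    proof -
      have "k < N m" using that by simp
      then have "\<bar>c m k\<bar> \<le> B" unfolding c_def by (rule stratum_mean_abs_le[OF strat])
      then have "\<bar>val m k u - c m k\<bar> \<le> 2 * B" using B(2)[of "(real k + u k) / real (N m)"] unfolding val_def by linarith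
      then show ?thesis unfolding Z_def abs_divide using D0[of m] by (simp add: divide_right_mono)
    qed
    show "(\<lambda>m. 2 * B / D m) \<longlonglongrightarrow> 0"
      by (rule tendsto_divide_0[OF tendsto_const filterlim_at_top_imp_at_infinity[OF D_top]])
    \<comment> \<open>For small m the variance may be 0, and division by \<open>D m\<close> then
      gives 0; unit total variance is claimed for large m.\<close>
    have "\<forall>\<^sub>F m in sequentially. 0 < D m" using D_top by (rule filterlim_at_top_dense[THEN iffD1, rule_format])
    then show "\<forall>\<^sub>F m in sequentially. (\<Sum>k<N m. \<integral>u. (Z m k u)\<^sup>2 \<partial>strat_space (N m)) = 1"
    proof eventually_elim
      case (elim m)
      have "(\<Sum>k<N m. \<integral>u. (Z m k u)\<^sup>2 \<partial>strat_space (N m)) = (\<Sum>k<N m. real (N m) * stratum_dev \<phi> (N m) k / (D m)\<^sup>2)"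
      proof (intro sum.cong refl)
        fix k assume "k \<in> {..<N m}"
        then have k: "k < N m" by simp
        have "(\<integral>u. (Z m k u)\<^sup>2 \<partial>strat_space (N m)) = (\<integral>u. (val m k u - c m k)\<^sup>2 \<partial>strat_space (N m)) / (D m)\<^sup>2"
          unfolding Z_def power_divide by (rule integral_divide_zero)
        also have "(\<integral>u. (val m k u - c m k)\<^sup>2 \<partial>strat_space (N m)) = real (N m) * stratum_dev \<phi> (N m) k"
          using variance_strat_val[OF strat k] ex[OF k] unfolding val_def by simp
        finally show "(\<integral>u. (Z m k u)\<^sup>2 \<partial>strat_space (N m)) = real (N m) * stratum_dev \<phi> (N m) k / (D m)\<^sup>2" .
      qed
      also have "\<dots> = real (N m) * (\<Sum>k<N m. stratum_dev \<phi> (N m) k) / (D m)\<^sup>2"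
        by (simp add: sum_distrib_left sum_divide_distrib)
      also have "real (N m) * (\<Sum>k<N m. stratum_dev \<phi> (N m) k) = (D m)\<^sup>2"
      proof -
        have "(D m)\<^sup>2 = (real (N m))\<^sup>2 * strat_var (N m)"
          using strat_var_nonneg by (simp add: D_def power_mult_distrib)
        then show ?thesis using N[of m] by (simp add: strat_var_def power2_eq_square)
      qed
      finally show ?case using elim by simp
    qed
  qed simp
  moreover have "distr (strat_space (N m)) borel (\<lambda>u. \<Sum>k<N m. Z m k u)
      = distr (perm_space b) borel (\<lambda>\<omega>. (est b m \<omega> - mean_f0) / sqrt (strat_var (b ^ m)))" for m
    unfolding Zsum unfolding val_def N_def est_def
    by (rule distr_scr_transfer[OF b borel_\<phi>, of "\<lambda>x. (x / real (b ^ m) - mean_f0) / sqrt (strat_var (b ^ m))", symmetric]) measurable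
  ultimately show ?thesis by simp
qed

end

section \<open>Passage from the Borel version to f on the completed space\<close>

theorem theorem3:
  fixes g :: "real ^ 'd \<Rightarrow> real" and Dg :: "real ^ 'd \<Rightarrow> real ^ 'd"
    and \<Omega> :: "(real ^ 'd) set" and f :: "real ^ 'd \<Rightarrow> real"
    and b :: nat and \<mu> \<sigma>2 :: real
  assumes b: "b \<ge> 2"
    and g_C1: "\<forall>x\<in>cbox 0 1. (g has_derivative (\<lambda>h. Dg x \<bullet> h)) (at x within cbox 0 1)"
    and Dg_cont: "continuous_on (cbox 0 1) Dg"
    and \<Omega>_sub: "\<Omega> \<subseteq> cbox 0 1"
    and mink: "has_minkowski_content (frontier \<Omega>)"
    and f_def: "f = (\<lambda>x. g x * indicator \<Omega> x)"
    and \<mu>_def: "\<mu> = (LINT x:cbox 0 1|lebesgue. f x)"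
    and \<sigma>2_def: "\<sigma>2 = (LINT x:\<Omega>|lebesgue. (norm (Dg x))\<^sup>2)"
    and \<sigma>2_pos: "\<sigma>2 > 0"
  shows "(\<forall>\<^sub>F m in sequentially.
            var (scr_space b) (hsfc_est b m f)
              \<ge> \<sigma>2 / 96 * 2 powr (- 2 / real CARD('d) - real CARD('d))
                  * real (b ^ m) powr (- 1 - 2 / real CARD('d)))
       \<and> (CARD('d) > 2 \<longrightarrow>
            weak_conv_m
              (\<lambda>m. distr (scr_space b) borel
                     (\<lambda>\<omega>. (hsfc_est b m f \<omega> - \<mu>) / sqrt (var (scr_space b) (hsfc_est b m f))))
              std_normal_distribution)"
proof -
  let ?W = "interior \<Omega>"
  have null: "frontier \<Omega> \<in> null_sets lborel"
    by (intro minkowski_null mink compact_frontier_bounded bounded_subset[OF bounded_cbox \<Omega>_sub])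
  have ae: "AE x in lborel. x \<notin> frontier \<Omega>" by (rule AE_not_in[OF null])
  \<comment> \<open>Off the frontier \<Omega> and its interior agree, so a null frontier makes the
    two indicators equal almost everywhere.\<close>
  have W_iff: "x \<in> \<Omega> \<longleftrightarrow> x \<in> ?W" if "x \<notin> frontier \<Omega>" for x
    using that interior_subset[of \<Omega>] closure_subset[of \<Omega>] by (auto simp: frontier_def)
  have W_sub: "?W \<subseteq> cbox 0 1" using interior_subset \<Omega>_sub by blast
  have D_borel: "(\<lambda>x. indicator ?W x *\<^sub>R (norm (Dg x))\<^sup>2) \<in> borel_measurable lborel"
  proof -
    have "continuous_on ?W (\<lambda>x. (norm (Dg x))\<^sup>2)"
      by (intro continuous_intros continuous_on_subset[OF Dg_cont W_sub])
    then have "(\<lambda>x. indicator ?W x *\<^sub>R (norm (Dg x))\<^sup>2) \<in> borel_measurable borel"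
      by (intro borel_measurable_continuous_on_indicator) simp
    then show ?thesis by simp
  qed
  have \<sigma>2_eq: "\<sigma>2 = (LINT x:?W|lborel. (norm (Dg x))\<^sup>2)"
    unfolding \<sigma>2_def set_lebesgue_integral_def
    by (rule integral_completion_AE[OF D_borel]) (use ae W_iff in \<open>auto elim!: eventually_mono simp: indicator_def\<close>)
  interpret c1: c1_on_open g Dg ?W
  proof
    show "(\<lambda>k. measure lborel (?W - (\<Union>h\<in>{h. h < 2 ^ (CARD('d) * k) \<and> hilbert_cube k h \<subseteq> ?W}. hilbert_cube k h))) \<longlonglongrightarrow> 0"
      by (rule interior_exhausted_by_cells[OF \<Omega>_sub mink])
  qed (use g_C1 Dg_cont W_sub \<sigma>2_pos \<sigma>2_eq in auto)
  have \<sigma>2_c1: "c1.\<sigma>2 = \<sigma>2" by (simp add: c1.\<sigma>2_def \<sigma>2_eq)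
  have f_f0: "f x = c1.f0 x" if "x \<notin> frontier \<Omega>" for x
    using W_iff[OF that] by (simp add: f_def c1.f0_def indicator_def)
  have \<mu>_eq: "\<mu> = c1.mean_f0"
    unfolding \<mu>_def c1.mean_f0_def set_lebesgue_integral_def
  proof (rule integral_completion_AE)
    show "(\<lambda>x. indicator (cbox 0 1) x *\<^sub>R c1.f0 x) \<in> borel_measurable lborel" by measurable
    show "AE x in lborel. indicator (cbox 0 1) x *\<^sub>R f x = indicator (cbox 0 1) x *\<^sub>R c1.f0 x"
      using ae by eventually_elim (simp add: f_f0)
  qed
  \<comment> \<open>Almost surely no scrambled point is mapped into the frontier, so f may be
    replaced by \<open>c1.f0\<close> at all n points at once.\<close>
  have est_ae: "AE \<omega> in perm_space b. hsfc_est b m f \<omega> = c1.est b m \<omega>" for m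
    using AE_scr_avoids_null[OF b null, of m]
    by eventually_elim (simp add: hsfc_est_def c1.est_def c1.\<phi>_def f_f0)
  have scr: "scr_space b = completion (perm_space b)" by (simp add: scr_space_def)
  have mean: "integral\<^sup>L (scr_space b) (hsfc_est b m f) = c1.mean_f0" for m
    unfolding scr using integral_completion_AE[OF c1.borel_est est_ae] c1.est_expectation[OF b] by simp
  have var: "var (scr_space b) (hsfc_est b m f) = c1.strat_var (b ^ m)" for m
  proof -
    have "var (scr_space b) (hsfc_est b m f) = (\<integral>\<omega>. (c1.est b m \<omega> - c1.mean_f0)\<^sup>2 \<partial>perm_space b)"
      unfolding var_def mean unfolding scr
    proof (rule integral_completion_AE)
      show "AE \<omega> in perm_space b. (hsfc_est b m f \<omega> - c1.mean_f0)\<^sup>2 = (c1.est b m \<omega> - c1.mean_f0)\<^sup>2"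
        using est_ae[of m] by eventually_elim simp
    qed measurable
    then show ?thesis by (simp only: c1.est_variance[OF b])
  qed
  show ?thesis
  proof (intro conjI impI)
    have "\<forall>\<^sub>F m in sequentially. c1.\<sigma>2 * var_rate CARD('d) (b ^ m) / real (b ^ m) \<le> c1.strat_var (b ^ m)"
      by (rule eventually_compose_filterlim[OF c1.strat_var_lower c1.filterlim_base_power[OF b]])
    then show "\<forall>\<^sub>F m in sequentially.
            var (scr_space b) (hsfc_est b m f)
              \<ge> \<sigma>2 / 96 * 2 powr (- 2 / real CARD('d) - real CARD('d))
                  * real (b ^ m) powr (- 1 - 2 / real CARD('d))"
    proof eventually_elim
      case (elim m)
      have "real (b ^ m) > 0" using b by simp
      then have "\<sigma>2 / 96 * 2 powr (- 2 / real CARD('d) - real CARD('d)) * real (b ^ m) powr (- 1 - 2 / real CARD('d))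
          = c1.\<sigma>2 * var_rate CARD('d) (b ^ m) / real (b ^ m)"
        unfolding var_rate_def \<sigma>2_c1
        by (simp add: powr_diff powr_minus_divide del: of_nat_power)
      then show ?case using elim var by simp
    qed
  next
    assume d: "2 < CARD('d)"
    have "distr (scr_space b) borel (\<lambda>\<omega>. (hsfc_est b m f \<omega> - \<mu>) / sqrt (var (scr_space b) (hsfc_est b m f)))
        = distr (perm_space b) borel (\<lambda>\<omega>. (c1.est b m \<omega> - c1.mean_f0) / sqrt (c1.strat_var (b ^ m)))" for m
      unfolding var \<mu>_eq unfolding scr
    proof (rule distr_completion_AE)
      show "AE \<omega> in perm_space b. (hsfc_est b m f \<omega> - c1.mean_f0) / sqrt (c1.strat_var (b ^ m))
          = (c1.est b m \<omega> - c1.mean_f0) / sqrt (c1.strat_var (b ^ m))"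
        using est_ae[of m] by eventually_elim simp
    qed measurable
    then show "weak_conv_m
              (\<lambda>m. distr (scr_space b) borel
                     (\<lambda>\<omega>. (hsfc_est b m f \<omega> - \<mu>) / sqrt (var (scr_space b) (hsfc_est b m f))))
              std_normal_distribution"
      using c1.est_clt[OF b d] by simp
  qed
qed

end
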